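(* Let $p$ be an odd prime, let $S$ be a finite $p$-group which is not cyclic, and let $\mathcal{G} \leq \mathcal{F}$ be two saturated fusion systems on $S$. Suppose that $\mathrm{Hom}_{\mathcal{G}}(A,B) = \mathrm{Hom}_{\mathcal{F}}(A,B)$ for all subgroups $A,B \leq S$ such that $A$ and $B$ are elementary abelian $p$-groups of rank at least $2$. Then $\mathcal{G} = \mathcal{F}$.
   Context: A fusion system $\mathcal{F}$ over (or on) a finite $p$-group $S$ is a category whose objects are the subgroups of $S$, and whose morphism sets $\mathrm{Hom}_{\mathcal{F}}(P,Q)$ (with composition being composition of maps) satisfy: (a) $\mathrm{Hom}_{S}(P,Q)\subseteq \mathrm{Hom}_{\mathcal{F}}(P,Q)\subseteq \mathrm{Inj}(P,Q)$ for all $P,Q\leq S$, where $\mathrm{Hom}_S(P,Q)$ is the set of homomorphisms $P\to Q$ induced by conjugation by elements of $S$ and $\mathrm{Inj}(P,Q)$ is the set of injective group homomorphisms $P \to Q$; (b) every morphism in $\mathcal{F}$ factors as an isomorphism in $\mathcal{F}$ followed by an inclusion. Write $\mathrm{Aut}_{\mathcal{F}}(P)=\mathrm{Hom}_{\mathcal{F}}(P,P)$, $\mathrm{Aut}_S(P)=\mathrm{Hom}_S(P,P)$, and $\mathrm{Iso}_{\mathcal{F}}(Q,P)$ for the set of isomorphisms from $Q$ to $P$ in $\mathcal{F}$. Two subgroups of $S$ are $\mathcal{F}$-conjugate if they are isomorphic as objects of $\mathcal{F}$. A subgroup $P\leq S$ is fully automised in $\mathcal{F}$ if $\mathrm{Aut}_{S}(P)$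 is a Sylow $p$-subgroup of $\mathrm{Aut}_{\mathcal{F}}(P)$. A subgroup $P\leq S$ is receptive in $\mathcal{F}$ if for each $Q\leq S$ and each $\varphi\in \mathrm{Iso}_{\mathcal{F}}(Q,P)$, setting $N_{\varphi}=\{g\in N_{S}(Q) \mid \varphi\circ c_{g}\circ\varphi^{-1}\in \mathrm{Aut}_{S}(P)\}$ (where $c_g$ is conjugation by $g$), there is $\overline{\varphi}\in \mathrm{Hom}_{\mathcal{F}}(N_{\varphi},S)$ with $\overline{\varphi}|_{Q}=\varphi$. The fusion system $\mathcal{F}$ is saturated if each subgroup of $S$ is $\mathcal{F}$-conjugate to a subgroup which is fully automised and receptive in $\mathcal{F}$. For two fusion systems $\mathcal{G},\mathcal{F}$ on the same $S$, $\mathcal{G}\leq\mathcal{F}$ means $\mathrm{Hom}_{\mathcal{G}}(P,Q)\subseteq \mathrm{Hom}_{\mathcal{F}}(P,Q)$ for all $P,Q\leq S$, and $\mathcal{G}=\mathcal{F}$ means equality of these sets for all $P,Q\leq S$. The rank of an elementary abelian $p$-group is its dimension over $\mathbb{F}_p$. *)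

theory Defs
  imports
    "HOL-Algebra.Group_Action"
    "HOL-Algebra.Elementary_Groups"
    "HOL-Algebra.FiniteProduct"
    "HOL-Algebra.Sylow"
begin

section \<open>Finite p-groups, Sylow subgroups, elementary abelian groups\<close>

locale finite_p_group = group S for S (structure) +
  fixes p :: nat
  assumes prime_p: "prime p"
    and order_prime_power: "\<exists>n. order S = p ^ n"

definition sylow_subgroup :: "nat \<Rightarrow> 'a set \<Rightarrow> ('a, 'b) monoid_scheme \<Rightarrow> bool" where
  "sylow_subgroup p H G \<longleftrightarrow>
     finite (carrier G) \<and> subgroup H G \<and> card H = p ^ multiplicity p (order G)"

definition elementary_abelian :: "nat \<Rightarrow> ('a, 'b) monoid_scheme \<Rightarrow> bool" where
  "elementary_abelian p E \<longleftrightarrow>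
     comm_group E \<and> (\<forall>x \<in> carrier E. x [^]\<^bsub>E\<^esub> p = \<one>\<^bsub>E\<^esub>)"

text \<open>
  In an elementary abelian p-group, written multiplicatively, the scalar in the field of p elements
  represented by \<open>k \<in> {..<p}\<close> acts by \<open>x \<mapsto> x [^] k\<close>, so linear combinations are products of powers.
  A finite set is a basis if each element is a linear combination of it in exactly one way.
\<close>

definition fp_basis :: "nat \<Rightarrow> ('a, 'b) monoid_scheme \<Rightarrow> 'a set \<Rightarrow> bool" where
  "fp_basis p E B \<longleftrightarrow>
     finite B \<and> B \<subseteq> carrier E \<and>
     bij_betw (\<lambda>c. \<Otimes>\<^bsub>E\<^esub>b\<in>B. b [^]\<^bsub>E\<^esub> c b) (B \<rightarrow>\<^sub>E {..<p}) (carrier E)"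

definition fp_rank :: "nat \<Rightarrow> ('a, 'b) monoid_scheme \<Rightarrow> nat" where
  "fp_rank p E = (THE n. \<exists>B. fp_basis p E B \<and> card B = n)"


section \<open>Fusion systems\<close>

text \<open>
  A fusion system is given by its morphism sets, indexed by source and target.  Morphisms
  out of \<open>P\<close> are functions that are \<^const>\<open>extensional\<close> on \<open>P\<close>, so that equality of functions
  is equality of maps on \<open>P\<close>.  Only the values at subgroups of \<open>S\<close> are meaningful; all
  quantifiers below are restricted accordingly.
\<close>

type_synonym 'a hom_family = "'a set \<Rightarrow> 'a set \<Rightarrow> ('a \<Rightarrow> 'a) set"

definition conj_map :: "('a, 'b) monoid_scheme \<Rightarrow> 'a \<Rightarrow> 'a set \<Rightarrow> 'a \<Rightarrow> 'a" where
  "conj_map S g P = (\<lambda>x\<in>P. g \<otimes>\<^bsub>S\<^esub> x \<otimes>\<^bsub>S\<^esub> inv\<^bsub>S\<^esub> g)"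

definition conj_hom :: "('a, 'b) monoid_scheme \<Rightarrow> 'a hom_family" where
  "conj_hom S P Q = {conj_map S g P | g. g \<in> carrier S \<and> conj_map S g P \<in> P \<rightarrow> Q}"

definition inj_hom :: "('a, 'b) monoid_scheme \<Rightarrow> 'a hom_family" where
  "inj_hom S P Q = mon (S\<lparr>carrier := P\<rparr>) (S\<lparr>carrier := Q\<rparr>) \<inter> extensional P"

definition fusion_iso :: "'a hom_family \<Rightarrow> 'a hom_family" where
  "fusion_iso F P Q =
     {\<phi> \<in> F P Q. \<exists>\<psi> \<in> F Q P. compose P \<psi> \<phi> = (\<lambda>x\<in>P. x) \<and> compose Q \<phi> \<psi> = (\<lambda>x\<in>Q. x)}"

text \<open>
  Identities need not be postulated: they are conjugation by the unit.
  Inclusions are likewise morphisms by \<open>conj_hom_subset\<close>.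
\<close>

locale fusion_system = finite_p_group S p for S (structure) and p +
  fixes F :: "'a hom_family"
  assumes conj_hom_subset:
      "\<lbrakk>subgroup P S; subgroup Q S\<rbrakk> \<Longrightarrow> conj_hom S P Q \<subseteq> F P Q"
    and subset_inj_hom:
      "\<lbrakk>subgroup P S; subgroup Q S\<rbrakk> \<Longrightarrow> F P Q \<subseteq> inj_hom S P Q"
    and compose_closed:
      "\<lbrakk>subgroup P S; subgroup Q S; subgroup R S; \<phi> \<in> F P Q; \<psi> \<in> F Q R\<rbrakk>
        \<Longrightarrow> compose P \<psi> \<phi> \<in> F P R"
    and iso_inclusion_factor:
      "\<lbrakk>subgroup P S; subgroup Q S; \<phi> \<in> F P Q\<rbrakk>
        \<Longrightarrow> \<exists>R \<psi>. subgroup R S \<and> R \<subseteq> Q \<and> \<psi> \<in> fusion_iso F P R \<and>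
              \<phi> = compose P (\<lambda>x\<in>R. x) \<psi>"

definition fusion_conj :: "'a hom_family \<Rightarrow> 'a set \<Rightarrow> 'a set \<Rightarrow> bool" where
  "fusion_conj F P Q \<longleftrightarrow> fusion_iso F P Q \<noteq> {}"

definition aut_group :: "'a hom_family \<Rightarrow> 'a set \<Rightarrow> ('a \<Rightarrow> 'a) monoid" where
  "aut_group F P = (BijGroup P)\<lparr>carrier := F P P\<rparr>"

definition fully_automised ::
    "('a, 'b) monoid_scheme \<Rightarrow> nat \<Rightarrow> 'a hom_family \<Rightarrow> 'a set \<Rightarrow> bool" where
  "fully_automised S p F P \<longleftrightarrow> sylow_subgroup p (conj_hom S P P) (aut_group F P)"

text \<open>For \<open>\<phi>\<close> an isomorphism from \<open>Q\<close> to \<open>P\<close>, this is the subgroup usually denoted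
  \<open>N\<^sub>\<phi>\<close>; the composite map is \<open>\<phi> \<circ> c\<^sub>g \<circ> \<phi>\<^sup>-\<^sup>1\<close>.\<close>

definition extender ::
    "('a, 'b) monoid_scheme \<Rightarrow> 'a set \<Rightarrow> 'a set \<Rightarrow> ('a \<Rightarrow> 'a) \<Rightarrow> 'a set" where
  "extender S Q P \<phi> =
     {g \<in> normalizer S Q.
        compose P \<phi> (compose P (conj_map S g Q) (inv_into Q \<phi>)) \<in> conj_hom S P P}"

definition receptive ::
    "('a, 'b) monoid_scheme \<Rightarrow> 'a hom_family \<Rightarrow> 'a set \<Rightarrow> bool" where
  "receptive S F P \<longleftrightarrow>
     (\<forall>Q \<phi>. subgroup Q S \<and> \<phi> \<in> fusion_iso F Q P \<longrightarrow>
        (\<exists>\<phi>' \<in> F (extender S Q P \<phi>) (carrier S). restrict \<phi>' Q = \<phi>))"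

locale saturated_fusion_system = fusion_system +
  assumes saturated:
    "subgroup P S \<Longrightarrow>
      \<exists>Q. subgroup Q S \<and> fusion_conj F P Q \<and> fully_automised S p F Q \<and> receptive S F Q"

definition fusion_le ::
    "('a, 'b) monoid_scheme \<Rightarrow> 'a hom_family \<Rightarrow> 'a hom_family \<Rightarrow> bool" where
  "fusion_le S G F \<longleftrightarrow> (\<forall>P Q. subgroup P S \<and> subgroup Q S \<longrightarrow> G P Q \<subseteq> F P Q)"

definition fusion_eq ::
    "('a, 'b) monoid_scheme \<Rightarrow> 'a hom_family \<Rightarrow> 'a hom_family \<Rightarrow> bool" where
  "fusion_eq S G F \<longleftrightarrow> (\<forall>P Q. subgroup P S \<and> subgroup Q S \<longrightarrow> G P Q = F P Q)"

end

theory Submission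
  imports Defs "HOL-Algebra.Multiplicative_Group" "HOL-Number_Theory.Number_Theory"
begin

text \<open>
  Call a subgroup good if all of its \<open>F\<close>-morphisms lie in \<open>G\<close>, and let \<open>P\<close> be a subgroup all of
  whose larger subgroups are good.  By Sylow and receptivity it suffices to show that
  \<open>Aut\<^sub>F(Q) = Aut\<^sub>G(Q)\<close> for a fully automised and receptive \<open>F\<close>-conjugate \<open>Q\<close> of \<open>P\<close>.

  If \<open>Q\<close> is cyclic then \<open>Q < S\<close>, and every automorphism commutes with conjugation by \<open>N\<^sub>S(Q)\<close> and so
  extends to \<open>N\<^sub>S(Q) > Q\<close>.

  Otherwise, \<open>p\<close> being odd, \<open>Q\<close> has a maximal normal elementary abelian subgroup \<open>E\<close> of rank at
  least two, and no nontrivial automorphism of \<open>Q\<close> of order prime to \<open>p\<close> centralises it.  Hence the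
  automorphisms in \<open>Aut\<^sub>F(Q)\<close> centralising \<open>E\<close> form a \<open>p\<close>-group, which after moving \<open>E\<close> lies in
  \<open>Aut\<^sub>S(Q)\<close>.  For \<open>\<alpha>\<close> in \<open>Aut\<^sub>F(Q)\<close> the restriction of \<open>\<alpha>\<close> to \<open>E\<close> is in \<open>G\<close>.  Extending
  isomorphisms in \<open>G\<close> from \<open>E\<close> and \<open>\<alpha>(E)\<close> to a \<open>G\<close>-receptive conjugate, one may correct \<open>\<alpha>\<close> by
  morphisms of \<open>G\<close> until it centralises \<open>E\<close>, or until it extends to a larger, hence good, subgroup.
\<close>

section \<open>Actions of finite p-groups\<close>

text \<open>The hypothesis provides morphisms of \<open>G\<close> only on elementary abelian
  subgroups, and only receptivity in \<open>G\<close> can lift them to \<open>Q\<close>. Neither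
  \<open>E\<close> nor its image under \<alpha> need be receptive in \<open>G\<close>, so the
  isomorphism between them cannot be lifted directly; both are therefore sent to a third subgroup.
  The two lifts to \<open>Q\<close> are compatible with \<alpha> on \<open>E\<close>, but their
  images in \<open>S\<close> may be different subgroups, and this causes the final alternative.
  Sylow's theorem places the automorphisms fixing \<open>E\<close> inside \<open>Aut_S(Q)\<close>
  only up to conjugacy, which is why \<open>E\<close> moves. A cyclic \<open>Q\<close> contains no
  elementary abelian subgroup of rank two, so the hypothesis says nothing inside it and a separate
  argument is needed. Oddness of \<open>p\<close> excludes groups such as the quaternion group of
  order 8, which is noncyclic but has a single involution. The subgroup \<open>E\<close> takes the
  role usually played by a critical subgroup in the sense of Thompson: it detects automorphisms of
  order prime to \<open>p\<close>.\<close>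

lemma p_action_fixed_points:
  assumes G: "group G" and p: "Factorial_Ring.prime p" and ord: "order G = p ^ n" and fin: "finite X"
    and closed: "\<And>g x. g \<in> carrier G \<Longrightarrow> x \<in> X \<Longrightarrow> a g x \<in> X"
    and one: "\<And>x. x \<in> X \<Longrightarrow> a \<one>\<^bsub>G\<^esub> x = x"
    and mult: "\<And>g h x. g \<in> carrier G \<Longrightarrow> h \<in> carrier G \<Longrightarrow> x \<in> X \<Longrightarrow> a (g \<otimes>\<^bsub>G\<^esub> h) x = a g (a h x)"
  shows "card X mod p = card {x \<in> X. \<forall>g\<in>carrier G. a g x = x} mod p"
proof -
  interpret G: group G by (rule G)
  define \<phi> where "\<phi> g = (\<lambda>x\<in>X. a g x)" for g
  have inv1: "a (inv\<^bsub>G\<^esub> g) (a g x) = x" "a g (a (inv\<^bsub>G\<^esub> g) x) = x" if "g \<in> carrier G" "x \<in> X" for g x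
    using that by (simp_all flip: mult add: one)
  have bij: "\<phi> g \<in> Bij X" if "g \<in> carrier G" for g
  proof -
    have "bij_betw (\<phi> g) X X"
      by (rule bij_betw_byWitness[where f' = "a (inv\<^bsub>G\<^esub> g)"])
         (use that in \<open>auto simp: \<phi>_def inv1 closed\<close>)
    then show ?thesis by (simp add: Bij_def \<phi>_def)
  qed
  have hom: "\<phi> \<in> hom G (BijGroup X)"
  proof (rule homI)
    fix g h assume gh: "g \<in> carrier G" "h \<in> carrier G"
    show "\<phi> (g \<otimes>\<^bsub>G\<^esub> h) = \<phi> g \<otimes>\<^bsub>BijGroup X\<^esub> \<phi> h"
      using gh bij[OF gh(1)] bij[OF gh(2)]
      by (auto simp: BijGroup_def \<phi>_def compose_def fun_eq_iff mult closed)
  qed (simp add: BijGroup_def bij)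
  interpret act: group_action G X \<phi>
    by (intro group_action.intro group_hom.intro group_hom_axioms.intro G group_BijGroup hom)
  define Fix where "Fix = {x \<in> X. \<forall>g\<in>carrier G. a g x = x}"
  have fin_orbits: "finite (orbits G X \<phi>)"
    using fin by (simp add: orbits_def)
  have sum: "card X = (\<Sum>Ob\<in>orbits G X \<phi>. card Ob)"
    using act.disjoint_sum[OF fin, of "\<lambda>_. 1::nat"] by simp
  have orb: "orbit G \<phi> x = {a g x |g. g \<in> carrier G}" if "x \<in> X" for x
    using that by (auto simp: orbit_def \<phi>_def)
  have fixorb: "orbit G \<phi> x = {x}" if "x \<in> Fix" for x
    using that orb[of x] one[of x] G.one_closed by (auto simp: Fix_def) (metis G.one_closed)
  \<comment> \<open>Orbit lengths are powers of \<open>p\<close> by the orbit-stabilizer theorem,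
    and an orbit of length one is a fixed point.\<close>
  have dv: "p dvd card Ob" if Ob: "Ob \<in> orbits G X \<phi> - (\<lambda>x. {x}) ` Fix" for Ob
  proof -
    from Ob obtain x where x: "x \<in> X" "Ob = orbit G \<phi> x" by (auto simp: orbits_def)
    have "card Ob * card (stabilizer G \<phi> x) = p ^ n"
      using act.orbit_stabilizer_theorem[OF x(1)] x(2) ord by simp
    then have "card Ob dvd p ^ n" by (metis dvd_triv_left)
    then obtain k where k: "card Ob = p ^ k" using p by (auto simp: divides_primepow_nat)
    have xO: "x \<in> Ob" using orb[OF x(1)] x one[OF x(1)] G.one_closed by force
    have "card Ob \<noteq> 1"
    proof
      assume "card Ob = 1"
      then have "Ob = {x}" using xO by (metis card_1_singletonE singletonD)
      then have "x \<in> Fix" using orb[OF x(1)] x by (auto simp: Fix_def)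
      then show False using Ob \<open>Ob = {x}\<close> by auto
    qed
    then show ?thesis using k by (cases k) auto
  qed
  have sub: "(\<lambda>x. {x}) ` Fix \<subseteq> orbits G X \<phi>"
    using fixorb by (auto simp: orbits_def Fix_def)
  have "card X = (\<Sum>Ob\<in>orbits G X \<phi> - (\<lambda>x. {x}) ` Fix. card Ob) + (\<Sum>Ob\<in>(\<lambda>x. {x}) ` Fix. card Ob)"
    using sum sum.subset_diff[OF sub fin_orbits] by metis
  moreover have "(\<Sum>Ob\<in>(\<lambda>x. {x}) ` Fix. card Ob) = card Fix"
    by (subst sum.reindex) (auto simp: inj_on_def)
  moreover have "p dvd (\<Sum>Ob\<in>orbits G X \<phi> - (\<lambda>x. {x}) ` Fix. card Ob)"
    using dv by (intro dvd_sum) auto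
  ultimately show ?thesis unfolding Fix_def[symmetric] by (auto elim!: dvdE)
qed

text \<open>\<open>P\<close> acts on the right cosets of \<open>T\<close>, and \<open>T x\<close> is
  fixed exactly when \<open>x P x^-1\<close> lies in \<open>T\<close>. One count serves two
  purposes: a Sylow subgroup \<open>T\<close> gives conjugacy, and \<open>T = P\<close> gives growth
  of normalizers.\<close>

lemma (in group) conjugates_into_subgroup_mod:
  assumes p: "Factorial_Ring.prime p" and fin: "finite (carrier G)" and T: "subgroup T G"
    and P: "subgroup P G" "card P = p ^ n"
  shows "card (rcosets T) mod p
    = card {C \<in> rcosets T. \<exists>x\<in>carrier G. C = T #> x \<and> (\<forall>g\<in>P. x \<otimes> g \<otimes> inv x \<in> T)} mod p"
proof -
  have T': "T \<subseteq> carrier G" and P': "P \<subseteq> carrier G" using T P subgroup.subset by auto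
  have GP: "group (G\<lparr>carrier := P\<rparr>)" using P(1) by (simp add: subgroup_imp_group)
  have inv_P: "inv g \<in> P" if "g \<in> P" for g using P(1) that by (simp add: subgroup.m_inv_closed)
  have "finite (rcosets T)" using rcosets_subset_PowG[OF T] fin by (meson finite_Pow_iff finite_subset)
  moreover have closed: "C #> inv g \<in> rcosets T" if "g \<in> P" "C \<in> rcosets T" for g C
  proof -
    from that obtain x where "x \<in> carrier G" "C = T #> x" by (auto simp: RCOSETS_def)
    moreover have "g \<in> carrier G" using that P' by auto
    ultimately show ?thesis using rcosetsI[OF T', of "x \<otimes> inv g"] T' by (simp add: coset_mult_assoc)
  qed
  \<comment> \<open>Multiplying on the right by \<open>inv g\<close> makes this a left
    action.\<close>
  ultimately have *: "card (rcosets T) mod p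
    = card {C \<in> rcosets T. \<forall>g\<in>carrier (G\<lparr>carrier := P\<rparr>). C #> inv g = C} mod p"
  proof (intro p_action_fixed_points[OF GP p, where a = "\<lambda>g C. C #> inv g"])
    show "order (G\<lparr>carrier := P\<rparr>) = p ^ n" using P by (simp add: order_def)
    fix C assume "C \<in> rcosets T"
    then have C: "C \<subseteq> carrier G" using rcosets_part_G[OF T] by auto
    show "C #> inv \<one>\<^bsub>G\<lparr>carrier := P\<rparr>\<^esub> = C" using C by simp
    fix g h assume "g \<in> carrier (G\<lparr>carrier := P\<rparr>)" "h \<in> carrier (G\<lparr>carrier := P\<rparr>)"
    then have "g \<in> carrier G" "h \<in> carrier G" using P' by auto
    then show "C #> inv (g \<otimes>\<^bsub>G\<lparr>carrier := P\<rparr>\<^esub> h) = C #> inv h #> inv g"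
      using C by (simp add: inv_mult_group coset_mult_assoc)
  qed auto
  have "(\<forall>g\<in>P. C #> inv g = C) \<longleftrightarrow>
      (\<exists>x\<in>carrier G. C = T #> x \<and> (\<forall>g\<in>P. x \<otimes> g \<otimes> inv x \<in> T))" if "C \<in> rcosets T" for C
  proof -
    from that obtain x where x: "x \<in> carrier G" "C = T #> x" by (auto simp: RCOSETS_def)
    have eq: "T #> y #> inv g = T #> y \<longleftrightarrow> y \<otimes> inv g \<otimes> inv y \<in> T" if "g \<in> P" "y \<in> carrier G" for g y
    proof -
      have g: "g \<in> carrier G" using that P' by auto
      have "T #> y #> inv g = T #> (y \<otimes> inv g)" using g that T' by (simp add: coset_mult_assoc)
      moreover have "T #> (y \<otimes> inv g) = T #> y \<longleftrightarrow> y \<otimes> inv g \<in> T #> y"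
        using g that T repr_independence repr_independenceD rcos_self
        by (metis inv_closed m_closed)
      moreover have "y \<otimes> inv g \<in> T #> y \<longleftrightarrow> (y \<otimes> inv g) \<otimes> inv y \<in> T"
        using subgroup.rcos_module[OF T is_group] g that by simp
      ultimately show ?thesis by simp
    qed
    have inv_iff: "(\<forall>g\<in>P. y \<otimes> inv g \<otimes> inv y \<in> T) \<longleftrightarrow> (\<forall>g\<in>P. y \<otimes> g \<otimes> inv y \<in> T)" for y
      using inv_P P' by (metis inv_inv subsetD)
    show ?thesis
    proof
      assume "\<forall>g\<in>P. C #> inv g = C"
      then show "\<exists>x\<in>carrier G. C = T #> x \<and> (\<forall>g\<in>P. x \<otimes> g \<otimes> inv x \<in> T)"
        using x eq[OF _ x(1)] inv_iff[of x] by auto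
    next
      assume "\<exists>x\<in>carrier G. C = T #> x \<and> (\<forall>g\<in>P. x \<otimes> g \<otimes> inv x \<in> T)"
      then show "\<forall>g\<in>P. C #> inv g = C" using eq inv_iff by metis
    qed
  qed
  then have "{C \<in> rcosets T. \<forall>g\<in>P. C #> inv g = C}
    = {C \<in> rcosets T. \<exists>x\<in>carrier G. C = T #> x \<and> (\<forall>g\<in>P. x \<otimes> g \<otimes> inv x \<in> T)}"
    by (intro Collect_cong conj_cong refl) auto
  with * show ?thesis by simp
qed

text \<open>The index of a Sylow subgroup is prime to \<open>p\<close>, so the number of cosets
  fixed by \<open>P\<close> cannot be zero.\<close>

lemma (in group) p_subgroup_conjugate_into_sylow:
  assumes p: "Factorial_Ring.prime p" and T: "sylow_subgroup p T G"
    and P: "subgroup P G" "card P = p ^ n"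
  shows "\<exists>x\<in>carrier G. \<forall>g\<in>P. x \<otimes> g \<otimes> inv x \<in> T"
proof (rule ccontr)
  assume neg: "\<not> ?thesis"
  have fin: "finite (carrier G)" and TG: "subgroup T G" and cT: "card T = p ^ multiplicity p (order G)"
    using T by (auto simp: sylow_subgroup_def)
  have "card (rcosets T) mod p = card ({} :: 'a set set) mod p"
  proof -
    have "{C \<in> rcosets T. \<exists>x\<in>carrier G. C = T #> x \<and> (\<forall>g\<in>P. x \<otimes> g \<otimes> inv x \<in> T)} = {}"
      using neg by auto
    then show ?thesis using conjugates_into_subgroup_mod[OF p fin TG P] by (simp only:)
  qed
  then have "p dvd card (rcosets T)" by auto
  moreover have "card (rcosets T) * p ^ multiplicity p (order G) = order G"
    using lagrange_finite[OF fin TG] cT by simp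
  ultimately have "p ^ Suc (multiplicity p (order G)) dvd order G"
    by (metis mult.commute mult_dvd_mono dvd_refl power_Suc)
  moreover have "order G \<noteq> 0" using fin order_gt_0_iff_finite by auto
  ultimately show False
    using p power_dvd_iff_le_multiplicity[of "order G" p "Suc (multiplicity p (order G))"] not_prime_unit[of p]
    by (metis not_less_eq_eq order_refl)
qed

context finite_p_group
begin

lemma fin [simp]: "finite (carrier S)"
  using order_prime_power prime_p by (metis order_gt_0_iff_finite prime_gt_0_nat zero_less_power)

lemma subgroup_finite: "subgroup H S \<Longrightarrow> finite H"
  using subgroup.subset fin finite_subset by metis

lemma card_subgroup:
  assumes "subgroup H S" obtains k where "card H = p ^ k"
proof -
  obtain n where "order S = p ^ n" using order_prime_power by auto
  then have "card H dvd p ^ n" using lagrange_finite[OF fin assms] by (metis dvd_triv_right)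
  then show ?thesis using prime_p that by (auto simp: divides_primepow_nat)
qed

lemma card_subgroup_less:
  assumes "subgroup H S" "subgroup K S" "H \<subset> K"
  shows "p * card H \<le> card K"
proof -
  obtain i j where ij: "card H = p ^ i" "card K = p ^ j"
    using card_subgroup[OF assms(1)] card_subgroup[OF assms(2)] by metis
  have "card H < card K" using assms subgroup_finite psubset_card_mono by blast
  then have "i < j" using ij prime_p by (metis power_strict_increasing_iff prime_gt_1_nat)
  then have "p ^ Suc i \<le> p ^ j" using prime_p by (intro power_increasing) (use prime_ge_1_nat[of p] in auto)
  then show ?thesis using ij by simp
qed

lemma subgroup_finite_p_group: "subgroup H S \<Longrightarrow> finite_p_group (S\<lparr>carrier := H\<rparr>) p"
  using card_subgroup[of H] prime_p
  by (auto simp: finite_p_group_def finite_p_group_axioms_def subgroup_imp_group order_def)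

lemma prime_dvd_index:
  assumes R: "subgroup R S" "R \<noteq> carrier S"
  shows "p dvd card (rcosets R)"
proof -
  obtain k where k: "card R = p ^ k" using card_subgroup R by metis
  have sub: "R \<subseteq> carrier S" using R subgroup.subset by auto
  have "p * card R \<le> card (rcosets R) * card R"
    using card_subgroup_less[OF R(1) subgroup_self] sub R lagrange_finite[OF fin R(1)]
    by (auto simp: order_def)
  then have gt: "p \<le> card (rcosets R)" using k prime_p by (simp add: prime_gt_0_nat)
  obtain n where n: "order S = p ^ n" using order_prime_power by auto
  have "card (rcosets R) dvd p ^ n" using lagrange_finite[OF fin R(1)] n by (metis dvd_triv_left)
  then obtain j where j: "card (rcosets R) = p ^ j" using prime_p by (auto simp: divides_primepow_nat)
  with gt show "p dvd card (rcosets R)" using prime_p by (cases j) (auto simp: prime_nat_iff)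
qed

text \<open>\<open>R\<close> acts on its own cosets and fixes the coset \<open>R\<close>. Since
  \<open>p\<close> divides the index, the number of fixed cosets is a nonzero multiple of
  \<open>p\<close>, and a second fixed coset supplies \<open>x\<close>.\<close>

lemma normalizer_growth:
  assumes R: "subgroup R S" "R \<noteq> carrier S"
  shows "\<exists>x\<in>carrier S - R. \<forall>r\<in>R. x \<otimes> r \<otimes> inv x \<in> R"
proof -
  obtain k where k: "card R = p ^ k" using card_subgroup R by metis
  have sub: "R \<subseteq> carrier S" using R subgroup.subset by auto
  define X where "X = {C \<in> rcosets R. \<exists>x\<in>carrier S. C = R #> x \<and> (\<forall>g\<in>R. x \<otimes> g \<otimes> inv x \<in> R)}"
  have eq: "card (rcosets R) mod p = card X mod p"
    unfolding X_def by (rule conjugates_into_subgroup_mod[OF prime_p fin R(1) R(1) k])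
  with eq prime_dvd_index[OF R] have dv: "p dvd card X" by auto
  have RX: "R \<in> X"
    unfolding X_def using R sub rcosetsI[OF sub one_closed]
    by (auto intro!: bexI[of _ \<one>] simp: subsetD coset_mult_one)
  have "X \<noteq> {R}" using dv prime_p by auto
  then obtain C where C: "C \<in> X" "C \<noteq> R" using RX by auto
  then obtain x where x: "x \<in> carrier S" "C = R #> x" "\<forall>g\<in>R. x \<otimes> g \<otimes> inv x \<in> R"
    by (auto simp: X_def)
  have "x \<notin> R" using x C coset_join2[OF x(1) R(1)] by auto
  then show ?thesis using x by auto
qed

end

section \<open>Normal subgroups of finite p-groups\<close>

context group
begin

lemma inv_cancel_left: "\<lbrakk>x \<in> carrier G; y \<in> carrier G\<rbrakk> \<Longrightarrow> inv x \<otimes> (x \<otimes> y) = y"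
  by (simp flip: m_assoc)

lemma inv_cancel_right: "\<lbrakk>x \<in> carrier G; y \<in> carrier G\<rbrakk> \<Longrightarrow> x \<otimes> (inv x \<otimes> y) = y"
  by (simp flip: m_assoc)

lemmas word_simps = m_assoc inv_mult_group inv_cancel_left inv_cancel_right

lemma conj_mult:
  "\<lbrakk>g \<in> carrier G; x \<in> carrier G; y \<in> carrier G\<rbrakk>
    \<Longrightarrow> g \<otimes> (x \<otimes> y) \<otimes> inv g = (g \<otimes> x \<otimes> inv g) \<otimes> (g \<otimes> y \<otimes> inv g)"
  by (simp add: word_simps)

lemma conj_pow:
  assumes "g \<in> carrier G" "x \<in> carrier G"
  shows "g \<otimes> x [^] (n::nat) \<otimes> inv g = (g \<otimes> x \<otimes> inv g) [^] n"
proof (induction n)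
  case (Suc n)
  have "g \<otimes> x [^] Suc n \<otimes> inv g = (g \<otimes> x [^] n \<otimes> inv g) \<otimes> (g \<otimes> x \<otimes> inv g)"
    using assms by (simp add: word_simps)
  then show ?case by (simp add: Suc)
qed (use assms in simp)

lemma subgroup_finiteI:
  assumes "finite (carrier G)" "H \<subseteq> carrier G" "H \<noteq> {}" "\<And>x y. x \<in> H \<Longrightarrow> y \<in> H \<Longrightarrow> x \<otimes> y \<in> H"
  shows "subgroup H G"
proof (rule subgroupI)
  fix x assume x: "x \<in> H"
  have pow: "x [^] Suc n \<in> H" for n
    by (induction n) (use x assms in auto)
  have "0 < order G" using assms(1) by (simp add: order_gt_0_iff_finite)
  \<comment> \<open>The exponent \<open>2 * order G\<close> is at least two even in the trivial
    group, so the inverse \<open>x [^] (2 * order G - 1)\<close> is a positive power and is covered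
    by \<open>pow\<close>.\<close>
  then obtain m where m: "2 * order G = Suc (Suc m)" by (cases "order G") auto
  have xG: "x \<in> carrier G" using x assms by auto
  have "x [^] (2 * order G) = \<one>" using xG by (simp add: nat_pow_pow[symmetric] pow_order_eq_1 mult.commute[of 2])
  then have "x [^] Suc m \<otimes> x = \<one>" by (simp add: m)
  then have "inv x = x [^] Suc m" using xG by (intro inv_equality) auto
  then show "inv x \<in> H" using pow by simp
qed (use assms in auto)

lemma subgroup_pow_closed: "subgroup H G \<Longrightarrow> x \<in> H \<Longrightarrow> x [^] (n::nat) \<in> H"
  by (induction n) (auto simp: subgroup.one_closed subgroup.m_closed)

text \<open>Conjugation changes \<open>k\<close> by a commutator, which lies in \<open>M\<close> and
  hence in \<open>K\<close>. This is how intermediate subgroups of a central section are shown to be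
  normal.\<close>

lemma normal_between:
  assumes "subgroup K G" "M \<subseteq> K" "\<And>x k. x \<in> carrier G \<Longrightarrow> k \<in> K \<Longrightarrow> x \<otimes> k \<otimes> inv x \<otimes> inv k \<in> M"
  shows "K \<lhd> G"
proof (rule normal_invI[OF assms(1)])
  fix x k assume xk: "x \<in> carrier G" "k \<in> K"
  then have "k \<in> carrier G" using assms(1) subgroup.subset by auto
  then have "x \<otimes> k \<otimes> inv x = (x \<otimes> k \<otimes> inv x \<otimes> inv k) \<otimes> k"
    using xk by (simp add: word_simps)
  then show "x \<otimes> k \<otimes> inv x \<in> K"
    using assms xk by (metis subgroup.m_closed subsetD)
qed

text \<open>A power computed modulo \<open>M\<close>; working with representatives avoids the
  quotient group.\<close>

lemma mult_pow_mod_normal: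
  assumes M: "M \<lhd> G" and "m \<in> M" "v \<in> carrier G"
  shows "\<exists>m'\<in>M. (m \<otimes> v) [^] (n::nat) = m' \<otimes> v [^] n"
proof (induction n)
  case 0
  then show ?case using subgroup.one_closed[OF normal_imp_subgroup[OF M]] by (auto intro!: bexI[of _ \<one>])
next
  case (Suc n)
  have sub: "subgroup M G" "M \<subseteq> carrier G" using M normal_imp_subgroup subgroup.subset by blast+
  from Suc obtain m' where m': "m' \<in> M" "(m \<otimes> v) [^] n = m' \<otimes> v [^] n" by auto
  have "m \<in> carrier G" "m' \<in> carrier G" using m' assms sub by auto
  then have "(m \<otimes> v) [^] Suc n = (m' \<otimes> (v [^] n \<otimes> m \<otimes> inv (v [^] n))) \<otimes> v [^] Suc n"
    using m' assms by (simp add: word_simps)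
  moreover have "m' \<otimes> (v [^] n \<otimes> m \<otimes> inv (v [^] n)) \<in> M"
    using m' assms sub by (meson nat_pow_closed normal_invE(2) subgroup.m_closed)
  ultimately show ?case by blast
qed

text \<open>The product of \<open>M\<close> with the cyclic group generated by \<open>v\<close>.
  Moving a power of \<open>v\<close> past an element of \<open>M\<close> conjugates that element,
  and in a finite group natural exponents reach the whole cyclic group.\<close>

lemma normal_extend_subgroup:
  assumes fin: "finite (carrier G)" and M: "M \<lhd> G" and v: "v \<in> carrier G"
  shows "subgroup {m \<otimes> v [^] i | m i. m \<in> M \<and> i \<in> (UNIV :: nat set)} G"
proof -
  have sub: "subgroup M G" "M \<subseteq> carrier G" using M normal_imp_subgroup subgroup.subset by blast+
  show ?thesis
  proof (rule subgroup_finiteI[OF fin])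
    show "{m \<otimes> v [^] i | m i. m \<in> M \<and> i \<in> (UNIV :: nat set)} \<subseteq> carrier G" using sub v by auto
    show "{m \<otimes> v [^] i | m i. m \<in> M \<and> i \<in> (UNIV :: nat set)} \<noteq> {}"
      using subgroup.one_closed[OF sub(1)] by auto
    fix x y
    assume "x \<in> {m \<otimes> v [^] i | m i. m \<in> M \<and> i \<in> (UNIV :: nat set)}"
      and "y \<in> {m \<otimes> v [^] i | m i. m \<in> M \<and> i \<in> (UNIV :: nat set)}"
    then obtain m i n j where mi: "m \<in> M" "n \<in> M" "x = m \<otimes> v [^] (i::nat)" "y = n \<otimes> v [^] (j::nat)" by auto
    then have c: "m \<in> carrier G" "n \<in> carrier G" using sub by auto
    have "x \<otimes> y = (m \<otimes> (v [^] i \<otimes> n \<otimes> inv (v [^] i))) \<otimes> v [^] (i + j)"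
      using mi c v by (simp add: word_simps nat_pow_mult[symmetric])
    moreover have "m \<otimes> (v [^] i \<otimes> n \<otimes> inv (v [^] i)) \<in> M"
      using mi v sub M by (meson nat_pow_closed normal_invE(2) subgroup.m_closed)
    ultimately show "x \<otimes> y \<in> {m \<otimes> v [^] i | m i. m \<in> M \<and> i \<in> (UNIV :: nat set)}" by blast
  qed
qed

text \<open>Here \<open>c\<close> is the commutator \<open>y x y^-1 x^-1\<close>, which commutes
  with both elements: each exchange of a \<open>y\<close> with \<open>x\<close> contributes one
  factor \<open>c\<close>.\<close>

lemma pow_mult_class2:
  assumes xy: "x \<in> carrier G" "y \<in> carrier G" "c \<in> carrier G"
    and c: "y \<otimes> x = c \<otimes> x \<otimes> y" "c \<otimes> x = x \<otimes> c" "c \<otimes> y = y \<otimes> c"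
  shows "y [^] (k::nat) \<otimes> x = x \<otimes> y [^] k \<otimes> c [^] k"
proof -
  have cn: "c [^] (k::nat) \<otimes> x = x \<otimes> c [^] k" "c [^] (k::nat) \<otimes> y = y \<otimes> c [^] k" for k
    using xy c by (simp_all add: group_commutes_pow)
  show ?thesis
  proof (induction k)
    case (Suc k)
    have "y [^] Suc k \<otimes> x = y [^] k \<otimes> (y \<otimes> x)" using xy by (simp add: m_assoc)
    also have "\<dots> = y [^] k \<otimes> (x \<otimes> (c \<otimes> y))" using xy c by (simp add: m_assoc)
    also have "\<dots> = (y [^] k \<otimes> x) \<otimes> (y \<otimes> c)" using xy c by (simp add: m_assoc)
    also have "\<dots> = x \<otimes> y [^] k \<otimes> (c [^] k \<otimes> y) \<otimes> c" using xy by (simp add: Suc m_assoc)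
    also have "\<dots> = x \<otimes> y [^] Suc k \<otimes> c [^] Suc k" using xy by (simp add: cn m_assoc)
    finally show ?case .
  qed (use xy in simp)
qed

text \<open>Collecting the factors of \<open>(x y)^n\<close> takes one exchange for each pair
  consisting of a \<open>y\<close> and a later \<open>x\<close>, and there are
  \<open>n * (n - 1) div 2\<close> such pairs.\<close>

lemma mult_pow_class2:
  assumes xy: "x \<in> carrier G" "y \<in> carrier G" "c \<in> carrier G"
    and c: "y \<otimes> x = c \<otimes> x \<otimes> y" "c \<otimes> x = x \<otimes> c" "c \<otimes> y = y \<otimes> c"
  shows "(x \<otimes> y) [^] (n::nat) = x [^] n \<otimes> y [^] n \<otimes> c [^] (n * (n - 1) div 2)"
proof -
  have cn: "c [^] (k::nat) \<otimes> x = x \<otimes> c [^] k" "c [^] (k::nat) \<otimes> y = y \<otimes> c [^] k" for k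
    using xy c by (simp_all add: group_commutes_pow)
  note yn = pow_mult_class2[OF xy c]
  show ?thesis
  proof (induction n)
    case (Suc n)
    define t where "t = n * (n - 1) div 2"
    have t: "Suc n * (Suc n - 1) div 2 = t + n"
    proof -
      have "Suc n * (Suc n - 1) = n * (n - 1) + 2 * n" by (cases n) auto
      then show ?thesis unfolding t_def by simp
    qed
    have "(x \<otimes> y) [^] Suc n = x [^] n \<otimes> y [^] n \<otimes> (c [^] t \<otimes> x) \<otimes> y"
      using xy by (simp add: Suc t_def m_assoc)
    also have "\<dots> = x [^] n \<otimes> (y [^] n \<otimes> x) \<otimes> (c [^] t \<otimes> y)"
      using xy by (simp add: cn m_assoc)
    also have "\<dots> = x [^] Suc n \<otimes> y [^] n \<otimes> (c [^] n \<otimes> y) \<otimes> c [^] t"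
      using xy by (simp add: yn cn(2)[of t] m_assoc)
    also have "\<dots> = x [^] Suc n \<otimes> y [^] Suc n \<otimes> c [^] (t + n)"
      using xy by (simp add: cn(2)[of n] nat_pow_mult m_assoc add.commute)
    finally show ?case unfolding t .
  qed (use xy in simp)
qed

text \<open>For odd \<open>p\<close> the exponent \<open>p * (p - 1) div 2\<close> is a multiple of
  \<open>p\<close>; for \<open>p = 2\<close> it is 1 and the commutator would survive.\<close>

lemma mult_pow_odd_class2:
  assumes xy: "x \<in> carrier G" "y \<in> carrier G" "c \<in> carrier G"
    and c: "y \<otimes> x = c \<otimes> x \<otimes> y" "c \<otimes> x = x \<otimes> c" "c \<otimes> y = y \<otimes> c"
    and p: "odd (p::nat)" "c [^] p = \<one>"
  shows "(x \<otimes> y) [^] p = x [^] p \<otimes> y [^] p"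
proof -
  obtain k where k: "p = 2 * k + 1" using p(1) by (elim oddE)
  then have "p * (p - 1) div 2 = p * k" by simp
  then have "c [^] (p * (p - 1) div 2) = \<one>" using xy p by (simp add: nat_pow_pow[symmetric])
  then show ?thesis using mult_pow_class2[OF xy c, of p] xy by simp
qed

end

section \<open>Central chief factors of finite p-groups\<close>

context finite_p_group
begin

lemma coprime_pow_eq_one:
  assumes "x \<in> carrier S" "x [^] m = \<one>" "coprime m p"
  shows "x = \<one>"
proof -
  obtain n where n: "order S = p ^ n" using order_prime_power by auto
  have "ord x dvd m" using assms pow_eq_id by auto
  moreover have "ord x dvd p ^ n" using assms n ord_dvd_group_order by metis
  ultimately have "ord x = 1" using assms(3)
    by (metis coprime_common_divisor_nat coprime_power_right_iff nat_dvd_1_iff_1 coprime_commute)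
  then show ?thesis using assms(1) ord_eq_1 by auto
qed

text \<open>In terms of quotients, the nontrivial normal subgroup \<open>N / M\<close> of
  \<open>S / M\<close> meets the centre nontrivially. \<open>S\<close> permutes the cosets of
  \<open>M\<close> in \<open>N\<close> by conjugation; their number is divisible by \<open>p\<close>
  and \<open>M\<close> itself is fixed, so a second coset is fixed.\<close>

lemma normal_central_step:
  assumes M: "M \<lhd> S" and N: "N \<lhd> S" and MN: "M \<subset> N"
  shows "\<exists>v\<in>N - M. \<forall>x\<in>carrier S. x \<otimes> v \<otimes> inv x \<otimes> inv v \<in> M"
proof -
  have sub: "subgroup M S" "M \<subseteq> carrier S" "subgroup N S" "N \<subseteq> carrier S"
    using M N normal_imp_subgroup subgroup.subset by blast+
  interpret N: finite_p_group "S\<lparr>carrier := N\<rparr>" p by (rule subgroup_finite_p_group[OF sub(3)])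
  define X where "X = {M #> v | v. v \<in> N}"
  define a where "a g C = (\<lambda>c. g \<otimes> c \<otimes> inv g) ` C" for g C
  have X: "X = rcosets\<^bsub>S\<lparr>carrier := N\<rparr>\<^esub> M" by (auto simp: X_def RCOSETS_def)
  have "subgroup M (S\<lparr>carrier := N\<rparr>)" using subgroup_incl[OF sub(1,3)] MN by auto
  then have pX: "p dvd card X" unfolding X using MN by (intro N.prime_dvd_index) auto
  have a_coset: "a g (M #> v) = M #> (g \<otimes> v \<otimes> inv g)" if "g \<in> carrier S" "v \<in> carrier S" for g v
  proof -
    have 1: "g \<otimes> (m \<otimes> v) \<otimes> inv g \<in> M #> (g \<otimes> v \<otimes> inv g)" if m: "m \<in> M" for m
    proof -
      have "g \<otimes> (m \<otimes> v) \<otimes> inv g = (g \<otimes> m \<otimes> inv g) \<otimes> (g \<otimes> v \<otimes> inv g)"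
        using that \<open>g \<in> carrier S\<close> \<open>v \<in> carrier S\<close> sub m by (intro conj_mult) auto
      then show ?thesis using normal_invE(2)[OF M \<open>g \<in> carrier S\<close> m] by (auto simp: r_coset_def)
    qed
    have 2: "m \<otimes> (g \<otimes> v \<otimes> inv g) \<in> a g (M #> v)" if m: "m \<in> M" for m
    proof -
      have "m \<otimes> (g \<otimes> v \<otimes> inv g) = g \<otimes> ((inv g \<otimes> m \<otimes> g) \<otimes> v) \<otimes> inv g"
        using \<open>g \<in> carrier S\<close> \<open>v \<in> carrier S\<close> subsetD[OF sub(2) m] by (simp add: word_simps)
      moreover have "inv g \<otimes> m \<otimes> g \<in> M"
        using normal.inv_op_closed1[OF M \<open>g \<in> carrier S\<close> m] .
      ultimately show ?thesis by (auto simp: r_coset_def a_def)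
    qed
    from 1 2 show ?thesis by (auto simp: a_def r_coset_def)
  qed
  obtain n where n: "order S = p ^ n" using order_prime_power by auto
  have conjN: "g \<otimes> v \<otimes> inv g \<in> N" if "g \<in> carrier S" "v \<in> N" for g v
    using N that by (simp add: normal_invE)
  have "finite X" using subgroup_finite[OF sub(3)] by (simp add: X_def)
  then have "card X mod p = card {C \<in> X. \<forall>g\<in>carrier S. a g C = C} mod p"
  proof (rule p_action_fixed_points[OF is_group prime_p n])
    fix C assume "C \<in> X"
    then obtain v where v: "v \<in> N" "C = M #> v" "v \<in> carrier S" using sub by (auto simp: X_def)
    show "a \<one> C = C" using v a_coset by simp
    fix g assume g: "g \<in> carrier S"
    show "a g C \<in> X" using v a_coset[OF g] conjN[OF g] by (auto simp: X_def)
    fix h assume h: "h \<in> carrier S"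
    show "a (g \<otimes> h) C = a g (a h C)" using v g h a_coset by (simp add: word_simps)
  qed
  with pX have dv: "p dvd card {C \<in> X. \<forall>g\<in>carrier S. a g C = C}" by auto
  have "M = M #> \<one>" using sub by simp
  then have "M \<in> {C \<in> X. \<forall>g\<in>carrier S. a g C = C}"
    using a_coset[OF _ one_closed] subgroup.one_closed[OF sub(3)] by (auto simp: X_def)
  moreover have "{C \<in> X. \<forall>g\<in>carrier S. a g C = C} \<noteq> {M}" using dv prime_p by auto
  ultimately obtain C where C: "C \<in> X" "C \<noteq> M" "\<forall>g\<in>carrier S. a g C = C" by blast
  from C(1) obtain v where v: "v \<in> N" "C = M #> v" "v \<in> carrier S" using sub by (auto simp: X_def)
  have "v \<notin> M" using C v coset_join2 sub by auto
  moreover have "x \<otimes> v \<otimes> inv x \<otimes> inv v \<in> M" if x: "x \<in> carrier S" for x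
  proof -
    have "M #> (x \<otimes> v \<otimes> inv x) = M #> v" using C v a_coset x by auto
    then have "x \<otimes> v \<otimes> inv x \<in> M #> v" using rcos_self[OF _ sub(1), of "x \<otimes> v \<otimes> inv x"] x v by simp
    then show ?thesis using subgroup.rcos_module[OF sub(1) is_group, of v] x v by simp
  qed
  ultimately show ?thesis using v by blast
qed

text \<open>\<open>N / M\<close> is a chief factor, and chief factors of a finite p-group are
  central of order \<open>p\<close>. The last three clauses express this by elements: centrality,
  exponent \<open>p\<close>, and generation by any element outside \<open>M\<close>.\<close>

lemma maximal_normal_below:
  assumes N: "N \<lhd> S" "N \<noteq> {\<one>}"
  obtains M where "M \<lhd> S" "M \<subset> N"
    "\<And>x n. x \<in> carrier S \<Longrightarrow> n \<in> N \<Longrightarrow> x \<otimes> n \<otimes> inv x \<otimes> inv n \<in> M"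
    "\<And>n. n \<in> N \<Longrightarrow> n [^] p \<in> M"
    "\<And>v n. v \<in> N - M \<Longrightarrow> n \<in> N \<Longrightarrow> \<exists>m\<in>M. \<exists>i. n = m \<otimes> v [^] (i::nat)"
proof -
  have subN: "subgroup N S" "N \<subseteq> carrier S" using N normal_imp_subgroup subgroup.subset by blast+
  define \<M> where "\<M> = {M. M \<lhd> S \<and> M \<subset> N}"
  have "finite \<M>" using subgroup_finite[OF subN(1)] by (auto simp: \<M>_def intro: finite_subset[of _ "Pow N"])
  moreover have "{\<one>} \<in> \<M>" using one_is_normal N subgroup.one_closed[OF subN(1)] by (auto simp: \<M>_def)
  ultimately obtain M where M: "M \<in> \<M>" "\<And>M'. M' \<in> \<M> \<Longrightarrow> M \<subseteq> M' \<Longrightarrow> M = M'"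
    by (metis empty_iff finite_has_maximal)
  have MS: "M \<lhd> S" "M \<subset> N" using M by (auto simp: \<M>_def)
  have subM: "subgroup M S" "M \<subseteq> carrier S" using MS normal_imp_subgroup subgroup.subset by blast+
  have max: "K = N" if "K \<lhd> S" "M \<subset> K" "K \<subseteq> N" for K
    using M(2)[of K] that by (auto simp: \<M>_def)
  obtain v where v: "v \<in> N - M" "\<And>x. x \<in> carrier S \<Longrightarrow> x \<otimes> v \<otimes> inv x \<otimes> inv v \<in> M"
    using normal_central_step[OF MS(1) N(1) MS(2)] by auto
  \<comment> \<open>The elements of \<open>N\<close> that are central modulo \<open>M\<close>. They
    form a normal subgroup containing \<open>v\<close>, which is outside \<open>M\<close>, so
    maximality of \<open>M\<close> makes it all of \<open>N\<close>.\<close>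
  define K where "K = {n \<in> N. \<forall>x\<in>carrier S. x \<otimes> n \<otimes> inv x \<otimes> inv n \<in> M}"
  have "subgroup K S"
  proof (rule subgroup_finiteI[OF fin])
    show "K \<subseteq> carrier S" using subN by (auto simp: K_def)
    show "K \<noteq> {}" using v by (auto simp: K_def)
    fix a b assume ab: "a \<in> K" "b \<in> K"
    then have c: "a \<in> carrier S" "b \<in> carrier S" "a \<otimes> b \<in> N"
      using subN subgroup.m_closed by (auto simp: K_def)
    have "x \<otimes> (a \<otimes> b) \<otimes> inv x \<otimes> inv (a \<otimes> b) \<in> M" if x: "x \<in> carrier S" for x
    proof -
      have "x \<otimes> (a \<otimes> b) \<otimes> inv x \<otimes> inv (a \<otimes> b)
        = (x \<otimes> a \<otimes> inv x \<otimes> inv a) \<otimes> (a \<otimes> (x \<otimes> b \<otimes> inv x \<otimes> inv b) \<otimes> inv a)"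
        using c x by (simp add: word_simps)
      moreover have "x \<otimes> a \<otimes> inv x \<otimes> inv a \<in> M" "x \<otimes> b \<otimes> inv x \<otimes> inv b \<in> M"
        using ab x by (auto simp: K_def)
      ultimately show ?thesis
        using subgroup.m_closed[OF subM(1)] normal_invE(2)[OF MS(1) c(1)] by simp
    qed
    then show "a \<otimes> b \<in> K" using c by (auto simp: K_def)
  qed
  moreover have MK: "M \<subseteq> K"
  proof
    fix m assume m: "m \<in> M"
    have "x \<otimes> m \<otimes> inv x \<otimes> inv m \<in> M" if "x \<in> carrier S" for x
      using normal_invE(2)[OF MS(1) that m] subM m
      by (simp add: subgroup.m_closed subgroup.m_inv_closed)
    then show "m \<in> K" using m MS by (auto simp: K_def)
  qed
  ultimately have "K \<lhd> S" by (rule normal_between) (auto simp: K_def)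
  moreover have "v \<in> K" "v \<notin> M" using v by (auto simp: K_def)
  ultimately have KN: "K = N" using MK by (intro max) (auto simp: K_def)
  have comm: "x \<otimes> n \<otimes> inv x \<otimes> inv n \<in> M" if "x \<in> carrier S" "n \<in> N" for x n
    using that KN by (auto simp: K_def)
  have gen: "\<exists>m\<in>M. \<exists>i. n = m \<otimes> v [^] (i::nat)" if v: "v \<in> N - M" and n: "n \<in> N" for v n
  proof -
    \<comment> \<open>Every subgroup between \<open>M\<close> and \<open>N\<close> is normal because
      the section is central, so \<open>M\<close> and \<open>v\<close> already generate
      \<open>N\<close>.\<close>
    define L where "L = {m \<otimes> v [^] i | m i. m \<in> M \<and> i \<in> (UNIV :: nat set)}"
    have vS: "v \<in> carrier S" using v subN by auto
    have L: "subgroup L S" unfolding L_def by (rule normal_extend_subgroup[OF fin MS(1) vS])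
    have LN: "L \<subseteq> N"
      using v MS subgroup_pow_closed[OF subN(1)] subgroup.m_closed[OF subN(1)] by (auto simp: L_def)
    have "M \<subseteq> L"
    proof
      fix m assume "m \<in> M"
      then have "m = m \<otimes> v [^] (0::nat)" using subM by auto
      then show "m \<in> L" using \<open>m \<in> M\<close> unfolding L_def by blast
    qed
    moreover have "v \<in> L"
    proof -
      have "v = \<one> \<otimes> v [^] (1::nat)" using vS by simp
      then show ?thesis using subgroup.one_closed[OF subM(1)] unfolding L_def by blast
    qed
    moreover have "L \<lhd> S" using comm LN by (intro normal_between[OF L \<open>M \<subseteq> L\<close>]) auto
    ultimately have "L = N" using LN v by (intro max) auto
    then show ?thesis using n by (auto simp: L_def)
  qed
  have "n [^] p \<in> M" if n: "n \<in> N" for n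
  proof -
    \<comment> \<open>The last power \<open>v [^] (p ^ k')\<close> outside \<open>M\<close> is
      \<open>w\<close>. Its \<open>p\<close>-th power lies in \<open>M\<close>, and \<open>w\<close>
      generates \<open>N\<close> modulo \<open>M\<close> just as \<open>v\<close> does, so all
      \<open>p\<close>-th powers from \<open>N\<close> lie in \<open>M\<close>.\<close>
    define k where "k = (LEAST k. v [^] (p ^ k) \<in> M)"
    obtain j where "order S = p ^ j" using order_prime_power by auto
    then have "v [^] (p ^ j) \<in> M" using pow_order_eq_1[of v] v subN subgroup.one_closed[OF subM(1)] by auto
    then have k: "v [^] (p ^ k) \<in> M" unfolding k_def by (rule LeastI)
    have vS: "v \<in> carrier S" using v subN by auto
    have "k \<noteq> 0" using k v vS by (intro notI) auto
    then obtain k' where k': "k = Suc k'" by (cases k) auto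
    define w where "w = v [^] (p ^ k')"
    have "w \<notin> M" using not_less_Least[of k' "\<lambda>k. v [^] (p ^ k) \<in> M"] k' by (auto simp: w_def k_def)
    then have w: "w \<in> N - M" using v subgroup_pow_closed[OF subN(1)] by (auto simp: w_def)
    have wp: "w [^] p \<in> M" using k vS by (simp add: w_def k' nat_pow_pow mult.commute)
    have wS: "w \<in> carrier S" using w subN by auto
    obtain m i where mi: "m \<in> M" "n = m \<otimes> w [^] (i::nat)" using gen[OF w n] by auto
    obtain m' where m': "m' \<in> M" "(m \<otimes> w [^] i) [^] p = m' \<otimes> (w [^] i) [^] p"
      using mult_pow_mod_normal[OF MS(1) mi(1)] wS by (meson nat_pow_closed)
    have "(w [^] i) [^] p = (w [^] p) [^] i" using wS by (simp add: nat_pow_pow mult.commute)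
    then have "(w [^] i) [^] p \<in> M" using subgroup_pow_closed[OF subM(1) wp] by simp
    then show ?thesis using mi m' subgroup.m_closed[OF subM(1)] by simp
  qed
  with MS comm gen show ?thesis by (intro that) auto
qed

end

text \<open>If \<open>k\<close> has order dividing \<open>p\<close> modulo \<open>p ^ n\<close>,
  then \<open>k\<close> is 1 modulo \<open>p ^ (n - 1)\<close>; multiplying by \<open>p\<close>
  states this without the subtraction. The factor \<open>1 + k + ... + k ^ (p - 1)\<close> of
  \<open>k ^ p - 1\<close> is \<open>p\<close> times a number prime to \<open>p\<close>, because
  \<open>p\<close> is odd. With \<open>p = 2\<close>, \<open>k = 3\<close> and \<open>n = 3\<close>
  the second congruence fails.\<close>

lemma prime_power_dvd_lift:
  fixes k p :: nat
  assumes p: "Factorial_Ring.prime p" "odd p" and n: "n \<ge> 1" and k: "[k ^ p = 1] (mod p ^ n)"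
  shows "[k = 1] (mod p)" and "[k * p = p] (mod p ^ n)"
proof -
  have "p dvd p ^ n" using n by (cases n) auto
  then have kp: "[k ^ p = 1] (mod p)" using k cong_dvd_modulus_nat by blast
  have "\<not> p dvd k"
  proof
    assume "p dvd k"
    then have "p dvd k ^ p" using p by (simp add: prime_gt_0_nat dvd_power_iff dvd_trans[OF _ dvd_power])
    then have "p dvd 1" using cong_dvd_iff[OF kp] by simp
    then show False using p by auto
  qed
  then have "[k ^ (p - 1) = 1] (mod p)" using fermat_theorem p by blast
  then have "[k * k ^ (p - 1) = k * 1] (mod p)" by (rule cong_scalar_left)
  moreover have "k * k ^ (p - 1) = k ^ p" using p by (simp add: prime_gt_0_nat flip: power_eq_if)
       (metis One_nat_def Suc_pred power_Suc prime_gt_0_nat)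
  ultimately have "[k = k ^ p] (mod p)" by (simp add: cong_sym)
  then show k1: "[k = 1] (mod p)" using kp cong_trans by blast
  define K where "K = int k"
  have "int p dvd K - 1" using k1 by (metis K_def cong_iff_dvd_diff cong_int_iff of_nat_1)
  then obtain j where j: "K = 1 + int p * j" by (metis add.commute diff_add_cancel dvdE)
  \<comment> \<open>The binomial expansion of \<open>(1 + p * j) ^ i\<close> modulo
    \<open>p ^ 2\<close>.\<close>
  have step: "int p ^ 2 dvd K ^ i - (1 + int i * int p * j)" for i
  proof (induction i)
    case (Suc i)
    have "K ^ Suc i - (1 + int (Suc i) * int p * j)
      = K * (K ^ i - (1 + int i * int p * j)) + int p ^ 2 * (int i * j ^ 2)"
      by (simp add: j algebra_simps power2_eq_square)
    then show ?case using Suc by simp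
  qed simp
  obtain m where m: "p = 2 * m + 1" using p(2) by (elim oddE)
  \<comment> \<open>Oddness makes the linear terms sum to a multiple of \<open>p ^ 2\<close>, so the
    geometric sum is \<open>p\<close> modulo \<open>p ^ 2\<close> and the cofactor \<open>u\<close>
    is 1 modulo \<open>p\<close>.\<close>
  have "(\<Sum>i<p. int i) = int p * int m"
  proof -
    have "2 * (\<Sum>i<q. int i) = int q * (int q - 1)" for q
      by (induction q) (auto simp: algebra_simps)
    from this[of p] show ?thesis by (simp add: m)
  qed
  then have "(\<Sum>i<p. 1 + int i * int p * j) = int p + int p ^ 2 * (int m * j)"
    by (simp add: sum.distrib power2_eq_square flip: sum_distrib_right)
  moreover have "int p ^ 2 dvd (\<Sum>i<p. K ^ i - (1 + int i * int p * j))"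
    using step by (intro dvd_sum) auto
  ultimately have "int p ^ 2 dvd (\<Sum>i<p. K ^ i) - (int p + int p ^ 2 * (int m * j))"
    by (simp add: sum_subtractf)
  then obtain r where r: "(\<Sum>i<p. K ^ i) - (int p + int p ^ 2 * (int m * j)) = int p ^ 2 * r" by (elim dvdE)
  define u where "u = 1 + int p * (int m * j + r)"
  have u: "(\<Sum>i<p. K ^ i) = int p * u" using r by (simp add: u_def algebra_simps power2_eq_square)
  have "coprime u (int p)" 
  proof (rule coprimeI)
    fix c assume "c dvd u" "c dvd int p"
    then have "c dvd u - int p * (int m * j + r)" by (intro dvd_diff) auto
    then show "is_unit c" by (simp add: u_def)
  qed
  then have cop: "coprime (int p ^ n) u" by (simp add: coprime_commute)
  have "[K ^ p = 1] (mod int p ^ n)" using k by (metis K_def cong_int_iff of_nat_1 of_nat_power)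
  then have "int p ^ n dvd K ^ p - 1" by (simp add: cong_iff_dvd_diff)
  also have "K ^ p - 1 = (K - 1) * (\<Sum>i<p. K ^ i)" by (rule power_diff_1_eq)
  also have "\<dots> = u * (K * int p - int p)" by (simp add: u algebra_simps)
  finally have "int p ^ n dvd K * int p - int p" using cop by (simp add: coprime_dvd_mult_right_iff)
  then have "[int (k * p) = int p] (mod int (p ^ n))" by (simp add: cong_iff_dvd_diff K_def)
  then show "[k * p = p] (mod p ^ n)" by (simp only: cong_int_iff)
qed

section \<open>Automorphisms centralising an elementary abelian subgroup\<close>

context group
begin

definition centralizer :: "'a set \<Rightarrow> 'a set" where
  "centralizer K = {c \<in> carrier G. \<forall>k\<in>K. c \<otimes> k = k \<otimes> c}"

lemma centralizer_subgroup:
  assumes K: "K \<subseteq> carrier G"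
  shows "subgroup (centralizer K) G"
proof (rule subgroupI)
  show "centralizer K \<noteq> {}" using K by (auto simp: centralizer_def intro!: exI[of _ \<one>])
  fix x assume x: "x \<in> centralizer K"
  then have xG: "x \<in> carrier G" by (simp add: centralizer_def)
  have "inv x \<otimes> k = k \<otimes> inv x" if "k \<in> K" for k
  proof -
    have k: "k \<in> carrier G" "x \<otimes> k = k \<otimes> x" using x K that by (auto simp: centralizer_def)
    then have "inv x \<otimes> (k \<otimes> x) \<otimes> inv x = k \<otimes> inv x" using xG by (simp add: inv_cancel_left flip: k(2))
    then show ?thesis using xG k(1) by (simp add: word_simps)
  qed
  then show "inv x \<in> centralizer K" using xG by (simp add: centralizer_def)
  fix y assume y: "y \<in> centralizer K"
  then have yG: "y \<in> carrier G" by (simp add: centralizer_def)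
  have "x \<otimes> y \<otimes> k = k \<otimes> (x \<otimes> y)" if "k \<in> K" for k
  proof -
    have k: "k \<in> carrier G" "x \<otimes> k = k \<otimes> x" "y \<otimes> k = k \<otimes> y"
      using x y K that by (auto simp: centralizer_def)
    then show ?thesis using xG yG by (metis m_assoc)
  qed
  then show "x \<otimes> y \<in> centralizer K" using xG yG by (simp add: centralizer_def)
qed (auto simp: centralizer_def)

lemma centralizer_normal:
  assumes K: "K \<lhd> G"
  shows "centralizer K \<lhd> G"
proof (rule normal_invI)
  have KG: "K \<subseteq> carrier G" using K normal_imp_subgroup subgroup.subset by blast
  then show "subgroup (centralizer K) G" by (rule centralizer_subgroup)
  fix x c assume xc: "x \<in> carrier G" "c \<in> centralizer K"
  have cG: "c \<in> carrier G" using xc by (simp add: centralizer_def)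
  have "x \<otimes> c \<otimes> inv x \<otimes> e = e \<otimes> (x \<otimes> c \<otimes> inv x)" if e: "e \<in> K" for e
  proof -
    have eG: "e \<in> carrier G" using e KG by auto
    have "inv x \<otimes> e \<otimes> x \<in> K" using normal.inv_op_closed1[OF K] xc e by blast
    then have "c \<otimes> (inv x \<otimes> e \<otimes> x) = (inv x \<otimes> e \<otimes> x) \<otimes> c" using xc by (simp add: centralizer_def)
    then have "x \<otimes> (c \<otimes> (inv x \<otimes> e \<otimes> x)) \<otimes> inv x = x \<otimes> ((inv x \<otimes> e \<otimes> x) \<otimes> c) \<otimes> inv x" by simp
    then show ?thesis using xc cG eG by (simp add: word_simps)
  qed
  then show "x \<otimes> c \<otimes> inv x \<in> centralizer K" using xc cG by (simp add: centralizer_def)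
qed

end

lemma (in group) image_centralizer_fixed:
  assumes h: "h \<in> hom G G" and K: "K \<subseteq> carrier G" "\<And>k. k \<in> K \<Longrightarrow> h k = k" and c: "c \<in> centralizer K"
  shows "h c \<in> centralizer K"
proof -
  have "h c \<otimes> k = k \<otimes> h c" if k: "k \<in> K" for k
  proof -
    have "c \<in> carrier G" "k \<in> carrier G" "c \<otimes> k = k \<otimes> c" using c k K by (auto simp: centralizer_def)
    then show ?thesis using hom_mult[OF h, of c k] hom_mult[OF h, of k c] K(2)[OF k] by simp
  qed
  then show ?thesis using c hom_in_carrier[OF h] by (simp add: centralizer_def)
qed

text \<open>Conjugating a fixed element by \<open>x\<close> gives a fixed element, so \<open>x\<close> and \<open>h x\<close> act equally on \<open>K\<close>.\<close>
lemma (in group) fixing_normal_trivial_mod_centralizer: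
  assumes h: "h \<in> hom G G" and K: "K \<lhd> G" "\<And>k. k \<in> K \<Longrightarrow> h k = k" and x: "x \<in> carrier G"
  shows "h x \<otimes> inv x \<in> centralizer K"
proof -
  interpret h: group_hom G G h using h by (simp add: group_hom_def group_hom_axioms_def)
  have "h x \<otimes> inv x \<otimes> e = e \<otimes> (h x \<otimes> inv x)" if e: "e \<in> K" for e
  proof -
    have eS: "e \<in> carrier G" using e K normal_imp_subgroup subgroup.subset by blast
    have f: "inv x \<otimes> e \<otimes> x \<in> K" using normal.inv_op_closed1[OF K(1)] x e by blast
    then have "h (inv x \<otimes> e \<otimes> x) = inv x \<otimes> e \<otimes> x" by (rule K(2))
    then have "inv (h x) \<otimes> e \<otimes> h x = inv x \<otimes> e \<otimes> x" using x eS K(2)[OF e] by simp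
    then have "h x \<otimes> (inv (h x) \<otimes> e \<otimes> h x) \<otimes> inv x = h x \<otimes> (inv x \<otimes> e \<otimes> x) \<otimes> inv x" by simp
    then show ?thesis using x eS by (simp add: word_simps)
  qed
  then show ?thesis using x by (simp add: centralizer_def)
qed

context finite_p_group
begin

definition normal_elem_abelian :: "'a set \<Rightarrow> bool" where
  "normal_elem_abelian E \<longleftrightarrow>
     E \<lhd> S \<and> (\<forall>x\<in>E. \<forall>y\<in>E. x \<otimes> y = y \<otimes> x) \<and> (\<forall>x\<in>E. x [^] p = \<one>)"

text \<open>Coprime action is trivial if it is trivial on \<open>M\<close> and preserves the coset
  of \<open>n\<close>. The displacement \<open>c\<close> of \<open>n\<close> is fixed by \<sigma>,
  so the iterates are \<open>(\<sigma> ^^ k) n = c [^] k \<otimes> n\<close>, and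
  \<open>c [^] m = \<one>\<close> with \<open>m\<close> prime to \<open>p\<close>.\<close>

lemma coprime_map_eq_self:
  assumes hom: "\<And>x y. x \<in> N \<Longrightarrow> y \<in> N \<Longrightarrow> \<sigma> (x \<otimes> y) = \<sigma> x \<otimes> \<sigma> y"
    and N: "subgroup N S" and M: "subgroup M S" "M \<subseteq> N" "\<And>x. x \<in> M \<Longrightarrow> \<sigma> x = x"
    and n: "n \<in> N" "\<sigma> n \<in> carrier S" "\<sigma> n \<otimes> inv n \<in> M" and m: "(\<sigma> ^^ m) n = n" "coprime m p"
  shows "\<sigma> n = n"
proof -
  define c where "c = \<sigma> n \<otimes> inv n"
  have nS: "n \<in> carrier S" using n N subgroup.subset by auto
  have c: "c \<in> M" "c \<in> carrier S" using n M subgroup.subset[OF M(1)] c_def by auto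
  have \<sigma>n: "\<sigma> n = c \<otimes> n" using nS n(2) by (simp add: c_def word_simps)
  have ck: "c [^] (k::nat) \<in> M" for k using c M by (simp add: subgroup_pow_closed)
  have "(\<sigma> ^^ k) n = c [^] k \<otimes> n" for k
  proof (induction k)
    case (Suc k)
    have "(\<sigma> ^^ Suc k) n = \<sigma> (c [^] k) \<otimes> \<sigma> n" using ck M n by (simp add: Suc hom subsetD[OF M(2)])
    also have "\<dots> = c [^] Suc k \<otimes> n" using ck M nS c by (simp add: \<sigma>n m_assoc)
    finally show ?case .
  qed (use nS in simp)
  then have "c [^] m \<otimes> n = n" using m by simp
  then have "c [^] m = \<one>" using nS c by (metis nat_pow_closed r_cancel_one')
  then have "c = \<one>" using coprime_pow_eq_one c m by blast
  then show ?thesis using \<sigma>n nS by simp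
qed

text \<open>Otherwise \<open>\<sigma>\<close> moves some element of \<open>C\<^sub>S(E)\<close>.  Choose a minimal normal \<open>\<sigma>\<close>-invariant
  \<open>N \<le> C\<^sub>S(E)\<close> on which \<open>\<sigma>\<close> is nontrivial.  Smaller such subgroups are fixed by \<open>\<sigma>\<close> and central in
  \<open>N\<close>; this applies to \<open>\<Phi> = [N, S] N\<^sup>p\<close>, so \<open>N\<close> has class two, and as \<open>p\<close> is odd it has exponent \<open>p\<close>.
  Then maximality of \<open>E\<close> gives \<open>\<Phi> \<le> E\<close> and finally \<open>N \<le> E\<close>.\<close>
lemma coprime_aut_fixing_maximal_normal_elem_abelian:
  assumes odd: "odd p" and E: "normal_elem_abelian E"
    and max: "\<And>E'. normal_elem_abelian E' \<Longrightarrow> E \<subseteq> E' \<Longrightarrow> E' = E"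
    and \<sigma>: "\<And>x. x \<in> carrier S \<Longrightarrow> \<sigma> x \<in> carrier S"
    and hom: "\<And>x y. x \<in> carrier S \<Longrightarrow> y \<in> carrier S \<Longrightarrow> \<sigma> (x \<otimes> y) = \<sigma> x \<otimes> \<sigma> y"
    and m: "\<And>x. x \<in> carrier S \<Longrightarrow> (\<sigma> ^^ m) x = x" "coprime m p"
    and fix_E: "\<And>e. e \<in> E \<Longrightarrow> \<sigma> e = e"
  shows "\<And>x. x \<in> carrier S \<Longrightarrow> \<sigma> x = x"
proof (rule ccontr)
  fix x0 assume x0: "x0 \<in> carrier S" "\<sigma> x0 \<noteq> x0"
  have subE: "subgroup E S" "E \<subseteq> carrier S" "E \<lhd> S"
    and commE: "\<And>x y. x \<in> E \<Longrightarrow> y \<in> E \<Longrightarrow> x \<otimes> y = y \<otimes> x" and expE: "\<And>x. x \<in> E \<Longrightarrow> x [^] p = \<one>"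
    using E normal_imp_subgroup subgroup.subset unfolding normal_elem_abelian_def by blast+
  have \<sigma>_hom: "\<sigma> \<in> hom S S" using \<sigma> hom by (auto intro: homI)
  then interpret \<sigma>: group_hom S S \<sigma> by (simp add: group_hom_def group_hom_axioms_def)
  have fix_coprime: "\<sigma> x = x"
    if "subgroup M S" "\<And>x. x \<in> M \<Longrightarrow> \<sigma> x = x" "x \<in> carrier S" "\<sigma> x \<otimes> inv x \<in> M" for M x
    using that coprime_map_eq_self[of "carrier S" \<sigma> M x m] hom m \<sigma> subgroup_self
    by (auto dest: subgroup.subset)
  define C where "C = centralizer E"
  have normC: "C \<lhd> S" unfolding C_def by (rule centralizer_normal[OF subE(3)])
  have subC: "subgroup C S" using normC by (rule normal_imp_subgroup)
  have \<sigma>C: "\<sigma> c \<in> C" if "c \<in> C" for c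
    using image_centralizer_fixed[OF \<sigma>_hom subE(2) fix_E] that by (simp add: C_def)
  have \<sigma>_mod_C: "\<sigma> x \<otimes> inv x \<in> C" if x: "x \<in> carrier S" for x
    using fixing_normal_trivial_mod_centralizer[OF \<sigma>_hom subE(3) fix_E x] by (simp add: C_def)
  define P where "P N \<longleftrightarrow> N \<lhd> S \<and> N \<subseteq> C \<and> (\<forall>n\<in>N. \<sigma> n \<in> N) \<and> (\<exists>n\<in>N. \<sigma> n \<noteq> n)" for N
  \<comment> \<open>Were \<sigma> trivial on \<open>C\<close>, its triviality modulo
    \<open>C\<close> would make it fix \<open>x0\<close>.\<close>
  have "P C"
    unfolding P_def using normC \<sigma>C fix_coprime[OF subC _ x0(1) \<sigma>_mod_C[OF x0(1)]] x0 by auto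
  then obtain N where PN: "P N" and least: "\<And>K. P K \<Longrightarrow> card N \<le> card K"
    using ex_has_least_nat[of P C card] by blast
  have N: "N \<lhd> S" "N \<subseteq> C" "\<And>n. n \<in> N \<Longrightarrow> \<sigma> n \<in> N" and N_nontriv: "\<exists>n\<in>N. \<sigma> n \<noteq> n"
    using PN by (auto simp: P_def)
  have subN: "subgroup N S" "N \<subseteq> carrier S" using N normal_imp_subgroup subgroup.subset by blast+
  have small_fixed: "\<sigma> k = k" if "K \<lhd> S" "K \<subset> N" "\<And>k. k \<in> K \<Longrightarrow> \<sigma> k \<in> K" "k \<in> K" for K k
  proof (rule ccontr)
    assume "\<sigma> k \<noteq> k"
    then have "P K" using that N by (auto simp: P_def)
    then have "card N \<le> card K" by (rule least)
    then show False using that subgroup_finite[OF subN(1)] psubset_card_mono by (metis not_le)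
  qed
  have Nx: "\<sigma> n \<otimes> inv n \<in> N" if "n \<in> N" for n
    using that N subN by (simp add: subgroup.m_closed subgroup.m_inv_closed)
  \<comment> \<open>By minimality \<sigma> fixes such a \<open>K\<close> pointwise; being trivial on
    the cosets of \<open>K\<close> in \<open>N\<close> as well, it would be trivial on
    \<open>N\<close>.\<close>
  have contra: False
    if K: "K \<lhd> S" "K \<subset> N" "\<And>k. k \<in> K \<Longrightarrow> \<sigma> k \<in> K" "\<And>n. n \<in> N \<Longrightarrow> \<sigma> n \<otimes> inv n \<in> K" for K
    using N_nontriv fix_coprime[of K] small_fixed[OF K(1-3)] K subN normal_imp_subgroup by blast
  have small_central: "n \<otimes> k = k \<otimes> n"
    if K: "K \<lhd> S" "K \<subset> N" "\<And>k. k \<in> K \<Longrightarrow> \<sigma> k \<in> K" and nk: "n \<in> N" "k \<in> K" for K n k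
  proof (rule ccontr)
    assume neq: "n \<otimes> k \<noteq> k \<otimes> n"
    have KS: "K \<subseteq> carrier S" using K subN by auto
    have fixK: "\<And>k. k \<in> K \<Longrightarrow> \<sigma> k = k" using small_fixed[OF K] by blast
    \<comment> \<open>Since \<sigma> fixes \<open>K\<close> pointwise, it displaces elements of
      \<open>N\<close> only by elements centralising \<open>K\<close>. If \<open>Z\<close> were
      proper in \<open>N\<close>, this would be the situation of \<open>contra\<close>.\<close>
    define Z where "Z = centralizer K \<inter> N"
    have "Z \<lhd> S" unfolding Z_def by (rule normal_subgroup_intersect[OF centralizer_normal[OF K(1)] N(1)])
    moreover have "Z \<subset> N" using neq nk by (auto simp: Z_def centralizer_def)
    moreover have "\<sigma> z \<in> Z" if "z \<in> Z" for z
      using that N(3) image_centralizer_fixed[OF \<sigma>_hom KS fixK] by (auto simp: Z_def)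
    moreover have "\<sigma> n \<otimes> inv n \<in> Z" if n: "n \<in> N" for n
      using n Nx subN(2) fixing_normal_trivial_mod_centralizer[OF \<sigma>_hom K(1) fixK] by (auto simp: Z_def)
    ultimately show False by (rule contra)
  qed
  have "N \<noteq> {\<one>}" using N_nontriv by auto
  then obtain M where M: "M \<lhd> S" "M \<subset> N"
    "\<And>x n. x \<in> carrier S \<Longrightarrow> n \<in> N \<Longrightarrow> x \<otimes> n \<otimes> inv x \<otimes> inv n \<in> M" "\<And>n. n \<in> N \<Longrightarrow> n [^] p \<in> M"
    using maximal_normal_below[OF N(1)] by metis
  have subM: "subgroup M S" using M normal_imp_subgroup by blast
  \<comment> \<open>Generators of \<Phi>. They all lie in the maximal \<open>M\<close> below
    \<open>N\<close>, which makes \<Phi> proper in \<open>N\<close>.\<close>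
  define \<Gamma> where "\<Gamma> = {x \<otimes> n \<otimes> inv x \<otimes> inv n | x n. x \<in> carrier S \<and> n \<in> N} \<union> {n [^] p | n. n \<in> N}"
  define \<Phi> where "\<Phi> = generate S \<Gamma>"
  have \<Gamma>M: "\<Gamma> \<subseteq> M" using M by (auto simp: \<Gamma>_def)
  then have \<Gamma>S: "\<Gamma> \<subseteq> carrier S" using subM subgroup.subset by blast
  have sub\<Phi>: "subgroup \<Phi> S" unfolding \<Phi>_def by (rule generate_is_subgroup[OF \<Gamma>S])
  have \<Gamma>\<Phi>: "\<Gamma> \<subseteq> \<Phi>" unfolding \<Phi>_def by (auto intro: generate.incl)
  have \<Phi>M: "\<Phi> \<subseteq> M" unfolding \<Phi>_def using generate_subgroup_incl[OF \<Gamma>M subM] .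
  have comm\<Phi>: "x \<otimes> n \<otimes> inv x \<otimes> inv n \<in> \<Phi>" if "x \<in> carrier S" "n \<in> N" for x n
    using that \<Gamma>\<Phi> by (auto simp: \<Gamma>_def)
  have pow\<Phi>: "n [^] p \<in> \<Phi>" if "n \<in> N" for n using that \<Gamma>\<Phi> by (auto simp: \<Gamma>_def)
  have \<Phi>N: "\<Phi> \<subset> N" using \<Phi>M M by auto
  have norm\<Phi>: "\<Phi> \<lhd> S" using \<Phi>N by (intro normal_between[OF sub\<Phi> order_refl] comm\<Phi>) auto
  have \<sigma>\<Phi>: "\<sigma> f \<in> \<Phi>" if f: "f \<in> \<Phi>" for f
  proof -
    have "subgroup {f \<in> \<Phi>. \<sigma> f \<in> \<Phi>} S"
    proof (rule subgroup_finiteI[OF fin])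
      show "{f \<in> \<Phi>. \<sigma> f \<in> \<Phi>} \<subseteq> carrier S" using \<Phi>N subN by auto
      then show "x \<otimes> y \<in> {f \<in> \<Phi>. \<sigma> f \<in> \<Phi>}" if "x \<in> {f \<in> \<Phi>. \<sigma> f \<in> \<Phi>}" "y \<in> {f \<in> \<Phi>. \<sigma> f \<in> \<Phi>}" for x y
        using that subgroup.m_closed[OF sub\<Phi>] by (auto simp: hom subsetD)
      show "{f \<in> \<Phi>. \<sigma> f \<in> \<Phi>} \<noteq> {}" using subgroup.one_closed[OF sub\<Phi>] by (auto intro!: exI[of _ \<one>])
    qed
    moreover have "\<sigma> g \<in> \<Phi>" if "g \<in> \<Gamma>" for g
      using that N subN comm\<Phi>[OF \<sigma>] pow\<Phi> by (auto simp: \<Gamma>_def subsetD \<sigma>.hom_nat_pow)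
    then have "\<Gamma> \<subseteq> {f \<in> \<Phi>. \<sigma> f \<in> \<Phi>}" using \<Gamma>\<Phi> by auto
    ultimately have "\<Phi> \<subseteq> {f \<in> \<Phi>. \<sigma> f \<in> \<Phi>}" using generate_subgroup_incl by (metis \<Phi>_def)
    then show ?thesis using f by auto
  qed
  have fix\<Phi>: "\<sigma> f = f" if "f \<in> \<Phi>" for f using small_fixed[OF norm\<Phi> \<Phi>N \<sigma>\<Phi> that] .
  have central\<Phi>: "n \<otimes> f = f \<otimes> n" if "n \<in> N" "f \<in> \<Phi>" for n f
    using small_central[OF norm\<Phi> \<Phi>N \<sigma>\<Phi> that] .
  have pow_mult: "(x \<otimes> y) [^] p = x [^] p \<otimes> y [^] p" if xy: "x \<in> N" "y \<in> N" for x y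
  proof -
    define d where "d = y \<otimes> x \<otimes> inv y \<otimes> inv x"
    have c: "x \<in> carrier S" "y \<in> carrier S" using xy subN by auto
    have d: "d \<in> \<Phi>" "d \<in> carrier S" using comm\<Phi>[OF c(2) xy(1)] c by (auto simp: d_def)
    have yx: "y \<otimes> x = d \<otimes> x \<otimes> y" using c by (simp add: d_def word_simps)
    have dc: "d \<otimes> x = x \<otimes> d" "d \<otimes> y = y \<otimes> d" using central\<Phi> xy d by auto
    \<comment> \<open>\<open>y [^] p\<close> lies in \<Phi> and so is central in \<open>N\<close>,
      which forces the commutator \<open>d\<close> to have trivial \<open>p\<close>-th
      power.\<close>
    have "x \<otimes> y [^] p \<otimes> d [^] p = y [^] p \<otimes> x" using pow_mult_class2[OF c d(2) yx dc] by simp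
    also have "\<dots> = x \<otimes> y [^] p" using central\<Phi>[OF xy(1) pow\<Phi>[OF xy(2)]] by simp
    finally have "d [^] p = \<one>" using c d r_cancel_one[of "x \<otimes> y [^] p" "d [^] p"] by simp
    then show ?thesis using mult_pow_odd_class2[OF c d(2) yx dc odd] by simp
  qed
  define \<Omega> where "\<Omega> = {n \<in> N. n [^] p = \<one>}"
  have \<Omega>S: "\<Omega> \<subseteq> carrier S" using subN by (auto simp: \<Omega>_def)
  have sub\<Omega>: "subgroup \<Omega> S"
  proof (rule subgroup_finiteI[OF fin \<Omega>S])
    show "\<Omega> \<noteq> {}" using subgroup.one_closed[OF subN(1)] by (auto simp: \<Omega>_def intro!: exI[of _ \<one>])
    show "x \<otimes> y \<in> \<Omega>" if "x \<in> \<Omega>" "y \<in> \<Omega>" for x y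
      using that subgroup.m_closed[OF subN(1)] by (auto simp: \<Omega>_def pow_mult)
  qed
  have norm\<Omega>: "\<Omega> \<lhd> S"
  proof (rule normal_invI[OF sub\<Omega>])
    fix x c assume xc: "x \<in> carrier S" "c \<in> \<Omega>"
    then show "x \<otimes> c \<otimes> inv x \<in> \<Omega>"
      using normal_invE(2)[OF N(1)] \<Omega>S by (auto simp: \<Omega>_def subsetD simp flip: conj_pow)
  qed
  have \<sigma>\<Omega>: "\<sigma> n \<in> \<Omega>" if "n \<in> \<Omega>" for n
  proof -
    have "n \<in> carrier S" using that \<Omega>S by auto
    then have "\<sigma> n [^] p = \<sigma> (n [^] p)" by (simp add: \<sigma>.hom_nat_pow)
    then show ?thesis using that N by (simp add: \<Omega>_def)
  qed
  \<comment> \<open>\<open>n [^] p\<close> lies in \<Phi> and is fixed by \<sigma>. As the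
    \<open>p\<close>-th power map is multiplicative on \<open>N\<close>, the displacement of
    \<open>n\<close> has trivial \<open>p\<close>-th power, and \<open>contra\<close> then gives
    \<open>N\<close> exponent \<open>p\<close>.\<close>
  have "\<sigma> n \<otimes> inv n \<in> \<Omega>" if n: "n \<in> N" for n
  proof -
    have nS: "n \<in> carrier S" using n subN by auto
    define c where "c = \<sigma> n \<otimes> inv n"
    have c: "c \<in> N" "c \<in> carrier S" using Nx[OF n] subN c_def by auto
    have "\<sigma> n = c \<otimes> n" using nS \<sigma> by (simp add: c_def word_simps)
    then have "\<sigma> n [^] p = c [^] p \<otimes> n [^] p" using pow_mult[OF c(1) n] by simp
    moreover have "\<sigma> n [^] p = n [^] p" using fix\<Phi>[OF pow\<Phi>[OF n]] nS by (simp add: \<sigma>.hom_nat_pow)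
    ultimately have "c [^] p = \<one>" using c nS by (metis nat_pow_closed r_cancel_one')
    then show ?thesis using c by (simp add: \<Omega>_def flip: c_def)
  qed
  then have "\<Omega> = N" using contra[OF norm\<Omega> _ \<sigma>\<Omega>] by (auto simp: \<Omega>_def)
  then have expN: "n [^] p = \<one>" if "n \<in> N" for n using that by (auto simp: \<Omega>_def)
  have commEN: "e \<otimes> n = n \<otimes> e" if "e \<in> E" "n \<in> N" for e n using that N(2) by (auto simp: C_def centralizer_def)
  \<comment> \<open>\<Phi> is abelian of exponent \<open>p\<close>, and it centralises
    \<open>E\<close> because it lies in \<open>N\<close> and hence in \<open>C\<close>.\<close>
  have "normal_elem_abelian (E <#> \<Phi>)"
    unfolding normal_elem_abelian_def
  proof (intro conjI ballI)
    have \<Phi>N': "\<Phi> \<subseteq> N" using \<Phi>N by auto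
    have mem: "z \<in> E <#> \<Phi> \<longleftrightarrow> (\<exists>e\<in>E. \<exists>f\<in>\<Phi>. z = e \<otimes> f)" for z by (auto simp: set_mult_def)
    have car: "e \<in> carrier S" "f \<in> carrier S" if "e \<in> E" "f \<in> \<Phi>" for e f
      using that subE subN \<Phi>N' by auto
    have prod: "(e \<otimes> f) \<otimes> (e' \<otimes> f') = (e \<otimes> e') \<otimes> (f \<otimes> f')"
      if "e \<in> E" "e' \<in> E" "f \<in> \<Phi>" "f' \<in> \<Phi>" for e e' f f'
    proof -
      have "(e \<otimes> f) \<otimes> (e' \<otimes> f') = e \<otimes> (f \<otimes> e') \<otimes> f'" using that car by (simp add: m_assoc)
      also have "f \<otimes> e' = e' \<otimes> f" using commEN[of e' f] that \<Phi>N' by auto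
      finally show ?thesis using that car by (simp add: m_assoc)
    qed
    have "subgroup (E <#> \<Phi>) S"
    proof (rule subgroup_finiteI[OF fin])
      show "E <#> \<Phi> \<subseteq> carrier S" using car by (auto simp: mem)
      show "E <#> \<Phi> \<noteq> {}" using subgroup.one_closed[OF subE(1)] subgroup.one_closed[OF sub\<Phi>] by (auto simp: set_mult_def)
      fix x y assume "x \<in> E <#> \<Phi>" "y \<in> E <#> \<Phi>"
      then show "x \<otimes> y \<in> E <#> \<Phi>"
        using prod subgroup.m_closed[OF subE(1)] subgroup.m_closed[OF sub\<Phi>] unfolding mem by blast
    qed
    then show "E <#> \<Phi> \<lhd> S"
    proof (rule normal_invI)
      fix x h assume x: "x \<in> carrier S" and "h \<in> E <#> \<Phi>"
      then obtain e f where ef: "e \<in> E" "f \<in> \<Phi>" "h = e \<otimes> f" by (auto simp: mem)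
      then have "x \<otimes> h \<otimes> inv x = (x \<otimes> e \<otimes> inv x) \<otimes> (x \<otimes> f \<otimes> inv x)"
        using x car by (simp add: conj_mult)
      then show "x \<otimes> h \<otimes> inv x \<in> E <#> \<Phi>"
        using normal_invE(2)[OF subE(3) x ef(1)] normal_invE(2)[OF norm\<Phi> x ef(2)] unfolding mem by blast
    qed
    fix x assume "x \<in> E <#> \<Phi>"
    then obtain e f where ef: "e \<in> E" "f \<in> \<Phi>" "x = e \<otimes> f" by (auto simp: mem)
    have "x [^] p = e [^] p \<otimes> f [^] p"
      using ef car[OF ef(1,2)] commEN[OF ef(1), of f] \<Phi>N' by (auto intro: pow_mult_distrib)
    then show "x [^] p = \<one>" using ef expE expN \<Phi>N' by auto
    fix y assume "y \<in> E <#> \<Phi>"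
    then obtain e' f' where ef': "e' \<in> E" "f' \<in> \<Phi>" "y = e' \<otimes> f'" by (auto simp: mem)
    have "e \<otimes> e' = e' \<otimes> e" "f \<otimes> f' = f' \<otimes> f" using commE central\<Phi> \<Phi>N' ef ef' by auto
    then show "x \<otimes> y = y \<otimes> x" using ef ef' prod by metis
  qed
  moreover have "E \<subseteq> E <#> \<Phi>"
  proof
    fix e assume e: "e \<in> E"
    then have "e = e \<otimes> \<one>" using subE by auto
    then show "e \<in> E <#> \<Phi>" using e subgroup.one_closed[OF sub\<Phi>] unfolding set_mult_def by blast
  qed
  ultimately have "E <#> \<Phi> = E" by (rule max)
  have \<Phi>E: "f \<in> E" if f: "f \<in> \<Phi>" for f
  proof -
    have "f = \<one> \<otimes> f" using f \<Phi>N subN by auto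
    then have "f \<in> E <#> \<Phi>" using f subgroup.one_closed[OF subE(1)] unfolding set_mult_def by blast
    then show ?thesis using \<open>E <#> \<Phi> = E\<close> by simp
  qed
  have "n \<in> E" if n: "n \<in> N" for n
  proof -
    have nS: "n \<in> carrier S" using n subN by auto
    \<comment> \<open>Commutators of \<open>S\<close> with powers of \<open>n\<close> now lie in
      \<open>E\<close>, so adjoining \<open>n\<close> to \<open>E\<close> preserves normality, and
      maximality puts \<open>n\<close> into \<open>E\<close>.\<close>
    define K where "K = {e \<otimes> n [^] i | e i. e \<in> E \<and> i \<in> (UNIV :: nat set)}"
    have mem: "z \<in> K \<longleftrightarrow> (\<exists>e\<in>E. \<exists>i. z = e \<otimes> n [^] (i::nat))" for z by (auto simp: K_def)
    have subK: "subgroup K S" unfolding K_def by (rule normal_extend_subgroup[OF fin subE(3) nS])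
    have EK: "E \<subseteq> K"
    proof
      fix e assume e: "e \<in> E"
      then have "e = e \<otimes> n [^] (0::nat)" using subE by auto
      then show "e \<in> K" using e unfolding mem by blast
    qed
    have ni: "n [^] i \<in> N" for i :: nat using n subgroup_pow_closed[OF subN(1)] by blast
    have "normal_elem_abelian K"
      unfolding normal_elem_abelian_def
    proof (intro conjI ballI)
      show "K \<lhd> S"
      proof (rule normal_invI[OF subK])
        fix x h assume x: "x \<in> carrier S" and "h \<in> K"
        then obtain e i where ei: "e \<in> E" "h = e \<otimes> n [^] (i::nat)" by (auto simp: mem)
        have eS: "e \<in> carrier S" using ei subE by auto
        have "x \<otimes> h \<otimes> inv x
          = (x \<otimes> e \<otimes> inv x) \<otimes> (x \<otimes> n [^] i \<otimes> inv x \<otimes> inv (n [^] i)) \<otimes> n [^] i"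
          using x eS nS by (simp add: ei(2) word_simps)
        moreover have "(x \<otimes> e \<otimes> inv x) \<otimes> (x \<otimes> n [^] i \<otimes> inv x \<otimes> inv (n [^] i)) \<in> E"
          using normal_invE(2)[OF subE(3) x ei(1)] \<Phi>E[OF comm\<Phi>[OF x ni]] subgroup.m_closed[OF subE(1)]
          by blast
        ultimately show "x \<otimes> h \<otimes> inv x \<in> K" unfolding mem by blast
      qed
      fix x assume "x \<in> K"
      then obtain e i where ei: "e \<in> E" "x = e \<otimes> n [^] (i::nat)" by (auto simp: mem)
      have eS: "e \<in> carrier S" using ei subE by auto
      have "x [^] p = e [^] p \<otimes> (n [^] i) [^] p"
        unfolding ei(2) using eS nS commEN[OF ei(1) ni] by (intro pow_mult_distrib) auto
      then show "x [^] p = \<one>" using ei expE expN[OF ni] by auto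
      fix y assume "y \<in> K"
      then obtain e' j where ej: "e' \<in> E" "y = e' \<otimes> n [^] (j::nat)" by (auto simp: mem)
      have e'S: "e' \<in> carrier S" using ej subE by auto
      have "x \<otimes> y = e \<otimes> (n [^] i \<otimes> e') \<otimes> n [^] j" using ei ej eS e'S nS by (simp add: m_assoc)
      also have "\<dots> = e \<otimes> (e' \<otimes> n [^] i) \<otimes> n [^] j" by (simp only: commEN[OF ej(1) ni])
      also have "\<dots> = (e \<otimes> e') \<otimes> (n [^] i \<otimes> n [^] j)" using eS e'S nS by (simp add: m_assoc)
      also have "\<dots> = (e' \<otimes> e) \<otimes> (n [^] j \<otimes> n [^] i)"
        using commE[OF ei(1) ej(1)] nS by (simp add: nat_pow_mult add.commute)
      also have "\<dots> = e' \<otimes> (e \<otimes> n [^] j) \<otimes> n [^] i" using eS e'S nS by (simp add: m_assoc)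
      also have "\<dots> = e' \<otimes> (n [^] j \<otimes> e) \<otimes> n [^] i" by (simp only: commEN[OF ei(1) ni])
      also have "\<dots> = y \<otimes> x" using ei ej eS e'S nS by (simp add: m_assoc)
      finally show "x \<otimes> y = y \<otimes> x" .
    qed
    then have "K = E" using EK by (rule max)
    moreover have "n \<in> K"
    proof -
      have "n = \<one> \<otimes> n [^] (1::nat)" using nS by simp
      then show ?thesis using subgroup.one_closed[OF subE(1)] unfolding mem by blast
    qed
    ultimately show ?thesis by simp
  qed
  then show False using N_nontriv fix_E by auto
qed

section \<open>Existence of a normal elementary abelian subgroup of rank two\<close>

lemma pow_eq_iff_cong_ord:
  assumes "a \<in> carrier S"
  shows "a [^] (i::nat) = a [^] (j::nat) \<longleftrightarrow> [i = j] (mod ord a)"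
proof -
  have "a [^] i = a [^] j \<longleftrightarrow> int (ord a) dvd int j - int i"
    using int_pow_eq[OF assms, of "int i" "int j"] by (simp add: int_pow_int)
  also have "\<dots> \<longleftrightarrow> [int j = int i] (mod int (ord a))" by (simp add: cong_iff_dvd_diff)
  also have "\<dots> \<longleftrightarrow> [i = j] (mod ord a)" by (simp add: cong_int_iff cong_sym_eq)
  finally show ?thesis .
qed

text \<open>In a finite group natural exponents reach every power of \<open>a\<close>, so for a
  subgroup this is ordinary cyclicity.\<close>

definition cyclic_subset :: "'a set \<Rightarrow> bool" where
  "cyclic_subset V \<longleftrightarrow> (\<exists>a\<in>V. \<forall>v\<in>V. \<exists>i::nat. v = a [^] i)"

text \<open>In a minimal noncyclic normal subgroup \<open>V\<close> with cyclic maximal subgroup \<open>M\<close>, oddness of \<open>p\<close>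
  yields an element \<open>y\<close> of order \<open>p\<close> outside \<open>M\<close>; it commutes with \<open>Z = {z \<in> M. z [^] p = \<one>}\<close>.\<close>
lemma noncyclic_imp_normal_elem_abelian:
  assumes odd: "odd p" and noncyc: "\<not> cyclic_subset (carrier S)"
  shows "\<exists>W. normal_elem_abelian W \<and> p ^ 2 \<le> card W"
proof -
  have "carrier S \<lhd> S" by (simp add: normal_invI subgroup_self)
  then obtain V where V: "V \<lhd> S" "\<not> cyclic_subset V"
    and least: "\<And>K. K \<lhd> S \<Longrightarrow> \<not> cyclic_subset K \<Longrightarrow> card V \<le> card K"
    using noncyc ex_has_least_nat[of "\<lambda>V. V \<lhd> S \<and> \<not> cyclic_subset V" "carrier S" card] by blast
  have subV: "subgroup V S" "V \<subseteq> carrier S" using V normal_imp_subgroup subgroup.subset by blast+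
  have "V \<noteq> {\<one>}" using V(2) by (auto simp: cyclic_subset_def)
  then obtain M where M: "M \<lhd> S" "M \<subset> V"
    and commM: "\<And>x n. x \<in> carrier S \<Longrightarrow> n \<in> V \<Longrightarrow> x \<otimes> n \<otimes> inv x \<otimes> inv n \<in> M"
    and powM: "\<And>n. n \<in> V \<Longrightarrow> n [^] p \<in> M"
    and gen: "\<And>v n. v \<in> V - M \<Longrightarrow> n \<in> V \<Longrightarrow> \<exists>m\<in>M. \<exists>i. n = m \<otimes> v [^] (i::nat)"
    using maximal_normal_below[OF V(1)] by blast
  have subM: "subgroup M S" "M \<subseteq> carrier S" using M normal_imp_subgroup subgroup.subset by blast+
  have "card M < card V" using M subgroup_finite[OF subV(1)] psubset_card_mono by blast
  then have "cyclic_subset M" using least[OF M(1)] by auto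
  then obtain a where a: "a \<in> M" and gen_a: "\<And>m. m \<in> M \<Longrightarrow> \<exists>i::nat. m = a [^] i"
    by (auto simp: cyclic_subset_def)
  have aS: "a \<in> carrier S" using a subM by auto
  obtain x where x: "x \<in> V - M" using M by auto
  have xS: "x \<in> carrier S" using x subV by auto
  have commuteM: "m \<otimes> m' = m' \<otimes> m" if "m \<in> M" "m' \<in> M" for m m'
  proof -
    obtain i j where "m = a [^] (i::nat)" "m' = a [^] (j::nat)" using gen_a \<open>m \<in> M\<close> \<open>m' \<in> M\<close> by metis
    then show ?thesis using aS by (simp add: nat_pow_mult add.commute)
  qed
  \<comment> \<open>A trivial \<open>M\<close> would make \<open>x\<close> a generator of
    \<open>V\<close>.\<close>
  have "a \<noteq> \<one>"
  proof
    assume "a = \<one>"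
    then have M1: "m = \<one>" if "m \<in> M" for m using gen_a[OF that] by auto
    have "cyclic_subset V"
      unfolding cyclic_subset_def
    proof (intro bexI[of _ x] ballI)
      fix v assume "v \<in> V"
      then obtain m i where "m \<in> M" "v = m \<otimes> x [^] (i::nat)" using gen[OF x] by blast
      then have "v = x [^] i" using M1[of m] xS by simp
      then show "\<exists>i::nat. v = x [^] i" by blast
    qed (use x in auto)
    then show False using V by simp
  qed
  obtain N where N: "order S = p ^ N" using order_prime_power by auto
  then have "ord a dvd p ^ N" using ord_dvd_group_order[OF aS] by simp
  then obtain n where n: "ord a = p ^ n" using prime_p by (auto simp: divides_primepow_nat)
  have "n \<noteq> 0" using n \<open>a \<noteq> \<one>\<close> ord_eq_1[OF aS] by (intro notI) auto
  then have n1: "n \<ge> 1" by simp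
  have "x \<otimes> a \<otimes> inv x \<in> M" using normal_invE(2)[OF M(1) xS a] .
  then obtain k :: nat where k: "x \<otimes> a \<otimes> inv x = a [^] k" using gen_a by blast
  have xk: "x \<otimes> m \<otimes> inv x = m [^] k" if m: "m \<in> M" for m
  proof -
    obtain i where i: "m = a [^] (i::nat)" using gen_a[OF m] by blast
    have "x \<otimes> m \<otimes> inv x = (a [^] k) [^] i" using i conj_pow[OF xS aS, of i] k by simp
    also have "\<dots> = m [^] k" using i aS by (simp add: nat_pow_pow mult.commute)
    finally show ?thesis .
  qed
  have xik: "x [^] i \<otimes> a \<otimes> inv (x [^] i) = a [^] (k ^ i)" for i :: nat
  proof (induction i)
    case (Suc i)
    have "x [^] Suc i \<otimes> a \<otimes> inv (x [^] Suc i) = x [^] i \<otimes> (x \<otimes> a \<otimes> inv x) \<otimes> inv (x [^] i)"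
      using xS aS by (simp add: word_simps)
    also have "\<dots> = (a [^] (k ^ i)) [^] k" using k conj_pow[of "x [^] i" a k] xS aS Suc by simp
    finally show ?case using aS by (simp add: nat_pow_pow mult.commute)
  qed (use aS in simp)
  have xpM: "x [^] p \<in> M" using powM x by auto
  \<comment> \<open>\<open>x [^] p\<close> lies in the abelian group \<open>M\<close>, so
    conjugation by it fixes \<open>a\<close>; on the other hand it sends \<open>a\<close> to its
    \<open>k ^ p\<close>-th power.\<close>
  have "a [^] (k ^ p) = a"
    unfolding xik[symmetric] using commuteM[OF xpM a] xS aS by (simp add: word_simps)
  then have "[k ^ p = 1] (mod p ^ n)" using pow_eq_iff_cong_ord[OF aS, of "k ^ p" 1] aS n by simp
  note k_cong = prime_power_dvd_lift[OF prime_p odd n1 this]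
  have kp: "m [^] (k * p) = m [^] p" if m: "m \<in> M" for m
  proof -
    obtain i where i: "m = a [^] (i::nat)" using gen_a[OF m] by blast
    have "a [^] (k * p) = a [^] p" using k_cong(2) pow_eq_iff_cong_ord[OF aS] n by simp
    then have "(a [^] (k * p)) [^] i = (a [^] p) [^] i" by simp
    then show ?thesis using i aS by (simp add: nat_pow_pow mult.commute mult.left_commute)
  qed
  define Z where "Z = {z \<in> M. z [^] p = \<one>}"
  have Zk: "z [^] k = z" if "z \<in> Z" for z
  proof -
    have z: "z \<in> carrier S" "z [^] p = \<one>" using that subM by (auto simp: Z_def)
    then have "ord z dvd p" using pow_eq_id by auto
    then have "[k = 1] (mod ord z)" using k_cong(1) cong_dvd_modulus_nat by blast
    then show ?thesis using pow_eq_iff_cong_ord[of z k 1] z by simp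
  qed
  have xZ: "x \<otimes> z = z \<otimes> x" if "z \<in> Z" for z
  proof -
    have z: "z \<in> carrier S" "z \<in> M" using that subM by (auto simp: Z_def)
    have "x \<otimes> z = (x \<otimes> z \<otimes> inv x) \<otimes> x" using z xS by (simp add: word_simps)
    then show ?thesis using xk[OF z(2)] Zk[OF that] by simp
  qed
  \<comment> \<open>The commutator \<open>d\<close> equals \<open>b [^] k \<otimes> inv b\<close>,
    so \<open>kp\<close> makes its \<open>p\<close>-th power trivial. Hence \<open>d\<close> lies in
    \<open>Z\<close>, commutes with \<open>x\<close> and \<open>b\<close>, and the class-two formula
    applies.\<close>
  have mult_x_pow: "(b \<otimes> x) [^] p = b [^] p \<otimes> x [^] p" if b: "b \<in> M" for b
  proof -
    have bS: "b \<in> carrier S" using b subM by auto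
    define d where "d = x \<otimes> b \<otimes> inv x \<otimes> inv b"
    have dM: "d \<in> M" "d \<in> carrier S" using commM[OF xS, of b] b M xS bS by (auto simp: d_def)
    have d_eq: "d = b [^] k \<otimes> inv b" using xk[OF b] by (simp add: d_def)
    have "d [^] p = (b [^] k) [^] p \<otimes> (inv b) [^] p"
      unfolding d_eq using bS by (intro pow_mult_distrib) (auto simp: group_commutes_pow)
    also have "\<dots> = b [^] p \<otimes> inv (b [^] p)" using kp[OF b] bS by (simp add: nat_pow_pow nat_pow_inv)
    finally have dp: "d [^] p = \<one>" using bS by simp
    have "d \<otimes> x = x \<otimes> d" using xZ[of d] dM dp by (auto simp: Z_def)
    moreover have "d \<otimes> b = b \<otimes> d" using commuteM dM b by blast
    moreover have "x \<otimes> b = d \<otimes> b \<otimes> x" using bS xS by (simp add: d_def word_simps)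
    ultimately show ?thesis using mult_pow_odd_class2[OF bS xS dM(2) _ _ _ odd dp] by blast
  qed
  obtain l where l: "x [^] p = a [^] (l::nat)" using gen_a[OF xpM] by blast
  \<comment> \<open>Otherwise \<open>x [^] p\<close> generates \<open>M\<close>, and
    \<open>x\<close> alone generates \<open>V\<close>.\<close>
  have "p dvd l"
  proof (rule ccontr)
    assume "\<not> p dvd l"
    then have "coprime l (p ^ n)" using prime_imp_coprime[OF prime_p] by (simp add: coprime_commute)
    then obtain e where e: "[l * e = 1] (mod p ^ n)" using cong_solve_coprime_nat by (metis One_nat_def)
    have "x [^] (p * e) = (a [^] l) [^] e" using xS l by (simp add: nat_pow_pow[of x, symmetric])
    also have "\<dots> = a" using pow_eq_iff_cong_ord[OF aS, of "l * e" 1] n aS e by (simp add: nat_pow_pow)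
    finally have "a = x [^] (p * e)" by simp
    have "cyclic_subset V"
      unfolding cyclic_subset_def
    proof (intro bexI[of _ x] ballI)
      fix v assume "v \<in> V"
      then obtain m i where "m \<in> M" "v = m \<otimes> x [^] (i::nat)" using gen[OF x] by blast
      moreover from this obtain j where "m = a [^] (j::nat)" using gen_a by blast
      ultimately have "v = x [^] (p * e * j + i)"
        using \<open>a = x [^] (p * e)\<close> xS by (simp add: nat_pow_pow nat_pow_mult)
      then show "\<exists>i::nat. v = x [^] i" by blast
    qed (use x in auto)
    then show False using V by simp
  qed
  then obtain j where j: "l = p * j" by (elim dvdE)
  \<comment> \<open>Chosen so that \<open>b [^] p\<close> is the inverse of \<open>x [^] p\<close>;
    by \<open>mult_x_pow\<close> the product \<open>b \<otimes> x\<close> then has trivial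
    \<open>p\<close>-th power.\<close>
  define b where "b = inv (a [^] j)"
  have b: "b \<in> M" using subgroup.m_inv_closed[OF subM(1)] subgroup_pow_closed[OF subM(1) a] by (simp add: b_def)
  then have bS: "b \<in> carrier S" using subM by auto
  define y where "y = b \<otimes> x"
  have "y [^] p = inv ((a [^] j) [^] p) \<otimes> a [^] (p * j)"
    using mult_x_pow[OF b] l j aS by (simp add: y_def b_def nat_pow_inv)
  also have "\<dots> = \<one>" using aS by (simp add: nat_pow_pow mult.commute)
  finally have yp: "y [^] p = \<one>" .
  have yS: "y \<in> carrier S" using bS xS by (simp add: y_def)
  have yV: "y \<in> V" using b x M subgroup.m_closed[OF subV(1)] by (auto simp: y_def)
  have yM: "y \<notin> M"
  proof
    assume "y \<in> M"
    then have "inv b \<otimes> y \<in> M" using b subgroup.m_closed[OF subM(1)] subgroup.m_inv_closed[OF subM(1)] by blast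
    then show False using x bS xS by (simp add: y_def inv_cancel_left)
  qed
  have yZ: "z \<otimes> y = y \<otimes> z" if "z \<in> Z" for z
  proof -
    have z: "z \<in> carrier S" "z \<in> M" using that subM by (auto simp: Z_def)
    have "z \<otimes> y = (b \<otimes> z) \<otimes> x" using commuteM[OF z(2) b] z bS xS by (simp add: y_def flip: m_assoc)
    also have "\<dots> = b \<otimes> (x \<otimes> z)" using xZ[OF that] z bS xS by (simp add: m_assoc)
    finally show ?thesis using z bS xS by (simp add: y_def m_assoc)
  qed
  \<comment> \<open>This gives normality of \<open>W\<close>: a conjugate of \<open>y\<close> has
    the form \<open>m \<otimes> y\<close> with \<open>m\<close> in \<open>M\<close> and has trivial
    \<open>p\<close>-th power, so \<open>m\<close> lies in \<open>Z\<close>.\<close>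
  have mult_y_pow: "(m \<otimes> y) [^] p = m [^] p" if m: "m \<in> M" for m
  proof -
    have mS: "m \<in> carrier S" and mb: "m \<otimes> b \<in> M" using m b subM subgroup.m_closed[OF subM(1)] by auto
    have "(m \<otimes> y) [^] p = (m \<otimes> b) [^] p \<otimes> x [^] p"
      using mult_x_pow[OF mb] mS bS xS by (simp add: y_def m_assoc)
    also have "(m \<otimes> b) [^] p = m [^] p \<otimes> b [^] p"
      using mS bS commuteM[OF m b] by (intro pow_mult_distrib) auto
    finally have "(m \<otimes> y) [^] p = m [^] p \<otimes> (b [^] p \<otimes> x [^] p)"
      using mS bS xS by (simp add: m_assoc)
    then show ?thesis using mult_x_pow[OF b] yp mS by (simp add: y_def)
  qed
  have ZS: "Z \<subseteq> carrier S" using subM by (auto simp: Z_def)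
  have subZ: "subgroup Z S"
  proof (rule subgroup_finiteI[OF fin ZS])
    show "Z \<noteq> {}" using subgroup.one_closed[OF subM(1)] by (auto simp: Z_def intro!: exI[of _ \<one>])
    fix u v assume uv: "u \<in> Z" "v \<in> Z"
    then have "(u \<otimes> v) [^] p = u [^] p \<otimes> v [^] p"
      using ZS commuteM by (intro pow_mult_distrib) (auto simp: Z_def)
    then show "u \<otimes> v \<in> Z" using uv subgroup.m_closed[OF subM(1)] by (simp add: Z_def)
  qed
  have normZ: "Z \<lhd> S"
  proof (rule normal_invI[OF subZ])
    fix s c assume sc: "s \<in> carrier S" "c \<in> Z"
    have "(s \<otimes> c \<otimes> inv s) [^] p = s \<otimes> c [^] p \<otimes> inv s" using sc ZS by (intro conj_pow[symmetric]) auto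
    then show "s \<otimes> c \<otimes> inv s \<in> Z" using sc normal_invE(2)[OF M(1)] by (simp add: Z_def)
  qed
  define W where "W = {z \<otimes> y [^] i | z i. z \<in> Z \<and> i \<in> (UNIV :: nat set)}"
  have mem: "w \<in> W \<longleftrightarrow> (\<exists>z\<in>Z. \<exists>i. w = z \<otimes> y [^] (i::nat))" for w by (auto simp: W_def)
  have subW: "subgroup W S" unfolding W_def by (rule normal_extend_subgroup[OF fin normZ yS])
  have yiZ: "z \<otimes> y [^] i = y [^] i \<otimes> z" if "z \<in> Z" for z and i :: nat
    using group_commutes_pow[of y z i] yZ[OF that] that ZS yS by auto
  have "normal_elem_abelian W"
    unfolding normal_elem_abelian_def
  proof (intro conjI ballI)
    show "W \<lhd> S"
    proof (rule normal_invI[OF subW])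
      fix s h assume s: "s \<in> carrier S" and "h \<in> W"
      then obtain z i where zi: "z \<in> Z" "h = z \<otimes> y [^] (i::nat)" by (auto simp: mem)
      have zS: "z \<in> carrier S" using zi ZS by auto
      define m where "m = s \<otimes> y \<otimes> inv s \<otimes> inv y"
      have m: "m \<in> M" using commM[OF s yV] by (simp add: m_def)
      have mS: "m \<in> carrier S" using m subM by auto
      have my: "s \<otimes> y \<otimes> inv s = m \<otimes> y" using s yS by (simp add: m_def word_simps)
      have "m [^] p = s \<otimes> y [^] p \<otimes> inv s"
        using mult_y_pow[OF m] conj_pow[OF s yS, of p] my by simp
      then have mZ: "m \<in> Z" using m s yp by (simp add: Z_def)
      have "s \<otimes> h \<otimes> inv s = (s \<otimes> z \<otimes> inv s) \<otimes> (s \<otimes> y [^] i \<otimes> inv s)"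
        using s zS yS by (simp add: zi(2) conj_mult)
      also have "s \<otimes> y [^] i \<otimes> inv s = m [^] i \<otimes> y [^] i"
      proof -
        have "(m \<otimes> y) [^] i = m [^] i \<otimes> y [^] i" using yZ[OF mZ] mS yS by (rule pow_mult_distrib)
        then show ?thesis using conj_pow[OF s yS, of i] my by simp
      qed
      finally have "s \<otimes> h \<otimes> inv s = (s \<otimes> z \<otimes> inv s \<otimes> m [^] i) \<otimes> y [^] i"
        using s zS yS mS by (simp add: m_assoc)
      moreover have "s \<otimes> z \<otimes> inv s \<otimes> m [^] i \<in> Z"
        using normal_invE(2)[OF normZ s zi(1)] subgroup_pow_closed[OF subZ mZ] subgroup.m_closed[OF subZ] by blast
      ultimately show "s \<otimes> h \<otimes> inv s \<in> W" unfolding mem by blast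
    qed
    fix u assume "u \<in> W"
    then obtain z i where zi: "z \<in> Z" "u = z \<otimes> y [^] (i::nat)" by (auto simp: mem)
    have zS: "z \<in> carrier S" using zi ZS by auto
    have "u [^] p = z [^] p \<otimes> (y [^] i) [^] p"
      unfolding zi(2) using zS yS yiZ[OF zi(1)] by (intro pow_mult_distrib) auto
    also have "(y [^] i) [^] p = (y [^] p) [^] i" using yS by (simp add: nat_pow_pow mult.commute)
    finally show "u [^] p = \<one>" using zi yp by (simp add: Z_def)
    fix v assume "v \<in> W"
    then obtain z' j where zj: "z' \<in> Z" "v = z' \<otimes> y [^] (j::nat)" by (auto simp: mem)
    have prod: "(c \<otimes> y [^] i) \<otimes> (d \<otimes> y [^] j) = (c \<otimes> d) \<otimes> y [^] (i + j)"
      if "c \<in> Z" "d \<in> Z" for c d and i j :: nat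
    proof -
      have cd: "c \<in> carrier S" "d \<in> carrier S" using that ZS by auto
      have "(c \<otimes> y [^] i) \<otimes> (d \<otimes> y [^] j) = c \<otimes> (y [^] i \<otimes> d) \<otimes> y [^] j" using cd yS by (simp add: m_assoc)
      also have "\<dots> = c \<otimes> (d \<otimes> y [^] i) \<otimes> y [^] j" by (simp only: yiZ[OF that(2)])
      finally show ?thesis using cd yS by (simp add: m_assoc nat_pow_mult)
    qed
    have "z \<otimes> z' = z' \<otimes> z" using commuteM zi zj by (simp add: Z_def)
    then show "u \<otimes> v = v \<otimes> u" using zi zj prod by (simp add: add.commute)
  qed
  moreover have "p ^ 2 \<le> card W"
  proof -
    \<comment> \<open>An element of order \<open>p\<close> in \<open>M\<close>, so \<open>Z\<close>
      is nontrivial; \<open>W\<close> is strictly larger than \<open>Z\<close> and therefore has at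
      least \<open>p ^ 2\<close> elements.\<close>
    define z where "z = a [^] (p ^ (n - 1))"
    have "z [^] p = a [^] ord a" using n1 aS n by (simp add: z_def nat_pow_pow flip: power_Suc2)
    then have "z \<in> Z" using aS subgroup_pow_closed[OF subM(1) a] by (simp add: Z_def z_def)
    moreover have "z \<noteq> \<one>"
    proof
      assume "z = \<one>"
      then have "p ^ n dvd p ^ (n - 1)" using pow_eq_id[OF aS] n by (simp add: z_def)
      then have "n \<le> n - 1" using prime_gt_1_nat[OF prime_p] power_dvd_imp_le by blast
      then show False using n1 by simp
    qed
    ultimately have "{\<one>} \<subset> Z" using subgroup.one_closed[OF subZ] by auto
    then have 1: "p * card {\<one>} \<le> card Z" by (intro card_subgroup_less triv_subgroup subZ)
    have "Z \<subseteq> W"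
    proof
      fix u assume "u \<in> Z"
      moreover from this have "u = u \<otimes> y [^] (0::nat)" using ZS by auto
      ultimately show "u \<in> W" unfolding mem by blast
    qed
    moreover have "y \<in> W"
    proof -
      have "y = \<one> \<otimes> y [^] (1::nat)" using yS by simp
      then show ?thesis using subgroup.one_closed[OF subZ] unfolding mem by blast
    qed
    ultimately have "Z \<subset> W" using yM by (auto simp: Z_def)
    then have 2: "p * card Z \<le> card W" by (intro card_subgroup_less subW subZ)
    have "p ^ 2 \<le> p * card Z" using 1 by (simp add: power2_eq_square)
    then show ?thesis using 2 by simp
  qed
  ultimately show ?thesis by blast
qed

text \<open>Take a maximal normal elementary abelian subgroup above the one of rank two.\<close>
lemma noncyclic_imp_faithful_elem_abelian:
  assumes odd: "odd p" and noncyc: "\<not> cyclic_subset (carrier S)"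
  obtains E where "normal_elem_abelian E" "p ^ 2 \<le> card E"
    "\<And>\<sigma> m x. \<lbrakk>\<sigma> \<in> hom S S; \<And>x. x \<in> carrier S \<Longrightarrow> (\<sigma> ^^ m) x = x; coprime m p;
        \<And>e. e \<in> E \<Longrightarrow> \<sigma> e = e; x \<in> carrier S\<rbrakk> \<Longrightarrow> \<sigma> x = x"
proof -
  obtain W where W: "normal_elem_abelian W" "p ^ 2 \<le> card W"
    using noncyclic_imp_normal_elem_abelian[OF assms] by blast
  define \<E> where "\<E> = {E. normal_elem_abelian E \<and> W \<subseteq> E}"
  have "\<E> \<subseteq> Pow (carrier S)"
    using normal_imp_subgroup subgroup.subset unfolding \<E>_def normal_elem_abelian_def by blast
  then have "finite \<E>" using fin by (meson finite_Pow_iff finite_subset)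
  moreover have "W \<in> \<E>" using W by (simp add: \<E>_def)
  ultimately obtain E where E: "E \<in> \<E>" "\<And>E'. E' \<in> \<E> \<Longrightarrow> E \<subseteq> E' \<Longrightarrow> E = E'"
    by (metis empty_iff finite_has_maximal)
  have E': "normal_elem_abelian E" "W \<subseteq> E" using E by (auto simp: \<E>_def)
  then have "finite E" using subgroup_finite normal_imp_subgroup unfolding normal_elem_abelian_def by blast
  then have "p ^ 2 \<le> card E" using W E' card_mono by (metis le_trans)
  show thesis
  proof (rule that[OF E'(1) \<open>p ^ 2 \<le> card E\<close>])
    fix \<sigma> m x
    assume \<sigma>: "\<sigma> \<in> hom S S" "\<And>x. x \<in> carrier S \<Longrightarrow> (\<sigma> ^^ m) x = x" "coprime m p"
      "\<And>e. e \<in> E \<Longrightarrow> \<sigma> e = e" and x: "x \<in> carrier S"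
    show "\<sigma> x = x"
    proof (rule coprime_aut_fixing_maximal_normal_elem_abelian[OF odd E'(1) _ _ _ \<sigma>(2,3,4) x])
      show "E'' = E" if "normal_elem_abelian E''" "E \<subseteq> E''" for E''
        using E(2)[of E''] that E' by (auto simp: \<E>_def)
      show "\<sigma> x \<in> carrier S" if "x \<in> carrier S" for x using \<sigma>(1) that by (rule hom_in_carrier)
      show "\<sigma> (x \<otimes> y) = \<sigma> x \<otimes> \<sigma> y" if "x \<in> carrier S" "y \<in> carrier S" for x y
        using \<sigma>(1) that by (rule hom_mult)
    qed
  qed
qed

end

section \<open>Morphisms of a fusion system\<close>

text \<open>A morphism from \<open>P\<close> to \<open>S\<close> is given by any function whose restriction to \<open>P\<close> is in \<open>F\<close>; this
  avoids the bookkeeping with extensional functions and codomains.\<close>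
definition fmor :: "('a, 'b) monoid_scheme \<Rightarrow> 'a hom_family \<Rightarrow> 'a set \<Rightarrow> ('a \<Rightarrow> 'a) \<Rightarrow> bool" where
  "fmor S F P f \<longleftrightarrow> subgroup P S \<and> restrict f P \<in> F P (carrier S)"

context fusion_system
begin

lemma fmor_subgroup: "fmor S F P f \<Longrightarrow> subgroup P S"
  by (simp add: fmor_def)

lemma fmor_cong: "fmor S F P f \<Longrightarrow> (\<And>x. x \<in> P \<Longrightarrow> f x = h x) \<Longrightarrow> fmor S F P h"
  using restrict_ext[of P f h] by (simp add: fmor_def)

lemma fmor_inj_hom:
  assumes "fmor S F P f"
  shows "f \<in> hom (S\<lparr>carrier := P\<rparr>) S" "inj_on f P"
proof -
  have "restrict f P \<in> mon (S\<lparr>carrier := P\<rparr>) (S\<lparr>carrier := carrier S\<rparr>)"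
    using assms subset_inj_hom[of P "carrier S"] subgroup_self by (auto simp: fmor_def inj_hom_def)
  then have h: "restrict f P \<in> hom (S\<lparr>carrier := P\<rparr>) (S\<lparr>carrier := carrier S\<rparr>)" "inj_on (restrict f P) P"
    by (auto simp: mon_def)
  then show "inj_on f P" by simp
  show "f \<in> hom (S\<lparr>carrier := P\<rparr>) S"
  proof (rule homI)
    fix x y assume "x \<in> carrier (S\<lparr>carrier := P\<rparr>)" "y \<in> carrier (S\<lparr>carrier := P\<rparr>)"
    then have xy: "x \<in> P" "y \<in> P" "x \<otimes> y \<in> P"
      using assms by (auto simp: fmor_def subgroup.m_closed)
    then show "f x \<in> carrier S" using hom_in_carrier[OF h(1)] by force
    show "f (x \<otimes>\<^bsub>S\<lparr>carrier := P\<rparr>\<^esub> y) = f x \<otimes> f y"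
      using hom_mult[OF h(1), of x y] xy by simp
  qed
qed

lemma fmor_closed: "fmor S F P f \<Longrightarrow> x \<in> P \<Longrightarrow> f x \<in> carrier S"
  using hom_in_carrier[OF fmor_inj_hom(1)] by fastforce

lemma fmor_mult: "fmor S F P f \<Longrightarrow> x \<in> P \<Longrightarrow> y \<in> P \<Longrightarrow> f (x \<otimes> y) = f x \<otimes> f y"
  using hom_mult[OF fmor_inj_hom(1)] by fastforce

lemma fmor_group_hom: "fmor S F P f \<Longrightarrow> group_hom (S\<lparr>carrier := P\<rparr>) S f"
  using fmor_inj_hom(1) fmor_subgroup
  by (simp add: group_hom_def group_hom_axioms_def subgroup_imp_group)

lemma fmor_inv: "fmor S F P f \<Longrightarrow> x \<in> P \<Longrightarrow> f (inv x) = inv (f x)"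
  using group_hom.hom_inv[OF fmor_group_hom] fmor_subgroup m_inv_consistent by fastforce

lemma fmor_conj:
  assumes f: "fmor S F P f" and "g \<in> P" "x \<in> P"
  shows "f (g \<otimes> x \<otimes> inv g) = f g \<otimes> f x \<otimes> inv (f g)"
proof -
  have P: "subgroup P S" using f by (rule fmor_subgroup)
  then have "g \<otimes> x \<in> P" "inv g \<in> P" using assms by (simp_all add: subgroup.m_closed subgroup.m_inv_closed)
  then show ?thesis using assms by (simp add: fmor_mult fmor_inv)
qed

lemma fmor_image: "fmor S F P f \<Longrightarrow> subgroup (f ` P) S"
  using group_hom.img_is_subgroup[OF fmor_group_hom] by fastforce

lemma fmor_image_subgroup:
  assumes f: "fmor S F P f" and R: "subgroup R S" "R \<subseteq> P"
  shows "subgroup (f ` R) S"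
proof -
  have "subgroup R (S\<lparr>carrier := P\<rparr>)" using R fmor_subgroup[OF f] by (simp add: subgroup_incl)
  then show ?thesis using group_hom.subgroup_img_is_subgroup[OF fmor_group_hom[OF f]] by blast
qed

lemma fmor_card: "fmor S F P f \<Longrightarrow> card (f ` P) = card P"
  using fmor_inj_hom(2) card_image by blast

lemma inclusion_mem:
  assumes "subgroup P S" "subgroup Q S" "P \<subseteq> Q"
  shows "(\<lambda>x\<in>P. x) \<in> F P Q"
proof -
  have "conj_map S \<one> P = (\<lambda>x\<in>P. x)"
    using assms(1) subgroup.subset by (fastforce simp: conj_map_def)
  then have "(\<lambda>x\<in>P. x) \<in> conj_hom S P Q" unfolding conj_hom_def using assms(3) by force
  then show ?thesis using conj_hom_subset assms by auto
qed

text \<open>The factorisation axiom yields an isomorphism onto some \<open>R\<close>; comparing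
  values and using the inverse identifies \<open>R\<close> with the image.\<close>

lemma fmor_iso:
  assumes f: "fmor S F P f"
  shows "restrict f P \<in> fusion_iso F P (f ` P)"
proof -
  obtain R \<psi> where R: "subgroup R S" and \<psi>: "\<psi> \<in> fusion_iso F P R"
    and eq: "restrict f P = compose P (\<lambda>x\<in>R. x) \<psi>"
    using iso_inclusion_factor[of P "carrier S" "restrict f P"] f subgroup_self by (auto simp: fmor_def)
  obtain \<psi>' where "\<psi> \<in> F P R" "\<psi>' \<in> F R P"
    and inv: "compose P \<psi>' \<psi> = (\<lambda>x\<in>P. x)" "compose R \<psi> \<psi>' = (\<lambda>x\<in>R. x)"
    using \<psi> by (auto simp: fusion_iso_def)
  then have i: "\<psi> \<in> inj_hom S P R" "\<psi>' \<in> inj_hom S R P"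
    using subset_inj_hom R fmor_subgroup[OF f] by blast+
  then have e: "\<psi> \<in> extensional P" by (simp add: inj_hom_def)
  have m: "\<psi> x \<in> R" if "x \<in> P" for x using i(1) that by (auto simp: inj_hom_def mon_def hom_def)
  have m': "\<psi>' x \<in> P" if "x \<in> R" for x using i(2) that by (auto simp: inj_hom_def mon_def hom_def)
  have fx: "f x = \<psi> x" if "x \<in> P" for x
    using fun_cong[OF eq, of x] that m[OF that] by (simp add: compose_def)
  have "\<psi> = restrict f P" using e fx by (auto simp: extensional_def fun_eq_iff)
  moreover have "f ` P = R"
  proof
    show "f ` P \<subseteq> R" using fx m by auto
    show "R \<subseteq> f ` P"
    proof
      fix r assume r: "r \<in> R"
      then have "\<psi> (\<psi>' r) = r" using fun_cong[OF inv(2), of r] by (simp add: compose_def)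
      then show "r \<in> f ` P" using m'[OF r] fx by force
    qed
  qed
  ultimately show ?thesis using \<psi> by simp
qed

text \<open>Inclusions are morphisms, and a morphism may be corestricted to its image, so membership
  in any hom set depends only on the morphism into \<open>S\<close> and its range. This is what
  allows codomains to be dropped.\<close>

lemma mem_iff_fmor:
  assumes P: "subgroup P S" and Q: "subgroup Q S"
  shows "\<phi> \<in> F P Q \<longleftrightarrow> \<phi> \<in> extensional P \<and> \<phi> ` P \<subseteq> Q \<and> fmor S F P \<phi>"
proof
  assume \<phi>: "\<phi> \<in> F P Q"
  then have i: "\<phi> \<in> inj_hom S P Q" using subset_inj_hom P Q by blast
  then have e: "\<phi> \<in> extensional P" by (simp add: inj_hom_def)
  have m: "\<phi> x \<in> Q" if "x \<in> P" for x using i that by (auto simp: inj_hom_def mon_def hom_def)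
  have "compose P (\<lambda>x\<in>Q. x) \<phi> \<in> F P (carrier S)"
    using compose_closed[OF P Q subgroup_self \<phi>] inclusion_mem[OF Q subgroup_self] Q subgroup.subset by blast
  moreover have "compose P (\<lambda>x\<in>Q. x) \<phi> = restrict \<phi> P" using m by (auto simp: compose_def fun_eq_iff)
  ultimately show "\<phi> \<in> extensional P \<and> \<phi> ` P \<subseteq> Q \<and> fmor S F P \<phi>"
    using e m P by (auto simp: fmor_def)
next
  assume \<phi>: "\<phi> \<in> extensional P \<and> \<phi> ` P \<subseteq> Q \<and> fmor S F P \<phi>"
  then have \<phi>P: "subgroup (\<phi> ` P) S" using fmor_image by blast
  have "restrict \<phi> P \<in> F P (\<phi> ` P)" using \<phi> fmor_iso by (auto simp: fusion_iso_def)
  then have "\<phi> \<in> F P (\<phi> ` P)" using \<phi> by (simp add: extensional_restrict)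
  then have "compose P (\<lambda>x\<in>\<phi> ` P. x) \<phi> \<in> F P Q"
    using compose_closed[OF P \<phi>P Q _ inclusion_mem[OF \<phi>P Q]] \<phi> by blast
  moreover have "compose P (\<lambda>x\<in>\<phi> ` P. x) \<phi> = \<phi>"
    using \<phi> by (auto simp: compose_def fun_eq_iff extensional_def)
  ultimately show "\<phi> \<in> F P Q" by simp
qed

lemma restrict_mem:
  "fmor S F P f \<Longrightarrow> subgroup Q S \<Longrightarrow> f ` P \<subseteq> Q \<Longrightarrow> restrict f P \<in> F P Q"
  using fmor_cong[of P f "restrict f P"] by (auto simp: mem_iff_fmor fmor_subgroup)

lemma fmor_comp:
  assumes f: "fmor S F P f" and h: "fmor S F R h" and fR: "f ` P \<subseteq> R"
  shows "fmor S F P (\<lambda>x. h (f x))"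
proof -
  have P: "subgroup P S" and R: "subgroup R S" using f h fmor_subgroup by auto
  have "compose P (restrict h R) (restrict f P) \<in> F P (carrier S)"
    using compose_closed[OF P R subgroup_self restrict_mem[OF f R fR]] h by (simp add: fmor_def)
  moreover have "compose P (restrict h R) (restrict f P) = restrict (\<lambda>x. h (f x)) P"
    using fR by (auto simp: compose_def fun_eq_iff)
  ultimately show ?thesis using P by (simp add: fmor_def)
qed

lemma fmor_id: "subgroup P S \<Longrightarrow> fmor S F P (\<lambda>x. x)"
  using inclusion_mem[of P "carrier S"] subgroup_self subgroup.subset by (auto simp: fmor_def)

lemma fmor_restrict: "fmor S F P f \<Longrightarrow> subgroup R S \<Longrightarrow> R \<subseteq> P \<Longrightarrow> fmor S F R f"
  using fmor_comp[OF fmor_id, of R P f] by simp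

lemma fmor_inv_into:
  assumes f: "fmor S F P f"
  shows "fmor S F (f ` P) (inv_into P f)"
proof -
  have P: "subgroup P S" and fP: "subgroup (f ` P) S" using f fmor_subgroup fmor_image by auto
  obtain \<psi> where \<psi>: "\<psi> \<in> F (f ` P) P" and inv: "compose P \<psi> (restrict f P) = (\<lambda>x\<in>P. x)"
    using fmor_iso[OF f] by (auto simp: fusion_iso_def)
  have "\<psi> y = inv_into P f y" if y: "y \<in> f ` P" for y
  proof -
    from y obtain x where x: "x \<in> P" "y = f x" by auto
    then have "\<psi> y = x" using fun_cong[OF inv, of x] by (simp add: compose_def)
    then show ?thesis using x fmor_inj_hom(2)[OF f] by simp
  qed
  moreover have "fmor S F (f ` P) \<psi>" using \<psi> by (simp add: mem_iff_fmor[OF fP P])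
  ultimately show ?thesis using fmor_cong by blast
qed

section \<open>Conjugation maps, normalizers and extenders\<close>

lemma fmor_conjugation:
  assumes "subgroup P S" "g \<in> carrier S"
  shows "fmor S F P (\<lambda>x. g \<otimes> x \<otimes> inv g)"
proof -
  have "P \<subseteq> carrier S" using assms subgroup.subset by auto
  then have "conj_map S g P \<in> P \<rightarrow> carrier S" using assms by (auto simp: conj_map_def)
  then have "conj_map S g P \<in> conj_hom S P (carrier S)" using assms unfolding conj_hom_def by blast
  then have "conj_map S g P \<in> F P (carrier S)" using conj_hom_subset assms subgroup_self by blast
  then show ?thesis using assms by (simp add: fmor_def conj_map_def)
qed

text \<open>\<open>normalizer\<close> is a stabiliser and demands that the conjugate equal
  \<open>Q\<close>; inclusion forces equality because conjugation is injective and \<open>Q\<close>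
  is finite.\<close>

lemma mem_normalizer:
  assumes Q: "subgroup Q S"
  shows "g \<in> normalizer S Q \<longleftrightarrow> g \<in> carrier S \<and> (\<forall>x\<in>Q. g \<otimes> x \<otimes> inv g \<in> Q)"
proof -
  have sub: "Q \<subseteq> carrier S" using Q subgroup.subset by auto
  have "g <# Q #> inv g = (\<lambda>x. g \<otimes> x \<otimes> inv g) ` Q" for g by (auto simp: l_coset_def r_coset_def)
  moreover have "(\<lambda>x. g \<otimes> x \<otimes> inv g) ` Q = Q" if g: "g \<in> carrier S" "\<forall>x\<in>Q. g \<otimes> x \<otimes> inv g \<in> Q" for g
  proof (rule card_subset_eq[OF subgroup_finite[OF Q]])
    show "card ((\<lambda>x. g \<otimes> x \<otimes> inv g) ` Q) = card Q"
      using fmor_card[OF fmor_conjugation[OF Q g(1)]] .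
  qed (use g in auto)
  ultimately show ?thesis using sub unfolding normalizer_def stabilizer_def by auto
qed

lemma mem_conj_hom_iff:
  assumes P: "subgroup P S" and \<kappa>: "\<kappa> \<in> extensional P" "\<kappa> ` P \<subseteq> P"
  shows "\<kappa> \<in> conj_hom S P P \<longleftrightarrow> (\<exists>h\<in>carrier S. \<forall>x\<in>P. \<kappa> x = h \<otimes> x \<otimes> inv h)"
proof
  assume "\<kappa> \<in> conj_hom S P P"
  then show "\<exists>h\<in>carrier S. \<forall>x\<in>P. \<kappa> x = h \<otimes> x \<otimes> inv h" by (auto simp: conj_hom_def conj_map_def)
next
  assume "\<exists>h\<in>carrier S. \<forall>x\<in>P. \<kappa> x = h \<otimes> x \<otimes> inv h"
  then obtain h where h: "h \<in> carrier S" "\<forall>x\<in>P. \<kappa> x = h \<otimes> x \<otimes> inv h" by blast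
  then have "\<kappa> = conj_map S h P" using \<kappa> by (auto simp: conj_map_def fun_eq_iff extensional_def)
  then show "\<kappa> \<in> conj_hom S P P" using h \<kappa> unfolding conj_hom_def by blast
qed

text \<open>Evaluating at \<open>f x\<close> turns the equation \<open>f c_g f^-1 = c_h\<close> into
  an intertwining relation without inverse maps.\<close>

lemma mem_extender_iff:
  assumes f: "fmor S F Q f"
  shows "g \<in> extender S Q (f ` Q) (restrict f Q) \<longleftrightarrow> g \<in> carrier S \<and> (\<forall>x\<in>Q. g \<otimes> x \<otimes> inv g \<in> Q)
    \<and> (\<exists>h\<in>carrier S. \<forall>x\<in>Q. f (g \<otimes> x \<otimes> inv g) = h \<otimes> f x \<otimes> inv h)"
proof (cases "g \<in> carrier S \<and> (\<forall>x\<in>Q. g \<otimes> x \<otimes> inv g \<in> Q)")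
  case True
  have Q: "subgroup Q S" using f by (rule fmor_subgroup)
  have inj: "inj_on f Q" using f by (rule fmor_inj_hom)
  define \<kappa> where "\<kappa> = compose (f ` Q) (restrict f Q)
    (compose (f ` Q) (conj_map S g Q) (inv_into Q (restrict f Q)))"
  have \<kappa>: "\<kappa> (f x) = f (g \<otimes> x \<otimes> inv g)" if "x \<in> Q" for x
  proof -
    have "inv_into Q (restrict f Q) (f x) = x" using inj that
      by (metis inj_on_restrict_eq inv_into_f_f restrict_apply')
    then show ?thesis using that True by (simp add: \<kappa>_def compose_def conj_map_def)
  qed
  have "\<kappa> \<in> conj_hom S (f ` Q) (f ` Q) \<longleftrightarrow> (\<exists>h\<in>carrier S. \<forall>x\<in>f ` Q. \<kappa> x = h \<otimes> x \<otimes> inv h)"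
  proof (rule mem_conj_hom_iff[OF fmor_image[OF f]])
    show "\<kappa> \<in> extensional (f ` Q)" by (simp add: \<kappa>_def compose_def)
    show "\<kappa> ` f ` Q \<subseteq> f ` Q" using True \<kappa> by auto
  qed
  then show ?thesis using True \<kappa> mem_normalizer[OF Q] by (simp add: extender_def flip: \<kappa>_def)
next
  case False
  then show ?thesis using mem_normalizer[OF fmor_subgroup[OF f]] by (auto simp: extender_def)
qed

lemma extender_subgroup:
  assumes f: "fmor S F Q f"
  shows "subgroup (extender S Q (f ` Q) (restrict f Q)) S"
proof (rule subgroup_finiteI[OF fin])
  note iff = mem_extender_iff[OF f]
  have QS: "Q \<subseteq> carrier S" using fmor_subgroup[OF f] subgroup.subset by auto
  show "extender S Q (f ` Q) (restrict f Q) \<subseteq> carrier S" using iff by blast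
  have "\<one> \<in> extender S Q (f ` Q) (restrict f Q)"
    unfolding iff using QS fmor_closed[OF f] by (auto intro!: bexI[of _ \<one>] simp: subsetD)
  then show "extender S Q (f ` Q) (restrict f Q) \<noteq> {}" by auto
  fix g g' assume "g \<in> extender S Q (f ` Q) (restrict f Q)" "g' \<in> extender S Q (f ` Q) (restrict f Q)"
  then obtain h h' where g: "g \<in> carrier S" "\<And>x. x \<in> Q \<Longrightarrow> g \<otimes> x \<otimes> inv g \<in> Q"
      "h \<in> carrier S" "\<And>x. x \<in> Q \<Longrightarrow> f (g \<otimes> x \<otimes> inv g) = h \<otimes> f x \<otimes> inv h"
    and g': "g' \<in> carrier S" "\<And>x. x \<in> Q \<Longrightarrow> g' \<otimes> x \<otimes> inv g' \<in> Q"
      "h' \<in> carrier S" "\<And>x. x \<in> Q \<Longrightarrow> f (g' \<otimes> x \<otimes> inv g') = h' \<otimes> f x \<otimes> inv h'"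
    unfolding iff by metis
  have eq: "g \<otimes> g' \<otimes> x \<otimes> inv (g \<otimes> g') = g \<otimes> (g' \<otimes> x \<otimes> inv g') \<otimes> inv g" if "x \<in> Q" for x
    using that QS g g' by (auto simp: word_simps subsetD)
  have "f (g \<otimes> g' \<otimes> x \<otimes> inv (g \<otimes> g')) = h \<otimes> h' \<otimes> f x \<otimes> inv (h \<otimes> h')" if "x \<in> Q" for x
    unfolding eq[OF that] using g g' that fmor_closed[OF f] by (simp add: word_simps)
  then show "g \<otimes> g' \<in> extender S Q (f ` Q) (restrict f Q)"
    unfolding iff using g g' eq by (auto intro!: bexI[of _ "h \<otimes> h'"])
qed

lemma receptive_extend:
  assumes f: "fmor S F Q f" and r: "receptive S F (f ` Q)"
  shows "\<exists>f'. fmor S F (extender S Q (f ` Q) (restrict f Q)) f' \<and> (\<forall>x\<in>Q. f' x = f x)"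
proof -
  obtain \<phi> where \<phi>: "\<phi> \<in> F (extender S Q (f ` Q) (restrict f Q)) (carrier S)" "restrict \<phi> Q = restrict f Q"
    using r fmor_iso[OF f] fmor_subgroup[OF f] unfolding receptive_def by blast
  then have "fmor S F (extender S Q (f ` Q) (restrict f Q)) \<phi>"
    using mem_iff_fmor[OF extender_subgroup[OF f] subgroup_self] by blast
  then show ?thesis using \<phi>(2) by (metis restrict_apply')
qed

section \<open>Automorphism groups and Sylow's theorem in them\<close>

lemma group_aut_group:
  assumes P: "subgroup P S"
  shows "group (aut_group F P)" "finite (F P P)" "F P P \<subseteq> Bij P"
proof -
  have sub: "F P P \<subseteq> Bij P"
  proof
    fix \<phi> assume "\<phi> \<in> F P P"
    then have \<phi>: "\<phi> \<in> extensional P" "\<phi> ` P \<subseteq> P" "fmor S F P \<phi>" by (auto simp: mem_iff_fmor[OF P P])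
    have "\<phi> ` P = P" using \<phi> fmor_card[OF \<phi>(3)] subgroup_finite[OF P] by (intro card_subset_eq) auto
    then show "\<phi> \<in> Bij P" using \<phi> fmor_inj_hom(2) by (auto simp: Bij_def bij_betw_def)
  qed
  have "Bij P \<subseteq> P \<rightarrow>\<^sub>E P" by (auto simp: Bij_def bij_betw_def PiE_def)
  then have "finite (Bij P)" using finite_PiE[of P "\<lambda>_. P"] subgroup_finite[OF P] finite_subset by blast
  then have fin': "finite (carrier (BijGroup P))" by (simp add: BijGroup_def)
  then show "finite (F P P)" "F P P \<subseteq> Bij P" using sub finite_subset by (auto simp: BijGroup_def)
  have "subgroup (F P P) (BijGroup P)"
  proof (rule group.subgroup_finiteI[OF group_BijGroup fin'])
    show "F P P \<subseteq> carrier (BijGroup P)" using sub by (simp add: BijGroup_def)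
    show "F P P \<noteq> {}" using inclusion_mem[OF P P] by auto
    fix x y assume "x \<in> F P P" "y \<in> F P P"
    then show "x \<otimes>\<^bsub>BijGroup P\<^esub> y \<in> F P P"
      using sub compose_closed[OF P P P, of y x] by (auto simp: BijGroup_def)
  qed
  then show "group (aut_group F P)"
    unfolding aut_group_def by (rule group.subgroup_imp_group[OF group_BijGroup])
qed

lemma aut_group_simps:
  assumes P: "subgroup P S"
  shows "carrier (aut_group F P) = F P P" "\<one>\<^bsub>aut_group F P\<^esub> = (\<lambda>x\<in>P. x)"
    and "\<lbrakk>\<alpha> \<in> F P P; \<beta> \<in> F P P\<rbrakk> \<Longrightarrow> \<alpha> \<otimes>\<^bsub>aut_group F P\<^esub> \<beta> = compose P \<alpha> \<beta>"
  using group_aut_group(3)[OF P] by (auto simp: aut_group_def BijGroup_def)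

lemma aut_memE:
  assumes "subgroup P S" "\<alpha> \<in> F P P"
  shows "fmor S F P \<alpha>" "\<alpha> ` P = P" "\<alpha> \<in> extensional P"
proof -
  show "fmor S F P \<alpha>" "\<alpha> \<in> extensional P" using assms mem_iff_fmor[OF assms(1) assms(1)] by auto
  have "\<alpha> \<in> Bij P" using assms group_aut_group(3) by blast
  then show "\<alpha> ` P = P" by (simp add: Bij_def bij_betw_def)
qed

text \<open>Sylow's theorem in \<open>Aut_F(P)\<close> conjugates the p-subgroup \<open>K\<close>
  into \<open>Aut_S(P)\<close>. The relation \<open>\<alpha> \<kappa> \<alpha>^-1 = c_h\<close> is
  recorded in the form \<open>\<alpha> \<kappa> = c_h \<alpha>\<close>.\<close>

lemma fully_automised_conjugate:
  assumes P: "subgroup P S" and fa: "fully_automised S p F P"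
    and K: "subgroup K (aut_group F P)" "card K = p ^ n"
  shows "\<exists>\<alpha>. fmor S F P \<alpha> \<and> \<alpha> ` P = P \<and> (\<forall>\<kappa>\<in>K. \<exists>h\<in>carrier S. \<forall>x\<in>P. \<alpha> (\<kappa> x) = h \<otimes> \<alpha> x \<otimes> inv h)"
proof -
  interpret A: group "aut_group F P" by (rule group_aut_group(1)[OF P])
  note simps = aut_group_simps[OF P]
  obtain \<alpha> where \<alpha>: "\<alpha> \<in> carrier (aut_group F P)"
    and conj: "\<And>\<kappa>. \<kappa> \<in> K \<Longrightarrow> \<alpha> \<otimes>\<^bsub>aut_group F P\<^esub> \<kappa> \<otimes>\<^bsub>aut_group F P\<^esub> inv\<^bsub>aut_group F P\<^esub> \<alpha> \<in> conj_hom S P P"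
    using A.p_subgroup_conjugate_into_sylow[OF prime_p _ K] fa unfolding fully_automised_def by blast
  have \<alpha>': "fmor S F P \<alpha>" "\<alpha> ` P = P" using aut_memE[OF P] \<alpha> simps by auto
  have "\<exists>h\<in>carrier S. \<forall>x\<in>P. \<alpha> (\<kappa> x) = h \<otimes> \<alpha> x \<otimes> inv h" if \<kappa>: "\<kappa> \<in> K" for \<kappa>
  proof -
    have \<kappa>A: "\<kappa> \<in> carrier (aut_group F P)" using \<kappa> K(1) subgroup.subset by blast
    define c where "c = \<alpha> \<otimes>\<^bsub>aut_group F P\<^esub> \<kappa> \<otimes>\<^bsub>aut_group F P\<^esub> inv\<^bsub>aut_group F P\<^esub> \<alpha>"
    have cA: "c \<in> carrier (aut_group F P)" using \<alpha> \<kappa>A by (simp add: c_def)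
    have "c \<otimes>\<^bsub>aut_group F P\<^esub> \<alpha> = \<alpha> \<otimes>\<^bsub>aut_group F P\<^esub> \<kappa>"
      using \<alpha> \<kappa>A by (simp add: c_def A.m_assoc)
    then have eq: "compose P c \<alpha> = compose P \<alpha> \<kappa>" using cA \<alpha> \<kappa>A simps by simp
    obtain h where h: "h \<in> carrier S" "c = conj_map S h P"
      using conj[OF \<kappa>] by (auto simp: conj_hom_def simp flip: c_def)
    have "\<alpha> (\<kappa> x) = h \<otimes> \<alpha> x \<otimes> inv h" if x: "x \<in> P" for x
    proof -
      have "\<alpha> x \<in> P" using \<alpha>'(2) x by auto
      then show ?thesis using fun_cong[OF eq, of x] x by (simp add: compose_def h conj_map_def)
    qed
    then show ?thesis using h by blast
  qed
  then show ?thesis using \<alpha>' by blast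
qed

end

lemma (in group_hom) card_image_prime_power:
  assumes p: "Factorial_Ring.prime p" and G: "order G = p ^ n"
  shows "\<exists>k. card (h ` carrier G) = p ^ k"
proof -
  have fin: "finite (carrier G)" using p G G.order_gt_0_iff_finite prime_gt_0_nat by (metis zero_less_power)
  interpret h: group_hom G "H\<lparr>carrier := h ` carrier G\<rparr>" h
    using img_is_subgroup H.subgroup_imp_group homh
    by (auto simp: group_hom_def group_hom_axioms_def hom_def)
  have "(\<lambda>X. the_elem (h ` X)) \<in> iso (G Mod kernel G (H\<lparr>carrier := h ` carrier G\<rparr>) h) (H\<lparr>carrier := h ` carrier G\<rparr>)"
    by (rule h.FactGroup_iso_set) simp
  then have "card (rcosets kernel G (H\<lparr>carrier := h ` carrier G\<rparr>) h) = card (h ` carrier G)"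
    using bij_betw_same_card by (force simp: iso_def FactGroup_def)
  then have "card (h ` carrier G) dvd p ^ n"
    using G.lagrange_finite[OF fin h.subgroup_kernel] G by (metis dvd_triv_left)
  then show ?thesis using p by (auto simp: divides_primepow_nat)
qed

context fusion_system
begin

text \<open>Transport along \<open>f\<close> turns \<open>Aut_S(P)\<close> into a p-subgroup of
  \<open>Aut_F(Q)\<close>, which some \<alpha> in \<open>Aut_F(Q)\<close> conjugates into
  \<open>Aut_S(Q)\<close>. The extender of the composite of \<open>f\<close> with \<alpha> then
  contains the whole normalizer. The extension restricts to this composite rather than to
  \<open>f\<close>, so only its image on \<open>P\<close> is asserted.\<close>

lemma sylow_extend:
  assumes Q: "fully_automised S p F Q" "receptive S F Q" and f: "fmor S F P f" "f ` P = Q"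
  shows "\<exists>f'. fmor S F (normalizer S P) f' \<and> f' ` P = Q"
proof -
  have P: "subgroup P S" and PS: "P \<subseteq> carrier S" and subQ: "subgroup Q S"
    using f fmor_subgroup fmor_image subgroup.subset by blast+
  have N: "subgroup (normalizer S P) S" by (rule normalizer_imp_subgroup[OF PS])
  note mem = mem_normalizer[OF P]
  \<comment> \<open>The automorphism \<open>f c_g f^-1\<close> of \<open>Q\<close>, for
    \<open>g\<close> in the normalizer of \<open>P\<close>.\<close>
  define c where "c g = (\<lambda>y. f (g \<otimes> inv_into P f y \<otimes> inv g))" for g
  have fi: "inv_into P f y \<in> P" "f (inv_into P f y) = y" if "y \<in> Q" for y
    using that f(2) by (auto intro: inv_into_into f_inv_into_f)
  have if_eq: "inv_into P f (f x) = x" if "x \<in> P" for x using fmor_inj_hom(2)[OF f(1)] that by simp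
  have c_apply: "c g (f x) = f (g \<otimes> x \<otimes> inv g)" if "x \<in> P" for g x
    using that by (simp add: c_def if_eq)
  have c_mem: "restrict (c g) Q \<in> F Q Q" if g: "g \<in> normalizer S P" for g
  proof (rule restrict_mem[OF _ subQ])
    have "fmor S F Q (\<lambda>y. g \<otimes> inv_into P f y \<otimes> inv g)"
      using fmor_comp[OF fmor_inv_into[OF f(1)] fmor_conjugation[OF P, of g]] g f(2) fi mem by auto
    then show "fmor S F Q (c g)"
      unfolding c_def using fi g mem by (intro fmor_comp[OF _ f(1)]) auto
    show "c g ` Q \<subseteq> Q" using g mem f(2) c_apply by auto
  qed
  have hom: "(\<lambda>g. restrict (c g) Q) \<in> hom (S\<lparr>carrier := normalizer S P\<rparr>) (aut_group F Q)"
  proof (rule homI)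
    show "restrict (c g) Q \<in> carrier (aut_group F Q)" if "g \<in> carrier (S\<lparr>carrier := normalizer S P\<rparr>)" for g
      using that c_mem by (simp add: aut_group_simps[OF subQ])
    fix g h assume gh: "g \<in> carrier (S\<lparr>carrier := normalizer S P\<rparr>)" "h \<in> carrier (S\<lparr>carrier := normalizer S P\<rparr>)"
    have "restrict (c (g \<otimes> h)) Q y = compose Q (restrict (c g) Q) (restrict (c h) Q) y" for y
    proof (cases "y \<in> Q")
      case True
      then obtain x where x: "x \<in> P" "y = f x" using f(2) by auto
      have hx: "h \<otimes> x \<otimes> inv h \<in> P" using gh x mem by auto
      have "c (g \<otimes> h) y = f (g \<otimes> (h \<otimes> x \<otimes> inv h) \<otimes> inv g)"
        using gh x mem PS c_apply[OF x(1)] by (auto simp: word_simps subsetD)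
      moreover have "c g (c h y) = f (g \<otimes> (h \<otimes> x \<otimes> inv h) \<otimes> inv g)"
        using x hx by (simp add: c_apply)
      moreover have "c h y \<in> Q" using x hx f(2) by (auto simp: c_apply)
      ultimately show ?thesis using True by (simp add: compose_def)
    qed (simp add: compose_def)
    then show "restrict (c (g \<otimes>\<^bsub>S\<lparr>carrier := normalizer S P\<rparr>\<^esub> h)) Q
        = restrict (c g) Q \<otimes>\<^bsub>aut_group F Q\<^esub> restrict (c h) Q"
      using gh c_mem by (simp add: aut_group_simps[OF subQ] fun_eq_iff)
  qed
  then interpret c: group_hom "S\<lparr>carrier := normalizer S P\<rparr>" "aut_group F Q" "\<lambda>g. restrict (c g) Q"
    using N group_aut_group(1)[OF subQ] by (simp add: group_hom_def group_hom_axioms_def subgroup_imp_group)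
  obtain m where "card (normalizer S P) = p ^ m" using card_subgroup[OF N] by blast
  then obtain n where n: "card ((\<lambda>g. restrict (c g) Q) ` normalizer S P) = p ^ n"
    using c.card_image_prime_power[OF prime_p, of m] by (auto simp: order_def)
  have K: "subgroup ((\<lambda>g. restrict (c g) Q) ` normalizer S P) (aut_group F Q)"
    using c.img_is_subgroup by simp
  obtain \<alpha> where \<alpha>: "fmor S F Q \<alpha>" "\<alpha> ` Q = Q"
    and conj: "\<forall>\<kappa>\<in>(\<lambda>g. restrict (c g) Q) ` normalizer S P. \<exists>h\<in>carrier S. \<forall>x\<in>Q. \<alpha> (\<kappa> x) = h \<otimes> \<alpha> x \<otimes> inv h"
    using fully_automised_conjugate[OF subQ Q(1) K n] by blast
  define f1 where "f1 = (\<lambda>x. \<alpha> (f x))"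
  have f1: "fmor S F P f1" "f1 ` P = Q"
    unfolding f1_def using fmor_comp[OF f(1) \<alpha>(1)] f(2) \<alpha>(2) by (auto simp flip: image_image)
  obtain f' where f': "fmor S F (extender S P Q (restrict f1 P)) f'" "\<And>x. x \<in> P \<Longrightarrow> f' x = f1 x"
    using receptive_extend[OF f1(1)] f1(2) Q(2) by auto
  have "normalizer S P \<subseteq> extender S P Q (restrict f1 P)"
  proof
    fix g assume g: "g \<in> normalizer S P"
    then obtain h where h: "h \<in> carrier S" "\<And>y. y \<in> Q \<Longrightarrow> \<alpha> (restrict (c g) Q y) = h \<otimes> \<alpha> y \<otimes> inv h"
      using conj by blast
    have "f1 (g \<otimes> x \<otimes> inv g) = h \<otimes> f1 x \<otimes> inv h" if x: "x \<in> P" for x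
    proof -
      have "f x \<in> Q" using x f(2) by auto
      then show ?thesis using h(2)[of "f x"] x by (simp add: f1_def c_apply)
    qed
    then show "g \<in> extender S P Q (restrict f1 P)"
      using mem_extender_iff[OF f1(1), of g] g mem h(1) f1(2) by blast
  qed
  then have "fmor S F (normalizer S P) f'" using f'(1) N fmor_restrict by blast
  moreover have "f' ` P = Q" using f'(2) f1(2) by (metis image_cong)
  ultimately show ?thesis by blast
qed

section \<open>Automorphisms fixing a subgroup pointwise\<close>

lemma aut_group_pow:
  assumes Q: "subgroup Q S" and \<sigma>: "\<sigma> \<in> F Q Q"
  shows "\<sigma> [^]\<^bsub>aut_group F Q\<^esub> (n::nat) = restrict (\<sigma> ^^ n) Q"
proof -
  interpret A: group "aut_group F Q" by (rule group_aut_group(1)[OF Q])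
  note simps = aut_group_simps[OF Q]
  have im: "\<sigma> x \<in> Q" if "x \<in> Q" for x using aut_memE(2)[OF Q \<sigma>] that by auto
  show ?thesis
  proof (induction n)
    case 0
    then show ?case by (simp add: simps(2))
  next
    case (Suc n)
    have "\<sigma> [^]\<^bsub>aut_group F Q\<^esub> Suc n = compose Q (\<sigma> [^]\<^bsub>aut_group F Q\<^esub> n) \<sigma>"
      using A.nat_pow_closed[of \<sigma> n] \<sigma> by (simp add: simps)
    then show ?case using im by (auto simp: Suc compose_def fun_eq_iff funpow_swap1)
  qed
qed

definition fixing_auts :: "'a set \<Rightarrow> 'a set \<Rightarrow> ('a \<Rightarrow> 'a) set" where
  "fixing_auts Q E = {\<kappa> \<in> F Q Q. \<forall>e\<in>E. \<kappa> e = e}"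

lemma fixing_auts_subgroup:
  assumes Q: "subgroup Q S" and EQ: "E \<subseteq> Q"
  shows "subgroup (fixing_auts Q E) (aut_group F Q)"
proof (rule group.subgroup_finiteI[OF group_aut_group(1)[OF Q]])
  note simps = aut_group_simps[OF Q]
  show "finite (carrier (aut_group F Q))" using group_aut_group(2)[OF Q] by (simp add: simps)
  show "fixing_auts Q E \<subseteq> carrier (aut_group F Q)" by (auto simp: fixing_auts_def simps)
  have "(\<lambda>x\<in>Q. x) \<in> fixing_auts Q E" using EQ inclusion_mem[OF Q Q] by (auto simp: fixing_auts_def)
  then show "fixing_auts Q E \<noteq> {}" by auto
  fix x y assume xy: "x \<in> fixing_auts Q E" "y \<in> fixing_auts Q E"
  then have F: "x \<in> F Q Q" "y \<in> F Q Q" by (auto simp: fixing_auts_def)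
  have "compose Q x y \<in> F Q Q" using compose_closed[OF Q Q Q F(2,1)] .
  moreover have "compose Q x y e = e" if "e \<in> E" for e
    using that xy EQ by (auto simp: fixing_auts_def compose_def)
  ultimately show "x \<otimes>\<^bsub>aut_group F Q\<^esub> y \<in> fixing_auts Q E" using F by (simp add: simps fixing_auts_def)
qed

text \<open>A further prime divisor \<open>q\<close> of the order would give an automorphism of
  order \<open>q\<close> fixing \<open>E\<close>, which \<open>faithful\<close> excludes.\<close>

lemma fixing_auts_prime_power:
  assumes Q: "subgroup Q S" and EQ: "E \<subseteq> Q"
    and faithful: "\<And>\<sigma> m. \<lbrakk>fmor S F Q \<sigma>; \<sigma> ` Q = Q; \<And>x. x \<in> Q \<Longrightarrow> (\<sigma> ^^ m) x = x; coprime m p;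
      \<And>e. e \<in> E \<Longrightarrow> \<sigma> e = e\<rbrakk> \<Longrightarrow> \<forall>x\<in>Q. \<sigma> x = x"
  shows "\<exists>n. card (fixing_auts Q E) = p ^ n"
proof -
  interpret A: group "aut_group F Q" by (rule group_aut_group(1)[OF Q])
  note simps = aut_group_simps[OF Q]
  define K where "K = fixing_auts Q E"
  have K: "subgroup K (aut_group F Q)" unfolding K_def by (rule fixing_auts_subgroup[OF Q EQ])
  interpret K: group "(aut_group F Q)\<lparr>carrier := K\<rparr>" by (rule A.subgroup_imp_group[OF K])
  have finK: "finite K" using group_aut_group(2)[OF Q] by (auto simp: K_def fixing_auts_def)
  have "card K \<noteq> 0" using finK subgroup.one_closed[OF K] by auto
  then obtain m where m: "card K = p ^ multiplicity p (card K) * m" "\<not> p dvd m"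
    using multiplicity_decompose'[of "card K" p] prime_p not_prime_unit by metis
  have "m = 1"
  proof (rule ccontr)
    assume "m \<noteq> 1"
    then obtain q where q: "Factorial_Ring.prime q" "q dvd m" using prime_factor_nat by blast
    then obtain m' where "m = q * m'" by auto
    then have ord: "order ((aut_group F Q)\<lparr>carrier := K\<rparr>) = q ^ 1 * (p ^ multiplicity p (card K) * m')"
      using m(1) by (simp add: order_def mult.left_commute)
    \<comment> \<open>Sylow's theorem with exponent one, in place of Cauchy's theorem.\<close>
    obtain H where H: "subgroup H ((aut_group F Q)\<lparr>carrier := K\<rparr>)" "card H = q"
      using sylow_thm[OF q(1) K.is_group ord] finK by auto
    have HK: "H \<subseteq> K" using subgroup.subset[OF H(1)] by simp
    have HA: "subgroup H (aut_group F Q)" using A.incl_subgroup[OF K H(1)] .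
    interpret H: group "(aut_group F Q)\<lparr>carrier := H\<rparr>" by (rule A.subgroup_imp_group[OF HA])
    have "H \<noteq> {\<one>\<^bsub>aut_group F Q\<^esub>}" using H(2) q(1) by auto
    moreover have "\<one>\<^bsub>aut_group F Q\<^esub> \<in> H" using subgroup.one_closed[OF HA] .
    ultimately obtain \<sigma> where \<sigma>: "\<sigma> \<in> H" "\<sigma> \<noteq> \<one>\<^bsub>aut_group F Q\<^esub>" by blast
    have \<sigma>F: "\<sigma> \<in> F Q Q" "\<And>e. e \<in> E \<Longrightarrow> \<sigma> e = e" using \<sigma> HK by (auto simp: K_def fixing_auts_def)
    have "\<sigma> [^]\<^bsub>aut_group F Q\<^esub> q = \<one>\<^bsub>aut_group F Q\<^esub>"
      using H.pow_order_eq_1[of \<sigma>] \<sigma>(1) H(2) A.nat_pow_consistent by (simp add: order_def)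
    then have eq: "restrict (\<sigma> ^^ q) Q = (\<lambda>x\<in>Q. x)" using aut_group_pow[OF Q \<sigma>F(1)] simps(2) by simp
    have "\<forall>x\<in>Q. \<sigma> x = x"
    proof (rule faithful[OF aut_memE(1,2)[OF Q \<sigma>F(1)] _ _ \<sigma>F(2)])
      show "(\<sigma> ^^ q) x = x" if "x \<in> Q" for x using fun_cong[OF eq, of x] that by simp
      have "q \<noteq> p" using q(2) m(2) by auto
      then show "coprime q p" using q(1) prime_p primes_coprime by blast
    qed
    then have "\<sigma> = (\<lambda>x\<in>Q. x)" using aut_memE(3)[OF Q \<sigma>F(1)] by (auto simp: extensional_def fun_eq_iff)
    then show False using \<sigma>(2) simps(2) by simp
  qed
  then show ?thesis using m by (auto simp flip: K_def)
qed

text \<open>Some \<alpha> conjugates the fixer of \<open>E\<close>, a p-group, into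
  \<open>Aut_S(Q)\<close>. The conjugated group is the fixer of the image of \<open>E\<close> under
  \<alpha>, so the conclusion speaks of that image.\<close>

lemma fully_automised_fixing_auts:
  assumes Q: "subgroup Q S" "fully_automised S p F Q" and EQ: "E \<subseteq> Q"
    and card: "\<exists>n. card (fixing_auts Q E) = p ^ n"
  shows "\<exists>\<alpha>. fmor S F Q \<alpha> \<and> \<alpha> ` Q = Q \<and>
    (\<forall>\<kappa>. fmor S F Q \<kappa> \<longrightarrow> \<kappa> ` Q = Q \<longrightarrow> (\<forall>e\<in>\<alpha> ` E. \<kappa> e = e) \<longrightarrow>
      (\<exists>h\<in>carrier S. \<forall>x\<in>Q. \<kappa> x = h \<otimes> x \<otimes> inv h))"
proof -
  obtain n where n: "card (fixing_auts Q E) = p ^ n" using card by blast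
  obtain \<alpha> where \<alpha>: "fmor S F Q \<alpha>" "\<alpha> ` Q = Q"
    and conj: "\<And>\<kappa>. \<kappa> \<in> fixing_auts Q E \<Longrightarrow> \<exists>h\<in>carrier S. \<forall>x\<in>Q. \<alpha> (\<kappa> x) = h \<otimes> \<alpha> x \<otimes> inv h"
    using fully_automised_conjugate[OF Q fixing_auts_subgroup[OF Q(1) EQ] n] by blast
  have inj: "inj_on \<alpha> Q" using fmor_inj_hom(2)[OF \<alpha>(1)] .
  define a where "a = inv_into Q \<alpha>"
  have a: "fmor S F Q a" "\<And>x. x \<in> Q \<Longrightarrow> a x \<in> Q" "\<And>x. x \<in> Q \<Longrightarrow> \<alpha> (a x) = x" "\<And>x. x \<in> Q \<Longrightarrow> a (\<alpha> x) = x"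
    using fmor_inv_into[OF \<alpha>(1)] \<alpha>(2) inj unfolding a_def
    by (auto intro: inv_into_into f_inv_into_f)
  have "\<exists>h\<in>carrier S. \<forall>x\<in>Q. \<kappa> x = h \<otimes> x \<otimes> inv h"
    if \<kappa>: "fmor S F Q \<kappa>" "\<kappa> ` Q = Q" "\<forall>e\<in>\<alpha> ` E. \<kappa> e = e" for \<kappa>
  proof -
    define \<mu> where "\<mu> = restrict (\<lambda>x. a (\<kappa> (\<alpha> x))) Q"
    have \<alpha>Q: "\<alpha> x \<in> Q" "\<kappa> x \<in> Q" if "x \<in> Q" for x using \<alpha>(2) \<kappa>(2) that by auto
    have "fmor S F Q (\<lambda>x. a (\<kappa> (\<alpha> x)))"
      by (rule fmor_comp[OF fmor_comp[OF \<alpha>(1) \<kappa>(1)] a(1)]) (use \<alpha>Q in auto)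
    then have "\<mu> \<in> F Q Q" unfolding \<mu>_def by (rule restrict_mem[OF _ Q(1)]) (use \<alpha>Q a in auto)
    moreover have "\<mu> e = e" if "e \<in> E" for e using that EQ \<kappa>(3) a by (auto simp: \<mu>_def)
    ultimately have "\<mu> \<in> fixing_auts Q E" by (simp add: fixing_auts_def)
    then obtain h where h: "h \<in> carrier S" "\<And>x. x \<in> Q \<Longrightarrow> \<alpha> (\<mu> x) = h \<otimes> \<alpha> x \<otimes> inv h"
      using conj by blast
    have "\<kappa> x = h \<otimes> x \<otimes> inv h" if x: "x \<in> Q" for x
      using h(2)[of "a x"] a x \<alpha>Q by (simp add: \<mu>_def)
    then show ?thesis using h(1) by blast
  qed
  then show ?thesis using \<alpha> by blast
qed

end

text \<open>Saturation provides some isomorphism onto a fully automised and receptive conjugate;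
  \<open>sylow_extend\<close> trades it for one defined on the whole normalizer.\<close>

lemma (in saturated_fusion_system) saturated_extend_normalizer:
  assumes P: "subgroup P S"
  shows "\<exists>f. fmor S F (normalizer S P) f \<and> fully_automised S p F (f ` P) \<and> receptive S F (f ` P)"
proof -
  obtain Q where Q: "subgroup Q S" "fusion_conj F P Q" "fully_automised S p F Q" "receptive S F Q"
    using saturated[OF P] by blast
  then obtain f g where fg: "f \<in> F P Q" "g \<in> F Q P" "compose Q f g = (\<lambda>x\<in>Q. x)"
    by (auto simp: fusion_conj_def fusion_iso_def)
  have "y \<in> f ` P" if "y \<in> Q" for y
  proof -
    have "f (g y) = y" using fun_cong[OF fg(3), of y] that by (simp add: compose_def)
    moreover have "g y \<in> P" using fg(2) that mem_iff_fmor[OF Q(1) P] by blast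
    ultimately show ?thesis by force
  qed
  then have "f ` P = Q" "fmor S F P f" using fg(1) mem_iff_fmor[OF P Q(1)] by auto
  then obtain f' where "fmor S F (normalizer S P) f'" "f' ` P = Q"
    using sylow_extend[OF Q(3,4)] by blast
  then show ?thesis using Q(3,4) by blast
qed

section \<open>Bases of elementary abelian groups\<close>

text \<open>A set is independent when its combinations with exponents below \<open>p\<close> are
  distinct. A maximal independent set spans, since any element outside its span could be
  adjoined.\<close>

lemma (in comm_group) fp_basis_exists:
  assumes p: "Factorial_Ring.prime p" and fin: "finite (carrier G)"
    and exp: "\<And>x. x \<in> carrier G \<Longrightarrow> x [^] (p::nat) = \<one>"
  shows "\<exists>B. fp_basis p G B"
proof -
  define m where "m B c = (\<Otimes>b\<in>B. b [^] (c b :: nat))" for B c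
  define ind where "ind B \<longleftrightarrow> inj_on (m B) (B \<rightarrow>\<^sub>E {..<p})" for B
  define \<B> where "\<B> = {B. B \<subseteq> carrier G \<and> ind B}"
  have "finite \<B>" using fin by (simp add: \<B>_def)
  moreover have "{} \<in> \<B>" by (simp add: \<B>_def ind_def)
  ultimately obtain B where B: "B \<in> \<B>" and max: "\<And>B'. B' \<in> \<B> \<Longrightarrow> B \<subseteq> B' \<Longrightarrow> B = B'"
    by (metis empty_iff finite_has_maximal)
  have BG: "B \<subseteq> carrier G" and inj: "inj_on (m B) (B \<rightarrow>\<^sub>E {..<p})" using B by (auto simp: \<B>_def ind_def)
  have finB: "finite B" using BG fin finite_subset by blast
  have p0: "0 < p" using p by (rule prime_gt_0_nat)
  have mod_p: "x [^] (k mod p) = x [^] k" if "x \<in> carrier G" for x and k :: nat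
  proof -
    have "x [^] k = x [^] (p * (k div p) + k mod p)" by simp
    also have "\<dots> = (x [^] p) [^] (k div p) \<otimes> x [^] (k mod p)"
      using that by (simp only: nat_pow_mult[symmetric] nat_pow_pow)
    finally show ?thesis using that exp by simp
  qed
  define I where "I = m B ` (B \<rightarrow>\<^sub>E {..<p})"
  have m_closed: "m B c \<in> carrier G" for c unfolding m_def using BG by (intro finprod_closed) auto
  have m_I: "m B c \<in> I" for c
  proof -
    have "m B c = m B (\<lambda>b\<in>B. c b mod p)"
      unfolding m_def by (rule finprod_cong') (use BG in \<open>auto simp: mod_p\<close>)
    moreover have "(\<lambda>b\<in>B. c b mod p) \<in> B \<rightarrow>\<^sub>E {..<p}" using p0 by auto
    ultimately show ?thesis unfolding I_def by blast
  qed
  have subI: "subgroup I G"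
  proof (rule subgroup_finiteI[OF fin])
    show "I \<subseteq> carrier G" using m_closed by (auto simp: I_def)
    show "I \<noteq> {}" using m_I by blast
    fix x y assume "x \<in> I" "y \<in> I"
    then obtain c d where "x = m B c" "y = m B d" by (auto simp: I_def)
    moreover have "m B (\<lambda>b. c b + d b) = (\<Otimes>b\<in>B. b [^] c b \<otimes> b [^] d b)"
      unfolding m_def by (rule finprod_cong') (use BG in \<open>auto simp: nat_pow_mult\<close>)
    moreover have "\<dots> = m B c \<otimes> m B d"
      unfolding m_def by (rule finprod_multf) (use BG in auto)
    ultimately show "x \<otimes> y \<in> I" using m_I by metis
  qed
  have "carrier G \<subseteq> I"
  proof
    fix x assume x: "x \<in> carrier G"
    show "x \<in> I"
    proof (rule ccontr)
      assume xI: "x \<notin> I"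
      have "x \<notin> B"
      proof
        assume xB: "x \<in> B"
        have "m B (\<lambda>b. if b = x then 1 else 0) = (\<Otimes>b\<in>B. if x = b then b else \<one>)"
          unfolding m_def using BG by (intro finprod_cong') auto
        also have "\<dots> = x" using xB finB BG by (intro finprod_singleton) auto
        finally show False using m_I xI by metis
      qed
      have m_insert: "m (insert x B) c = x [^] c x \<otimes> m B c" for c
        unfolding m_def using \<open>x \<notin> B\<close> finB BG x by (intro finprod_insert) auto
      have exp_unique: "k = l"
        if kl: "k < p" "l < p" and eq: "x [^] k \<otimes> u = x [^] l \<otimes> v" and uv: "u \<in> I" "v \<in> I" for k l u v
      proof (rule ccontr)
        assume "k \<noteq> l"
        have uvG: "u \<in> carrier G" "v \<in> carrier G" using uv subI subgroup.subset by blast+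
        \<comment> \<open>A natural number representing \<open>k - l\<close> modulo
          \<open>p\<close>. It lies strictly between 0 and \<open>2 * p\<close> and differs from
          \<open>p\<close>, so it is invertible modulo \<open>p\<close>, and a power of
          \<open>x [^] e\<close> recovers \<open>x\<close>.\<close>
        define e where "e = k + (p - l)"
        have "x [^] e \<otimes> u = x [^] (p - l) \<otimes> (x [^] k \<otimes> u)"
          using x uvG by (simp add: e_def nat_pow_mult add.commute flip: m_assoc)
        also have "\<dots> = x [^] (p - l + l) \<otimes> v" using x uvG by (simp add: eq nat_pow_mult flip: m_assoc)
        also have "\<dots> = v" using kl exp[OF x] uvG by simp
        finally have "x [^] e = v \<otimes> inv u" using x uvG by (metis inv_solve_right nat_pow_closed)
        then have xe: "x [^] e \<in> I" using uv subI by (simp add: subgroup.m_closed subgroup.m_inv_closed)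
        have "\<not> p dvd e"
        proof
          assume "p dvd e"
          then obtain t where t: "e = p * t" by (elim dvdE)
          moreover have "0 < e" "e < p * 2" using kl by (auto simp: e_def)
          ultimately have "t = 1" by auto
          then show False using t kl \<open>k \<noteq> l\<close> by (simp add: e_def)
        qed
        then have "coprime e p" using prime_imp_coprime[OF p] by (simp add: coprime_commute)
        then obtain f where f: "[e * f = 1] (mod p)" using cong_solve_coprime_nat by (metis One_nat_def)
        have "(x [^] e) [^] f = x [^] ((e * f) mod p)" using x mod_p by (simp add: nat_pow_pow)
        also have "(e * f) mod p = 1 mod p" using f by (simp add: cong_def)
        also have "x [^] (1 mod p) = x" using x mod_p[OF x, of 1] by simp
        finally show False using subgroup_pow_closed[OF subI xe, of f] xI by simp
      qed
      have "ind (insert x B)"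
        unfolding ind_def
      proof (rule inj_onI)
        fix c d assume cd: "c \<in> insert x B \<rightarrow>\<^sub>E {..<p}" "d \<in> insert x B \<rightarrow>\<^sub>E {..<p}"
          and eq: "m (insert x B) c = m (insert x B) d"
        have x_eq: "c x = d x"
          using cd eq m_I by (intro exp_unique[of _ _ "m B c" "m B d"]) (auto simp: m_insert)
        then have "m B c = m B d" using eq x m_closed by (simp add: m_insert)
        moreover have "m B (restrict c B) = m B c" for c
          unfolding m_def using BG by (intro finprod_cong') auto
        ultimately have "restrict c B = restrict d B"
          using inj_onD[OF inj, of "restrict c B" "restrict d B"] cd by (auto simp: PiE_iff)
        then have "c b = d b" if "b \<in> insert x B" for b
          using x_eq that by (metis insertE restrict_apply')
        then show "c = d" using cd by (intro PiE_ext)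
      qed
      then have "insert x B \<in> \<B>" using BG x by (simp add: \<B>_def)
      then show False using max[of "insert x B"] \<open>x \<notin> B\<close> by blast
    qed
  qed
  then have "I = carrier G" using subI subgroup.subset by blast
  then have "fp_basis p G B"
    using inj finB BG unfolding fp_basis_def bij_betw_def I_def m_def by blast
  then show ?thesis by blast
qed

lemma fp_basis_card:
  assumes "fp_basis p G B"
  shows "card (carrier G) = p ^ card B"
proof -
  have "finite B" and bij: "bij_betw (\<lambda>c. \<Otimes>\<^bsub>G\<^esub>b\<in>B. b [^]\<^bsub>G\<^esub> c b) (B \<rightarrow>\<^sub>E {..<p}) (carrier G)"
    using assms by (auto simp: fp_basis_def)
  then have "card (B \<rightarrow>\<^sub>E {..<p}) = p ^ card B" by (simp add: card_PiE)
  then show ?thesis using bij_betw_same_card[OF bij] by simp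
qed

text \<open>A basis \<open>B\<close> forces the group to have \<open>p ^ card B\<close> elements, so
  all bases have the same size and the definite description in \<open>fp_rank\<close> denotes
  it.\<close>

lemma (in comm_group) le_fp_rank:
  assumes p: "Factorial_Ring.prime p" and fin: "finite (carrier G)"
    and exp: "\<And>x. x \<in> carrier G \<Longrightarrow> x [^] (p::nat) = \<one>" and card: "p ^ n \<le> card (carrier G)"
  shows "n \<le> fp_rank p G"
proof -
  obtain B where B: "fp_basis p G B" using fp_basis_exists[OF p fin exp] by blast
  have p1: "1 < p" using p by (rule prime_gt_1_nat)
  have "fp_rank p G = card B"
    unfolding fp_rank_def
  proof (rule the_equality)
    show "\<exists>B'. fp_basis p G B' \<and> card B' = card B" using B by blast
    fix k assume "\<exists>B'. fp_basis p G B' \<and> card B' = k"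
    then have "p ^ k = p ^ card B" using fp_basis_card B by metis
    then show "k = card B" using p1 by simp
  qed
  then show ?thesis using card fp_basis_card[OF B] p1 by (simp add: power_increasing_iff)
qed

section \<open>Comparison of two fusion systems\<close>

locale fusion_pair = finite_p_group S p +
  F: saturated_fusion_system S p F + G: saturated_fusion_system S p G
  for S (structure) and p and F G +
  assumes le: "fusion_le S G F"
begin

lemma fmor_le: "fmor S G P f \<Longrightarrow> fmor S F P f"
  using le subgroup_self by (auto simp: fusion_le_def fmor_def)

text \<open>Goodness in the sense of the overview: by \<open>mem_iff_fmor\<close>, morphisms into
  \<open>S\<close> determine every hom set out of \<open>P\<close>.\<close>

definition agree :: "'a set \<Rightarrow> bool" where
  "agree P \<longleftrightarrow> (\<forall>f. fmor S F P f \<longrightarrow> fmor S G P f)"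

lemma agreeD: "agree P \<Longrightarrow> fmor S F P f \<Longrightarrow> fmor S G P f"
  by (simp add: agree_def)

text \<open>Two morphisms \<epsilon> and \<chi> of \<open>G\<close> on \<open>Q\<close> are built
  such that \<open>\<chi> \<circ> \<alpha>\<close> and \<epsilon> agree on \<open>E\<close>. It
  remains to put \<nu>, the inverse of \<open>\<chi> \<circ> \<alpha>\<close>, into
  \<open>G\<close>. Either \<nu> extends to a larger subgroup, where the systems agree, or its
  domain \<open>Q2\<close> contains the centralizer of the image of \<open>E\<close> under
  \<epsilon>. In the latter case \<epsilon> also maps onto \<open>Q2\<close>, and
  \<open>\<nu> \<circ> \<epsilon>\<close> is an automorphism to which \<open>fixing\<close>
  applies.\<close>

lemma aut_agree:
  assumes Q: "subgroup Q S" and rec: "receptive S F Q"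
    and big: "\<And>R. subgroup R S \<Longrightarrow> card Q < card R \<Longrightarrow> agree R"
    and E: "subgroup E S" "E \<subseteq> Q" "\<And>g e. g \<in> Q \<Longrightarrow> e \<in> E \<Longrightarrow> g \<otimes> e \<otimes> inv g \<in> E"
    and agree_E: "\<And>f. fmor S F Q f \<Longrightarrow> agree (f ` E)"
    and fixing: "\<And>\<kappa>. fmor S F Q \<kappa> \<Longrightarrow> \<kappa> ` Q = Q \<Longrightarrow> \<forall>e\<in>E. \<kappa> e = e
        \<Longrightarrow> \<exists>h\<in>carrier S. \<forall>x\<in>Q. \<kappa> x = h \<otimes> x \<otimes> inv h"
    and \<alpha>: "fmor S F Q \<alpha>" "\<alpha> ` Q = Q"
  shows "fmor S G Q \<alpha>"
proof -
  have QS: "Q \<subseteq> carrier S" using Q subgroup.subset by auto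
  define a where "a = inv_into Q \<alpha>"
  have a: "fmor S F Q a" "a ` Q = Q" "\<And>x. x \<in> Q \<Longrightarrow> a x \<in> Q" "\<And>x. x \<in> Q \<Longrightarrow> \<alpha> (a x) = x"
      "\<And>x. x \<in> Q \<Longrightarrow> a (\<alpha> x) = x"
  proof -
    have inj: "inj_on \<alpha> Q" using F.fmor_inj_hom(2)[OF \<alpha>(1)] .
    show "fmor S F Q a" using F.fmor_inv_into[OF \<alpha>(1)] \<alpha>(2) by (simp add: a_def)
    show "\<And>x. x \<in> Q \<Longrightarrow> a x \<in> Q" "\<And>x. x \<in> Q \<Longrightarrow> \<alpha> (a x) = x" "\<And>x. x \<in> Q \<Longrightarrow> a (\<alpha> x) = x"
      using \<alpha>(2) inj unfolding a_def by (auto intro: inv_into_into f_inv_into_f)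
    show "a ` Q = Q" using inv_into_image_cancel[OF inj order_refl] \<alpha>(2) by (simp add: a_def)
  qed
  have \<alpha>Q: "\<alpha> x \<in> Q" if "x \<in> Q" for x using \<alpha>(2) that by auto
  have EQ: "e \<in> Q" if "e \<in> E" for e using E(2) that by auto
  have \<alpha>E: "subgroup (\<alpha> ` E) S" "\<alpha> ` E \<subseteq> Q" using F.fmor_image_subgroup[OF \<alpha>(1) E(1,2)] E(2) \<alpha>(2) by auto
  \<comment> \<open>The isomorphism onto a conjugate receptive in \<open>G\<close> is taken on the
    normalizer of \<open>E\<close>, so that it is defined on \<open>Q\<close>.\<close>
  obtain \<epsilon> where \<epsilon>N: "fmor S G (normalizer S E) \<epsilon>" and rec_E: "receptive S G (\<epsilon> ` E)"
    using G.saturated_extend_normalizer[OF E(1)] by blast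
  have "Q \<subseteq> normalizer S E" using E(3) QS by (auto simp: F.mem_normalizer[OF E(1)])
  then have \<epsilon>: "fmor S G Q \<epsilon>" using G.fmor_restrict[OF \<epsilon>N Q] by blast
  note \<epsilon>F = fmor_le[OF \<epsilon>]
  \<comment> \<open>On the image of \<open>E\<close> under \<alpha> this is an isomorphism in
    \<open>F\<close> onto the same receptive subgroup; the systems agree on that image, so it lies
    in \<open>G\<close>.\<close>
  define \<psi> where "\<psi> = (\<lambda>y. \<epsilon> (a y))"
  have \<psi>\<alpha>: "\<psi> (\<alpha> x) = \<epsilon> x" if "x \<in> Q" for x using that a by (simp add: \<psi>_def)
  have "fmor S F Q \<psi>" unfolding \<psi>_def using F.fmor_comp[OF a(1) \<epsilon>F] a(2) by simp
  then have "fmor S F (\<alpha> ` E) \<psi>" using F.fmor_restrict \<alpha>E by blast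
  then have \<psi>: "fmor S G (\<alpha> ` E) \<psi>" using agreeD[OF agree_E[OF \<alpha>(1)]] by blast
  have im_\<psi>: "\<psi> ` \<alpha> ` E = \<epsilon> ` E" using \<psi>\<alpha> EQ by (auto simp: image_iff)
  obtain \<chi> where \<chi>X: "fmor S G (extender S (\<alpha> ` E) (\<epsilon> ` E) (restrict \<psi> (\<alpha> ` E))) \<chi>"
    and \<chi>\<psi>: "\<And>y. y \<in> \<alpha> ` E \<Longrightarrow> \<chi> y = \<psi> y"
    using G.receptive_extend[OF \<psi>] rec_E unfolding im_\<psi> by blast
  \<comment> \<open>Conjugation by \<open>g\<close> is carried to conjugation by
    \<open>\<epsilon> (a g)\<close>. Hence \<open>Q\<close> lies in the extender and the restriction
    of \<psi> lifts to \<open>Q\<close> within \<open>G\<close>.\<close>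
  have act: "\<psi> (g \<otimes> y \<otimes> inv g) = \<epsilon> (a g) \<otimes> \<psi> y \<otimes> inv (\<epsilon> (a g))" "g \<otimes> y \<otimes> inv g \<in> \<alpha> ` E"
    if g: "g \<in> Q" and y: "y \<in> \<alpha> ` E" for g y
  proof -
    obtain e where e: "e \<in> E" "y = \<alpha> e" using y by auto
    have eq: "g \<otimes> y \<otimes> inv g = \<alpha> (a g \<otimes> e \<otimes> inv (a g))"
      using F.fmor_conj[OF \<alpha>(1) a(3)[OF g] EQ[OF e(1)]] a(4)[OF g] e(2) by simp
    have E': "a g \<otimes> e \<otimes> inv (a g) \<in> E" using E(3) a(3)[OF g] e(1) by blast
    then show "g \<otimes> y \<otimes> inv g \<in> \<alpha> ` E" using eq by auto
    have "\<psi> (g \<otimes> y \<otimes> inv g) = \<epsilon> (a g \<otimes> e \<otimes> inv (a g))" using eq \<psi>\<alpha> EQ[OF E'] by simp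
    then show "\<psi> (g \<otimes> y \<otimes> inv g) = \<epsilon> (a g) \<otimes> \<psi> y \<otimes> inv (\<epsilon> (a g))"
      using F.fmor_conj[OF \<epsilon>F a(3)[OF g] EQ[OF e(1)]] \<psi>\<alpha>[OF EQ[OF e(1)]] e(2) by simp
  qed
  have "Q \<subseteq> extender S (\<alpha> ` E) (\<epsilon> ` E) (restrict \<psi> (\<alpha> ` E))"
  proof
    fix g assume g: "g \<in> Q"
    have "\<epsilon> (a g) \<in> carrier S" using F.fmor_closed[OF \<epsilon>F a(3)[OF g]] .
    then show "g \<in> extender S (\<alpha> ` E) (\<epsilon> ` E) (restrict \<psi> (\<alpha> ` E))"
      using G.mem_extender_iff[OF \<psi>, of g] act[OF g] g QS unfolding im_\<psi> by blast
  qed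
  then have \<chi>: "fmor S G Q \<chi>" using G.fmor_restrict[OF \<chi>X Q] by blast
  note \<chi>F = fmor_le[OF \<chi>]
  have \<chi>\<alpha>: "\<chi> (\<alpha> e) = \<epsilon> e" if "e \<in> E" for e using that \<chi>\<psi> \<psi>\<alpha> EQ by auto
  define Q2 where "Q2 = \<chi> ` Q"
  have Q2: "subgroup Q2 S" "Q2 \<subseteq> carrier S" "card Q2 = card Q"
    using G.fmor_image[OF \<chi>] subgroup.subset G.fmor_card[OF \<chi>] by (auto simp: Q2_def)
  have finQ2: "finite Q2" using subgroup_finite[OF Q2(1)] .
  define b where "b = inv_into Q \<chi>"
  have b: "fmor S F Q2 b" "\<And>z. z \<in> Q2 \<Longrightarrow> b z \<in> Q" "\<And>z. z \<in> Q2 \<Longrightarrow> \<chi> (b z) = z" "\<And>x. x \<in> Q \<Longrightarrow> b (\<chi> x) = x"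
    using F.fmor_inv_into[OF \<chi>F] F.fmor_inj_hom(2)[OF \<chi>F] unfolding b_def Q2_def
    by (auto intro: inv_into_into f_inv_into_f)
  define \<nu> where "\<nu> = (\<lambda>z. a (b z))"
  have \<nu>: "fmor S F Q2 \<nu>" unfolding \<nu>_def using F.fmor_comp[OF b(1) a(1)] b(2) by blast
  have \<nu>\<chi>: "\<nu> (\<chi> (\<alpha> x)) = x" if "x \<in> Q" for x using that by (simp add: \<nu>_def b a \<alpha>Q)
  have Q2E: "\<exists>x\<in>Q. z = \<chi> (\<alpha> x)" if z: "z \<in> Q2" for z
  proof -
    obtain y where "y \<in> Q" "z = \<chi> y" using z by (auto simp: Q2_def)
    then show ?thesis using a by metis
  qed
  have \<chi>Q2: "\<chi> (\<alpha> x) \<in> Q2" if "x \<in> Q" for x using that \<alpha>Q by (simp add: Q2_def)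
  have \<nu>Q2: "\<nu> ` Q2 = Q"
  proof
    show "\<nu> ` Q2 \<subseteq> Q" using a b by (auto simp: \<nu>_def)
    show "Q \<subseteq> \<nu> ` Q2" using \<nu>\<chi> \<chi>Q2 by force
  qed
  \<comment> \<open>\<open>\<nu> \<circ> \<chi>\<close> is the inverse of \<alpha> on
    \<open>Q\<close>.\<close>
  have goal: "fmor S G Q \<alpha>" if "fmor S G Q2 \<nu>"
  proof -
    have "fmor S G Q (\<lambda>x. \<nu> (\<chi> x))" by (rule G.fmor_comp[OF \<chi> that]) (simp add: Q2_def)
    then have "fmor S G Q a" by (rule G.fmor_cong) (simp add: \<nu>_def b)
    then have "fmor S G Q (inv_into Q a)" using G.fmor_inv_into[of Q a] a(2) by simp
    moreover have "inv_into Q a x = \<alpha> x" if "x \<in> Q" for x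
      using F.fmor_inj_hom(2)[OF a(1)] \<alpha>Q[OF that] a(5)[OF that] by (metis inv_into_f_f)
    ultimately show ?thesis by (rule G.fmor_cong)
  qed
  define X where "X = extender S Q2 Q (restrict \<nu> Q2)"
  have mem_X: "g \<in> X \<longleftrightarrow> g \<in> carrier S \<and> (\<forall>x\<in>Q2. g \<otimes> x \<otimes> inv g \<in> Q2)
    \<and> (\<exists>h\<in>carrier S. \<forall>x\<in>Q2. \<nu> (g \<otimes> x \<otimes> inv g) = h \<otimes> \<nu> x \<otimes> inv h)" for g
    using F.mem_extender_iff[OF \<nu>, of g] unfolding \<nu>Q2 X_def .
  have X: "subgroup X S" using F.extender_subgroup[OF \<nu>] unfolding \<nu>Q2 X_def .
  have Q2X: "Q2 \<subseteq> X"
  proof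
    fix g assume g: "g \<in> Q2"
    have "g \<otimes> x \<otimes> inv g \<in> Q2" if "x \<in> Q2" for x
      using g that Q2(1) by (simp add: subgroup.m_closed subgroup.m_inv_closed)
    moreover have "\<nu> (g \<otimes> x \<otimes> inv g) = \<nu> g \<otimes> \<nu> x \<otimes> inv (\<nu> g)" if "x \<in> Q2" for x
      using F.fmor_conj[OF \<nu> g that] .
    moreover have "\<nu> g \<in> carrier S" using F.fmor_closed[OF \<nu> g] .
    ultimately show "g \<in> X" unfolding mem_X using g Q2(2) by blast
  qed
  show ?thesis
  proof (cases "X = Q2")
    case False
    then have "card Q < card X" using Q2X Q2(3) subgroup_finite[OF X] psubset_card_mono by (metis psubsetI)
    then have "agree X" using big X by blast
    obtain \<nu>' where "fmor S F X \<nu>'" and eq: "\<forall>z\<in>Q2. \<nu>' z = \<nu> z"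
      using F.receptive_extend[OF \<nu>] rec unfolding \<nu>Q2 X_def by blast
    then have "fmor S G X \<nu>'" using agreeD[OF \<open>agree X\<close>] by blast
    then have "fmor S G Q2 \<nu>'" using G.fmor_restrict Q2(1) Q2X by blast
    then have "fmor S G Q2 \<nu>" by (rule G.fmor_cong) (use eq in auto)
    then show ?thesis by (rule goal)
  next
    case XQ2: True
    define E2 where "E2 = \<epsilon> ` E"
    have E2S: "E2 \<subseteq> carrier S" using F.fmor_closed[OF \<epsilon>F] EQ by (auto simp: E2_def)
    \<comment> \<open>As \<open>\<chi> \<circ> \<alpha>\<close> and \<epsilon> agree on
      \<open>E\<close>, the elements \<open>\<chi> (\<alpha> x)\<close> and
      \<open>\<epsilon> x\<close> act alike on \<open>E2\<close> and so differ by an element of its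
      centralizer.\<close>
    have same_action: "\<chi> (\<alpha> x) \<otimes> e \<otimes> inv (\<chi> (\<alpha> x)) = \<epsilon> x \<otimes> e \<otimes> inv (\<epsilon> x)"
      and norm_E2: "\<epsilon> x \<otimes> e \<otimes> inv (\<epsilon> x) \<in> E2" if x: "x \<in> Q" and e: "e \<in> E2" for x e
    proof -
      obtain d where d: "d \<in> E" "e = \<epsilon> d" using e by (auto simp: E2_def)
      have d': "x \<otimes> d \<otimes> inv x \<in> E" using E(3) x d(1) by blast
      have 1: "\<epsilon> (x \<otimes> d \<otimes> inv x) = \<epsilon> x \<otimes> e \<otimes> inv (\<epsilon> x)"
        using F.fmor_conj[OF \<epsilon>F x EQ[OF d(1)]] d(2) by simp
      have "\<chi> (\<alpha> (x \<otimes> d \<otimes> inv x)) = \<chi> (\<alpha> x) \<otimes> \<chi> (\<alpha> d) \<otimes> inv (\<chi> (\<alpha> x))"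
        using F.fmor_conj[OF \<alpha>(1) x EQ[OF d(1)]] F.fmor_conj[OF \<chi>F \<alpha>Q[OF x] \<alpha>Q[OF EQ[OF d(1)]]] by simp
      then show "\<chi> (\<alpha> x) \<otimes> e \<otimes> inv (\<chi> (\<alpha> x)) = \<epsilon> x \<otimes> e \<otimes> inv (\<epsilon> x)"
        using \<chi>\<alpha>[OF d(1)] \<chi>\<alpha>[OF d'] d(2) 1 by simp
      show "\<epsilon> x \<otimes> e \<otimes> inv (\<epsilon> x) \<in> E2" unfolding E2_def 1[symmetric] using d' by (rule imageI)
    qed
    have norm_Q2: "z \<otimes> e \<otimes> inv z \<in> E2" if "z \<in> Q2" "e \<in> E2" for z e
      using Q2E[OF that(1)] same_action norm_E2 that(2) by metis
    define C where "C = centralizer E2"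
    have C: "subgroup C S" "C \<subseteq> carrier S" unfolding C_def using centralizer_subgroup[OF E2S] by (auto simp: centralizer_def)
    have C_comm: "c \<otimes> e = e \<otimes> c" if "c \<in> C" "e \<in> E2" for c e using that by (simp add: C_def centralizer_def)
    \<comment> \<open>Transported by \<nu>, conjugation by \<open>g\<close> fixes \<open>E\<close>
      pointwise and is therefore induced by some \<open>h\<close> in \<open>S\<close>. This puts
      \<open>g\<close> into the extender of \<nu>, which is just \<open>Q2\<close> in this
      case.\<close>
    have norm_C: "g \<in> Q2" if g: "g \<in> C" "\<And>z. z \<in> Q2 \<Longrightarrow> g \<otimes> z \<otimes> inv g \<in> Q2" for g
    proof -
      have gS: "g \<in> carrier S" using g C by auto
      define \<kappa> where "\<kappa> = (\<lambda>x. \<nu> (g \<otimes> \<chi> (\<alpha> x) \<otimes> inv g))"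
      have "fmor S F Q (\<lambda>x. g \<otimes> \<chi> (\<alpha> x) \<otimes> inv g)"
        by (rule F.fmor_comp[OF F.fmor_comp[OF \<alpha>(1) \<chi>F] F.fmor_conjugation[OF Q2(1) gS]])
           (use \<alpha>Q \<chi>Q2 in auto)
      then have \<kappa>: "fmor S F Q \<kappa>"
        unfolding \<kappa>_def by (rule F.fmor_comp[OF _ \<nu>]) (use g(2) \<chi>Q2 in auto)
      have "\<kappa> ` Q \<subseteq> Q" using g(2) \<chi>Q2 \<nu>Q2 by (auto simp: \<kappa>_def)
      then have "\<kappa> ` Q = Q" using F.fmor_card[OF \<kappa>] subgroup_finite[OF Q] by (intro card_subset_eq) auto
      moreover have "\<kappa> e = e" if e: "e \<in> E" for e
      proof -
        have eS: "\<epsilon> e \<in> carrier S" using F.fmor_closed[OF \<epsilon>F EQ[OF e]] .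
        have "g \<otimes> \<epsilon> e = \<epsilon> e \<otimes> g" using C_comm[OF g(1), of "\<epsilon> e"] e by (simp add: E2_def)
        then have "g \<otimes> \<chi> (\<alpha> e) \<otimes> inv g = \<chi> (\<alpha> e)" using gS eS \<chi>\<alpha>[OF e] by (simp add: word_simps)
        then show ?thesis using \<nu>\<chi> EQ[OF e] by (simp add: \<kappa>_def)
      qed
      ultimately obtain h where h: "h \<in> carrier S" "\<And>x. x \<in> Q \<Longrightarrow> \<kappa> x = h \<otimes> x \<otimes> inv h"
        using fixing[OF \<kappa>] by blast
      have "\<nu> (g \<otimes> z \<otimes> inv g) = h \<otimes> \<nu> z \<otimes> inv h" if z: "z \<in> Q2" for z
      proof -
        obtain x where x: "x \<in> Q" "z = \<chi> (\<alpha> x)" using Q2E[OF z] by blast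
        then show ?thesis using h(2)[OF x(1)] \<nu>\<chi> by (simp add: \<kappa>_def)
      qed
      then have "g \<in> X" unfolding mem_X using gS g(2) h(1) by blast
      then show ?thesis using XQ2 by simp
    qed
    \<comment> \<open>The product of \<open>Q2\<close> and \<open>C\<close>, a subgroup because
      \<open>Q2\<close> normalises \<open>C\<close>. Were it larger than \<open>Q2\<close>, some
      \<open>q \<otimes> c\<close> outside \<open>Q2\<close> would normalise \<open>Q2\<close>; then
      \<open>c\<close> normalises it too and lies in \<open>Q2\<close> by
      \<open>norm_C\<close>.\<close>
    define M where "M = {q \<otimes> c | q c. q \<in> Q2 \<and> c \<in> C}"
    have Q2_inv: "inv q \<in> Q2" if "q \<in> Q2" for q using subgroup.m_inv_closed[OF Q2(1) that] .
    have conj_C: "inv q \<otimes> c \<otimes> q \<in> C" if q: "q \<in> Q2" and c: "c \<in> C" for q c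
    proof -
      have qc: "q \<in> carrier S" "c \<in> carrier S" using q c Q2(2) C(2) by auto
      have "inv q \<otimes> c \<otimes> q \<otimes> e = e \<otimes> (inv q \<otimes> c \<otimes> q)" if e: "e \<in> E2" for e
      proof -
        have eS: "e \<in> carrier S" using e E2S by auto
        have "c \<otimes> (q \<otimes> e \<otimes> inv q) = (q \<otimes> e \<otimes> inv q) \<otimes> c" using C_comm[OF c norm_Q2[OF q e]] .
        then have "inv q \<otimes> (c \<otimes> (q \<otimes> e \<otimes> inv q)) \<otimes> q = inv q \<otimes> ((q \<otimes> e \<otimes> inv q) \<otimes> c) \<otimes> q" by simp
        then show ?thesis using qc eS by (simp add: word_simps)
      qed
      then show ?thesis using qc by (simp add: C_def centralizer_def)
    qed
    have subM: "subgroup M S"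
    proof (rule subgroup_finiteI[OF fin])
      show "M \<subseteq> carrier S" using Q2(2) C(2) by (auto simp: M_def)
      show "M \<noteq> {}" using subgroup.one_closed[OF Q2(1)] subgroup.one_closed[OF C(1)] by (auto simp: M_def)
      fix x y assume "x \<in> M" "y \<in> M"
      then obtain q c q' c' where qc: "q \<in> Q2" "c \<in> C" "q' \<in> Q2" "c' \<in> C" "x = q \<otimes> c" "y = q' \<otimes> c'"
        by (auto simp: M_def)
      then have S: "q \<in> carrier S" "c \<in> carrier S" "q' \<in> carrier S" "c' \<in> carrier S" using Q2(2) C(2) by auto
      have "x \<otimes> y = (q \<otimes> q') \<otimes> ((inv q' \<otimes> c \<otimes> q') \<otimes> c')" using S qc(5,6) by (simp add: word_simps)
      moreover have "q \<otimes> q' \<in> Q2" using qc subgroup.m_closed[OF Q2(1)] by blast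
      moreover have "(inv q' \<otimes> c \<otimes> q') \<otimes> c' \<in> C" using qc conj_C subgroup.m_closed[OF C(1)] by blast
      ultimately show "x \<otimes> y \<in> M" unfolding M_def by blast
    qed
    have Q2M: "Q2 \<subseteq> M"
    proof
      fix q assume q: "q \<in> Q2"
      then have "q = q \<otimes> \<one>" using Q2(2) by auto
      then show "q \<in> M" using q subgroup.one_closed[OF C(1)] unfolding M_def by blast
    qed
    have "M = Q2"
    proof (rule ccontr)
      assume "M \<noteq> Q2"
      interpret M: finite_p_group "S\<lparr>carrier := M\<rparr>" p by (rule subgroup_finite_p_group[OF subM])
      have "subgroup Q2 (S\<lparr>carrier := M\<rparr>)" using subgroup_incl[OF Q2(1) subM Q2M] .
      then obtain x where x: "x \<in> M" "x \<notin> Q2" "\<And>r. r \<in> Q2 \<Longrightarrow> x \<otimes> r \<otimes> inv\<^bsub>S\<lparr>carrier := M\<rparr>\<^esub> x \<in> Q2"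
        using M.normalizer_growth[of Q2] \<open>M \<noteq> Q2\<close> by auto
      then obtain q c where qc: "q \<in> Q2" "c \<in> C" "x = q \<otimes> c" by (auto simp: M_def)
      have qcS: "q \<in> carrier S" "c \<in> carrier S" using qc Q2(2) C(2) by auto
      have "c \<otimes> z \<otimes> inv c \<in> Q2" if z: "z \<in> Q2" for z
      proof -
        have zS: "z \<in> carrier S" using z Q2(2) by auto
        have "x \<otimes> z \<otimes> inv x \<in> Q2" using x(3)[OF z] m_inv_consistent[OF subM x(1)] by simp
        then have "inv q \<otimes> (x \<otimes> z \<otimes> inv x) \<otimes> q \<in> Q2" using qc(1) Q2_inv subgroup.m_closed[OF Q2(1)] by blast
        then show ?thesis using qcS zS qc(3) by (simp add: word_simps)
      qed
      then have "c \<in> Q2" using norm_C qc(2) by blast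
      then show False using x(2) qc subgroup.m_closed[OF Q2(1)] by blast
    qed
    have CQ2: "c \<in> Q2" if "c \<in> C" for c
    proof -
      have "c = \<one> \<otimes> c" using that C(2) by auto
      then have "c \<in> M" using that subgroup.one_closed[OF Q2(1)] unfolding M_def by blast
      then show ?thesis using \<open>M = Q2\<close> by simp
    qed
    have \<epsilon>Q2: "\<epsilon> x \<in> Q2" if x: "x \<in> Q" for x
    proof -
      have S: "\<epsilon> x \<in> carrier S" "\<chi> (\<alpha> x) \<in> carrier S" using F.fmor_closed[OF \<epsilon>F x] \<chi>Q2[OF x] Q2(2) by auto
      have "inv (\<chi> (\<alpha> x)) \<otimes> \<epsilon> x \<otimes> e = e \<otimes> (inv (\<chi> (\<alpha> x)) \<otimes> \<epsilon> x)" if e: "e \<in> E2" for e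
      proof -
        have eS: "e \<in> carrier S" using e E2S by auto
        have "inv (\<chi> (\<alpha> x)) \<otimes> (\<chi> (\<alpha> x) \<otimes> e \<otimes> inv (\<chi> (\<alpha> x))) \<otimes> \<epsilon> x
            = inv (\<chi> (\<alpha> x)) \<otimes> (\<epsilon> x \<otimes> e \<otimes> inv (\<epsilon> x)) \<otimes> \<epsilon> x"
          using same_action[OF x e] by simp
        then show ?thesis using S eS by (simp add: word_simps)
      qed
      then have "inv (\<chi> (\<alpha> x)) \<otimes> \<epsilon> x \<in> C" using S by (simp add: C_def centralizer_def)
      then have "\<chi> (\<alpha> x) \<otimes> (inv (\<chi> (\<alpha> x)) \<otimes> \<epsilon> x) \<in> Q2"
        using CQ2 \<chi>Q2[OF x] subgroup.m_closed[OF Q2(1)] by blast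
      then show ?thesis using S by (simp add: inv_cancel_right)
    qed
    have im_\<epsilon>: "\<epsilon> ` Q = Q2"
      using \<epsilon>Q2 F.fmor_card[OF \<epsilon>F] Q2(3) finQ2 by (intro card_subset_eq) auto
    \<comment> \<open>It fixes \<open>E\<close> pointwise, hence is conjugation by some
      \<open>h\<close> and belongs to \<open>G\<close>; then \<nu> is \<kappa> composed with the
      inverse of \<epsilon>.\<close>
    define \<kappa> where "\<kappa> = (\<lambda>x. \<nu> (\<epsilon> x))"
    have \<kappa>: "fmor S F Q \<kappa>" unfolding \<kappa>_def by (rule F.fmor_comp[OF \<epsilon>F \<nu>]) (simp add: im_\<epsilon>)
    have "\<kappa> ` Q = Q" using im_\<epsilon> \<nu>Q2 by (simp add: \<kappa>_def flip: image_image)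
    moreover have "\<forall>e\<in>E. \<kappa> e = e" using \<nu>\<chi> \<chi>\<alpha> EQ by (metis \<kappa>_def)
    ultimately obtain h where h: "h \<in> carrier S" "\<And>x. x \<in> Q \<Longrightarrow> \<kappa> x = h \<otimes> x \<otimes> inv h"
      using fixing[OF \<kappa>] by blast
    have \<kappa>G: "fmor S G Q \<kappa>" using G.fmor_cong[OF G.fmor_conjugation[OF Q h(1)]] h(2) by simp
    have inv\<epsilon>: "fmor S G Q2 (inv_into Q \<epsilon>)" using G.fmor_inv_into[OF \<epsilon>] im_\<epsilon> by simp
    have inv\<epsilon>_mem: "inv_into Q \<epsilon> z \<in> Q" "\<epsilon> (inv_into Q \<epsilon> z) = z" if "z \<in> Q2" for z
      using that im_\<epsilon> by (auto intro: inv_into_into f_inv_into_f)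
    have "fmor S G Q2 (\<lambda>z. \<kappa> (inv_into Q \<epsilon> z))"
      by (rule G.fmor_comp[OF inv\<epsilon> \<kappa>G]) (use inv\<epsilon>_mem in auto)
    then have "fmor S G Q2 \<nu>" by (rule G.fmor_cong) (simp add: \<kappa>_def inv\<epsilon>_mem)
    then show ?thesis by (rule goal)
  qed
qed

text \<open>Rank at least two is measured by cardinality, which injective morphisms visibly
  preserve; the passage to \<open>fp_rank\<close> is made only where the hypothesis of the theorem
  is applied.\<close>

definition big_elem_abelian :: "'a set \<Rightarrow> bool" where
  "big_elem_abelian E \<longleftrightarrow> subgroup E S \<and> (\<forall>x\<in>E. \<forall>y\<in>E. x \<otimes> y = y \<otimes> x) \<and>
     (\<forall>x\<in>E. x [^] p = \<one>) \<and> p ^ 2 \<le> card E"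

lemma fmor_pow:
  assumes f: "fmor S F P f" and x: "x \<in> P"
  shows "f (x [^] (n::nat)) = f x [^] n"
proof -
  interpret f: group_hom "S\<lparr>carrier := P\<rparr>" S f by (rule F.fmor_group_hom[OF f])
  show ?thesis using f.hom_nat_pow[of x n] x nat_pow_consistent by simp
qed

lemma big_elem_abelian_image:
  assumes E: "big_elem_abelian E" "E \<subseteq> Q" and f: "fmor S F Q f"
  shows "big_elem_abelian (f ` E)"
proof -
  have sub: "subgroup E S" using E by (simp add: big_elem_abelian_def)
  have fE: "fmor S F E f" using F.fmor_restrict[OF f sub E(2)] .
  have "f x \<otimes> f y = f y \<otimes> f x" if "x \<in> E" "y \<in> E" for x y
  proof -
    have "f (x \<otimes> y) = f (y \<otimes> x)" using E(1) that by (simp add: big_elem_abelian_def)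
    then show ?thesis using F.fmor_mult[OF fE] that by simp
  qed
  moreover have "f x [^] p = \<one>" if "x \<in> E" for x
  proof -
    have "f x [^] p = f (x [^] p)" using fmor_pow[OF fE that] by simp
    also have "\<dots> = f \<one>" using E(1) that by (simp add: big_elem_abelian_def)
    also have "\<dots> = \<one>" using group_hom.hom_one[OF F.fmor_group_hom[OF fE]] by simp
    finally show ?thesis .
  qed
  ultimately show ?thesis
    using E(1) F.fmor_image[OF fE] F.fmor_card[OF fE] by (auto simp: big_elem_abelian_def)
qed

text \<open>On a cyclic subgroup, conjugation by a normalising \<open>g\<close> is a power map, and
  homomorphisms respect powers. So \<open>g\<close> itself witnesses its membership in the extender
  of \<alpha>.\<close>

lemma aut_agree_cyclic:
  assumes Q: "subgroup Q S" "Q \<noteq> carrier S" "cyclic_subset Q" and rec: "receptive S F Q"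
    and big: "\<And>R. subgroup R S \<Longrightarrow> card Q < card R \<Longrightarrow> agree R"
    and \<alpha>: "fmor S F Q \<alpha>" "\<alpha> ` Q = Q"
  shows "fmor S G Q \<alpha>"
proof -
  have QS: "Q \<subseteq> carrier S" using Q subgroup.subset by auto
  obtain a where a: "a \<in> Q" and gen: "\<And>v. v \<in> Q \<Longrightarrow> \<exists>i::nat. v = a [^] i"
    using Q(3) by (auto simp: cyclic_subset_def)
  define X where "X = extender S Q Q (restrict \<alpha> Q)"
  have X: "subgroup X S" using F.extender_subgroup[OF \<alpha>(1)] \<alpha>(2) by (simp add: X_def)
  have mem_X: "g \<in> X" if g: "g \<in> carrier S" "\<And>x. x \<in> Q \<Longrightarrow> g \<otimes> x \<otimes> inv g \<in> Q" for g
  proof -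
    obtain k where k: "g \<otimes> a \<otimes> inv g = a [^] (k::nat)" using gen[OF g(2)[OF a]] by blast
    have pow: "g \<otimes> x \<otimes> inv g = x [^] k" if x: "x \<in> Q" for x
    proof -
      obtain i where i: "x = a [^] (i::nat)" using gen[OF x] by blast
      have aS: "a \<in> carrier S" using a QS by auto
      have "g \<otimes> x \<otimes> inv g = (a [^] k) [^] i" using conj_pow[OF g(1) aS, of i] k by (simp add: i)
      then show ?thesis using i aS by (simp add: nat_pow_pow mult.commute)
    qed
    have "\<alpha> (g \<otimes> x \<otimes> inv g) = g \<otimes> \<alpha> x \<otimes> inv g" if x: "x \<in> Q" for x
    proof -
      have "\<alpha> x \<in> Q" using x \<alpha>(2) by auto
      then show ?thesis using pow x fmor_pow[OF \<alpha>(1) x] by simp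
    qed
    then show ?thesis using F.mem_extender_iff[OF \<alpha>(1), of g] g \<alpha>(2) unfolding X_def by auto
  qed
  have QX: "Q \<subseteq> X"
  proof
    fix g assume g: "g \<in> Q"
    then show "g \<in> X" using QS Q(1) by (intro mem_X) (auto simp: subgroup.m_closed subgroup.m_inv_closed)
  qed
  obtain g where g: "g \<in> carrier S" "g \<notin> Q" "\<And>r. r \<in> Q \<Longrightarrow> g \<otimes> r \<otimes> inv g \<in> Q"
    using normalizer_growth[OF Q(1,2)] by blast
  then have "Q \<subset> X" using QX mem_X by blast
  then have "card Q < card X" using subgroup_finite[OF X] psubset_card_mono by blast
  then have "agree X" using big X by blast
  obtain \<alpha>' where \<alpha>': "fmor S F X \<alpha>'" "\<forall>x\<in>Q. \<alpha>' x = \<alpha> x"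
    using F.receptive_extend[OF \<alpha>(1)] rec \<alpha>(2) unfolding X_def by auto
  then have "fmor S G X \<alpha>'" using agreeD[OF \<open>agree X\<close>] by blast
  then have "fmor S G Q \<alpha>'" using G.fmor_restrict Q(1) QX by blast
  then show ?thesis by (rule G.fmor_cong) (use \<alpha>' in auto)
qed

text \<open>Only the fixer of the image of \<open>E\<close> under \<beta> is known to be induced by
  \<open>S\<close>, so \<open>aut_agree\<close> is applied to that image, which is normal in
  \<open>Q\<close> because \<beta> is an automorphism.\<close>

lemma aut_agree_noncyclic:
  assumes odd: "odd p" and Q: "subgroup Q S" "\<not> cyclic_subset Q"
    and fa: "fully_automised S p F Q" and rec: "receptive S F Q"
    and big: "\<And>R. subgroup R S \<Longrightarrow> card Q < card R \<Longrightarrow> agree R"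
    and EA: "\<And>E. big_elem_abelian E \<Longrightarrow> agree E"
    and \<alpha>: "fmor S F Q \<alpha>" "\<alpha> ` Q = Q"
  shows "fmor S G Q \<alpha>"
proof -
  interpret Q: finite_p_group "S\<lparr>carrier := Q\<rparr>" p by (rule subgroup_finite_p_group[OF Q(1)])
  have "\<not> Q.cyclic_subset (carrier (S\<lparr>carrier := Q\<rparr>))"
    using Q(2) by (simp add: Q.cyclic_subset_def cyclic_subset_def flip: nat_pow_consistent)
  then obtain E where E: "Q.normal_elem_abelian E" "p ^ 2 \<le> card E"
    and faithful: "\<And>\<sigma> m x. \<lbrakk>\<sigma> \<in> hom (S\<lparr>carrier := Q\<rparr>) (S\<lparr>carrier := Q\<rparr>);
        \<And>x. x \<in> carrier (S\<lparr>carrier := Q\<rparr>) \<Longrightarrow> (\<sigma> ^^ m) x = x; coprime m p;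
        \<And>e. e \<in> E \<Longrightarrow> \<sigma> e = e; x \<in> carrier (S\<lparr>carrier := Q\<rparr>)\<rbrakk> \<Longrightarrow> \<sigma> x = x"
    using Q.noncyclic_imp_faithful_elem_abelian[OF odd] by blast
  have norm: "E \<lhd> S\<lparr>carrier := Q\<rparr>" using E by (simp add: Q.normal_elem_abelian_def)
  then have subEQ: "subgroup E (S\<lparr>carrier := Q\<rparr>)" by (rule normal_imp_subgroup)
  have subE: "subgroup E S" using incl_subgroup[OF Q(1) subEQ] .
  have EQ: "E \<subseteq> Q" using subgroup.subset[OF subEQ] by simp
  have E_big: "big_elem_abelian E"
    using E subE by (auto simp: big_elem_abelian_def Q.normal_elem_abelian_def simp flip: nat_pow_consistent)
  have E_norm: "g \<otimes> e \<otimes> inv g \<in> E" if "g \<in> Q" "e \<in> E" for g e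
    using Q.normal_invE(2)[OF norm, of g e] that m_inv_consistent[OF Q(1)] by simp
  have "\<exists>n. card (F.fixing_auts Q E) = p ^ n"
  proof (rule F.fixing_auts_prime_power[OF Q(1) EQ])
    fix \<sigma> m
    assume \<sigma>: "fmor S F Q \<sigma>" "\<sigma> ` Q = Q" "\<And>x. x \<in> Q \<Longrightarrow> (\<sigma> ^^ m) x = x" "coprime m p" "\<And>e. e \<in> E \<Longrightarrow> \<sigma> e = e"
    have "\<sigma> \<in> hom (S\<lparr>carrier := Q\<rparr>) (S\<lparr>carrier := Q\<rparr>)"
      using \<sigma>(2) F.fmor_mult[OF \<sigma>(1)] by (intro homI) auto
    then show "\<forall>x\<in>Q. \<sigma> x = x" using faithful[of \<sigma> m] \<sigma>(3,4,5) by simp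
  qed
  then obtain \<beta> where \<beta>: "fmor S F Q \<beta>" "\<beta> ` Q = Q"
    and fixing: "\<And>\<kappa>. fmor S F Q \<kappa> \<Longrightarrow> \<kappa> ` Q = Q \<Longrightarrow> \<forall>e\<in>\<beta> ` E. \<kappa> e = e
        \<Longrightarrow> \<exists>h\<in>carrier S. \<forall>x\<in>Q. \<kappa> x = h \<otimes> x \<otimes> inv h"
    using F.fully_automised_fixing_auts[OF Q(1) fa EQ] by blast
  have \<beta>E: "big_elem_abelian (\<beta> ` E)" "\<beta> ` E \<subseteq> Q"
    using big_elem_abelian_image[OF E_big EQ \<beta>(1)] EQ \<beta>(2) by auto
  show ?thesis
  proof (rule aut_agree[OF Q(1) rec big _ \<beta>E(2) _ _ fixing \<alpha>])
    show "subgroup (\<beta> ` E) S" using \<beta>E(1) by (simp add: big_elem_abelian_def)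
    show "agree (f ` \<beta> ` E)" if "fmor S F Q f" for f
      using EA big_elem_abelian_image[OF \<beta>E that] by blast
    fix g e assume "g \<in> Q" "e \<in> \<beta> ` E"
    then obtain x d where xd: "x \<in> Q" "g = \<beta> x" "d \<in> E" "e = \<beta> d" using \<beta>(2) by (metis imageE)
    then have "g \<otimes> e \<otimes> inv g = \<beta> (x \<otimes> d \<otimes> inv x)" using F.fmor_conj[OF \<beta>(1), of x d] EQ by auto
    then show "g \<otimes> e \<otimes> inv g \<in> \<beta> ` E" using E_norm[OF xd(1,3)] by simp
  qed
qed

text \<open>A morphism \<open>g\<close> on a proper subgroup \<open>P\<close> is compared with an
  automorphism of \<open>Q\<close> through morphisms of \<open>G\<close> carrying \<open>P\<close>
  and its image under \<open>g\<close> onto \<open>Q\<close>. For \<open>P = S\<close> no larger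
  subgroup is available, but then \<open>Q = P\<close> and \<open>g\<close> is itself an
  automorphism of \<open>Q\<close>.\<close>

lemma all_agree:
  assumes odd: "odd p" and noncyc: "\<not> cyclic_subset (carrier S)"
    and EA: "\<And>E. big_elem_abelian E \<Longrightarrow> agree E"
  shows "subgroup P S \<Longrightarrow> agree P"
proof (induction "order S - card P" arbitrary: P rule: less_induct)
  case less
  note P = less.prems
  have big: "agree R" if R: "subgroup R S" "card P < card R" for R
  proof -
    have "card R \<le> order S" using subgroup.subset[OF R(1)] by (simp add: order_def card_mono)
    then have "order S - card R < order S - card P" using R(2) by simp
    then show ?thesis using less.hyps R(1) by blast
  qed
  obtain f where f: "fmor S F (normalizer S P) f" and fa: "fully_automised S p F (f ` P)"
    and rec: "receptive S F (f ` P)"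
    using F.saturated_extend_normalizer[OF P] by blast
  define Q where "Q = f ` P"
  have P_norm: "P \<subseteq> normalizer S P"
    using subgroup.subset[OF P] P by (auto simp: F.mem_normalizer[OF P] subgroup.m_closed subgroup.m_inv_closed)
  have fP: "fmor S F P f" using F.fmor_restrict[OF f P P_norm] .
  have Q: "subgroup Q S" "card Q = card P" using F.fmor_image[OF fP] F.fmor_card[OF fP] by (simp_all add: Q_def)
  have aut: "fmor S G Q \<alpha>" if \<alpha>: "fmor S F Q \<alpha>" "\<alpha> ` Q = Q" for \<alpha>
  proof (cases "cyclic_subset Q")
    case True
    then have "Q \<noteq> carrier S" using noncyc by auto
    then show ?thesis using aut_agree_cyclic[OF Q(1) _ True _ _ \<alpha>] rec big Q(2) by (simp add: Q_def)
  next
    case False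
    show ?thesis
      by (rule aut_agree_noncyclic[OF odd Q(1) False _ _ _ EA \<alpha>]) (use fa rec big Q(2) in \<open>auto simp: Q_def\<close>)
  qed
  have to_Q: "\<exists>u. fmor S G R u \<and> u ` R = Q"
    if R: "subgroup R S" "R \<noteq> carrier S" "card R = card P" and h: "fmor S F R h" "h ` R = Q" for R h
  proof -
    obtain u where u: "fmor S F (normalizer S R) u" "u ` R = Q"
      using F.sylow_extend[OF fa rec h(1)] h(2) by (auto simp: Q_def)
    have N: "subgroup (normalizer S R) S" by (rule F.fmor_subgroup[OF u(1)])
    have RN: "R \<subseteq> normalizer S R"
      using subgroup.subset[OF R(1)] R(1) by (auto simp: F.mem_normalizer[OF R(1)] subgroup.m_closed subgroup.m_inv_closed)
    \<comment> \<open>The extension \<open>u\<close> lives on a strictly larger subgroup, where the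
      induction hypothesis applies.\<close>
    have "R \<noteq> normalizer S R" using normalizer_growth[OF R(1,2)] F.mem_normalizer[OF R(1)] by blast
    then have "card P < card (normalizer S R)"
      using RN R(3) psubset_card_mono[OF subgroup_finite[OF N], of R] by auto
    then have "fmor S G (normalizer S R) u" using agreeD[OF big[OF N] u(1)] by blast
    then show ?thesis using G.fmor_restrict[OF _ R(1) RN] u(2) by blast
  qed
  show "agree P"
    unfolding agree_def
  proof (intro allI impI)
    fix g assume g: "fmor S F P g"
    show "fmor S G P g"
    proof (cases "P = carrier S")
      case True
      have eq: "R = carrier S" if "subgroup R S" "card R = card P" for R
        using that True subgroup.subset fin by (intro card_subset_eq) auto
      have "Q = P" "g ` P = P"
        using eq[OF Q] eq[OF F.fmor_image[OF g] F.fmor_card[OF g]] True by auto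
      then show ?thesis using aut g by simp
    next
      case False
      define R where "R = g ` P"
      have R: "subgroup R S" "card R = card P" using F.fmor_image[OF g] F.fmor_card[OF g] by (simp_all add: R_def)
      have RS: "R \<noteq> carrier S"
        using R(2) False subgroup.subset[OF P] fin by (metis card_subset_eq)
      define g' where "g' = inv_into P g"
      have inj: "inj_on g P" using F.fmor_inj_hom(2)[OF g] .
      have g': "fmor S F R g'" "g' ` R = P"
        using F.fmor_inv_into[OF g] inv_into_image_cancel[OF inj order_refl] by (simp_all add: R_def g'_def)
      have "fmor S F R (\<lambda>x. f (g' x))" by (rule F.fmor_comp[OF g'(1) fP]) (simp add: g')
      moreover have "(\<lambda>x. f (g' x)) ` R = Q" using g'(2) by (simp add: Q_def flip: image_image)
      ultimately obtain v where v: "fmor S G R v" "v ` R = Q" using to_Q[OF R(1) RS R(2)] by blast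
      obtain u where u: "fmor S G P u" "u ` P = Q" using to_Q[OF P False refl fP] Q_def by blast
      define u' where "u' = inv_into P u"
      define v' where "v' = inv_into R v"
      have u'G: "fmor S G Q u'" using G.fmor_inv_into[OF u(1)] u(2) by (simp add: u'_def)
      have v'G: "fmor S G Q v'" using G.fmor_inv_into[OF v(1)] v(2) by (simp add: v'_def)
      have inj_uv: "inj_on u P" "inj_on v R" using G.fmor_inj_hom(2) u v by blast+
      have u'u: "u' (u x) = x" if "x \<in> P" for x using inj_uv(1) that by (simp add: u'_def)
      have v'v: "v' (v x) = x" if "x \<in> R" for x using inj_uv(2) that by (simp add: v'_def)
      have u'Q: "u' ` Q = P" using inv_into_image_cancel[OF inj_uv(1) order_refl] u(2) by (simp add: u'_def)
      \<comment> \<open>\<open>w = v g u^-1\<close> is an automorphism of \<open>Q\<close> in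
        \<open>F\<close>, hence in \<open>G\<close>, and \<open>g\<close> is recovered as
        \<open>v^-1 w u\<close>.\<close>
      define w where "w = (\<lambda>y. v (g (u' y)))"
      have "fmor S F Q (\<lambda>y. g (u' y))"
        by (rule F.fmor_comp[OF fmor_le[OF u'G] g]) (simp add: u'Q)
      then have w: "fmor S F Q w" unfolding w_def
        by (rule F.fmor_comp[OF _ fmor_le[OF v(1)]]) (use u'Q in \<open>auto simp: R_def\<close>)
      have "w ` Q = v ` g ` u' ` Q" by (auto simp: w_def)
      then have "w ` Q = Q" using u'Q v(2) by (simp add: R_def)
      then have wG: "fmor S G Q w" using aut[OF w] by blast
      have "fmor S G P (\<lambda>x. w (u x))" by (rule G.fmor_comp[OF u(1) wG]) (simp add: u)
      then have "fmor S G P (\<lambda>x. v' (w (u x)))"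
        by (rule G.fmor_comp[OF _ v'G]) (use u(2) \<open>w ` Q = Q\<close> in auto)
      then show ?thesis by (rule G.fmor_cong) (simp add: w_def u'u v'v R_def)
    qed
  qed
qed

end

theorem theoremB:
  fixes S :: "('a, 'b) monoid_scheme" and p :: nat and F G :: "'a hom_family"
  assumes "Factorial_Ring.prime p" and "odd p"
    and "finite_p_group S p"
    and "\<not> cyclic_group S"
    and "saturated_fusion_system S p G"
    and "saturated_fusion_system S p F"
    and "fusion_le S G F"
    and "\<And>A B. \<lbrakk>subgroup A S; subgroup B S;
            elementary_abelian p (S\<lparr>carrier := A\<rparr>); fp_rank p (S\<lparr>carrier := A\<rparr>) \<ge> 2;
            elementary_abelian p (S\<lparr>carrier := B\<rparr>); fp_rank p (S\<lparr>carrier := B\<rparr>) \<ge> 2\<rbrakk>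
          \<Longrightarrow> G A B = F A B"
  shows "fusion_eq S G F"
proof -
  interpret fusion_pair S p F G
    using assms(3,5,6,7) by (simp add: fusion_pair_def fusion_pair_axioms_def)
  have noncyc: "\<not> cyclic_subset (carrier S)"
  proof
    assume "cyclic_subset (carrier S)"
    then obtain a where a: "a \<in> carrier S" "\<And>v. v \<in> carrier S \<Longrightarrow> \<exists>i::nat. v = a [^]\<^bsub>S\<^esub> i"
      by (auto simp: cyclic_subset_def)
    then have "carrier S \<subseteq> range (\<lambda>n::int. a [^]\<^bsub>S\<^esub> n)" by (metis int_pow_int rangeI subsetI)
    then have "carrier S = range (\<lambda>n::int. a [^]\<^bsub>S\<^esub> n)" using a(1) by auto
    then show False using assms(4) a(1) cyclic_group by blast
  qed
  have elem: "elementary_abelian p (S\<lparr>carrier := A\<rparr>) \<and> fp_rank p (S\<lparr>carrier := A\<rparr>) \<ge> 2"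
    if A: "big_elem_abelian A" for A
  proof -
    have sub: "subgroup A S" and exp: "\<And>x. x \<in> A \<Longrightarrow> x [^]\<^bsub>S\<^esub> p = \<one>\<^bsub>S\<^esub>" and card: "p ^ 2 \<le> card A"
      using A by (auto simp: big_elem_abelian_def)
    interpret A: comm_group "S\<lparr>carrier := A\<rparr>"
      by (rule group.group_comm_groupI[OF subgroup_imp_group[OF sub]])
         (use A in \<open>auto simp: big_elem_abelian_def\<close>)
    have exp': "x [^]\<^bsub>S\<lparr>carrier := A\<rparr>\<^esub> p = \<one>\<^bsub>S\<lparr>carrier := A\<rparr>\<^esub>" if "x \<in> carrier (S\<lparr>carrier := A\<rparr>)" for x
      using exp that nat_pow_consistent[of x p A] by simp
    have "2 \<le> fp_rank p (S\<lparr>carrier := A\<rparr>)"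
      by (rule A.le_fp_rank[OF prime_p _ exp']) (use subgroup_finite[OF sub] card in auto)
    then show ?thesis using A.comm_group_axioms exp' by (simp add: elementary_abelian_def)
  qed
  have EA: "agree E" if E: "big_elem_abelian E" for E
    unfolding agree_def
  proof (intro allI impI)
    fix f assume f: "fmor S F E f"
    have fE: "big_elem_abelian (f ` E)" using big_elem_abelian_image[OF E order_refl f] .
    have subs: "subgroup E S" "subgroup (f ` E) S" using E fE by (auto simp: big_elem_abelian_def)
    \<comment> \<open>The hypothesis compares hom sets between two subgroups of rank at least two;
      with the image of \<open>E\<close> as target both ends qualify.\<close>
    have "restrict f E \<in> F E (f ` E)" using F.restrict_mem[OF f subs(2)] by blast
    then have "restrict f E \<in> G E (f ` E)" using assms(8)[OF subs] elem[OF E] elem[OF fE] by simp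
    then have "fmor S G E (restrict f E)" using G.mem_iff_fmor[OF subs] by blast
    then show "fmor S G E f" by (rule G.fmor_cong) simp
  qed
  show ?thesis
    unfolding fusion_eq_def
  proof (intro allI impI)
    fix P Q assume PQ: "subgroup P S \<and> subgroup Q S"
    have "agree P" using all_agree[OF assms(2) noncyc EA] PQ by blast
    then have "fmor S G P \<phi> \<longleftrightarrow> fmor S F P \<phi>" for \<phi> using agreeD fmor_le by blast
    then show "G P Q = F P Q" using F.mem_iff_fmor[of P Q] G.mem_iff_fmor[of P Q] PQ by blast
  qed
qed

end
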